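(* Let $\mathbb{X}$ be a random cubical filtration in $\mathbb{R}^d$ that is stationary and $R$-dependent for some integer $R\ge0$, and fix an integer $0\le q<d$. Then there exists a Radon measure $\widehat\xi_q$ on $\Delta$ such that $\mathbb{E}[\xi_q^{\mathbb{X}^n}]/|\Lambda^n|$ converges vaguely to $\widehat\xi_q$ as $n\to\infty$, and almost surely $\xi_q^{\mathbb{X}^n}/|\Lambda^n|$ converges vaguely to $\widehat\xi_q$ as $n\to\infty$.
   Context: Fix $d\in\mathbb{N}$. Elementary cubes, cubical sets, (bounded) cubical filtrations $\{X(t)\}_{t\ge0}$ (increasing, right-continuous: $X(t)=\bigcap_{t'>t}X(t')$), real-coefficient cubical homology, birth times $t^{\mathbb{X}}_Q=\inf\{t: Q\subset X(t)\}$, random cubical filtrations (measurable w.r.t. the $\sigma$-field generated by birth times), stationarity (translations by $z\in\mathbb{Z}^d$ preserve the law of $\{t^{\mathbb{X}}_Q\}_Q$) and $R$-dependence (birth-time families of cubes in sets at max-norm distance $>R$ are independent) are as usual. $\Lambda^n=[-n,n]^d$, $|\Lambda^n|=(2n)^d$, $\mathbb{X}^n=\{X(t)\cap\Lambda^n\}_{t\ge0}$. $\Delta=\{(s,t)\in[0,\infty]^2:0\le s<t\le\infty\}$, topologized as homeomorphic to $\{(x,y):0\le x<y\le1\}$. For a bounded cubical filtration $\mathbb{X}$, the $q$th persistence diagram $\xi_q^{\mathbb{X}}=\sum_i\delta_{(b_i,d_i)}$ is the counting measure on $\Delta$ of the $q$th birth–death pairs (from the decomposition $\bigoplus_{t}H_q(X(t))\cong\bigoplus_i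 (z^{b_i})/(z^{d_i})$ as graded $\mathbb{R}[\{z^t\}_{t\ge0}]$-modules); equivalently it is the unique counting measure with $\xi_q^{\mathbb{X}}([0,s]\times(t,\infty])=\beta_q^{\mathbb{X}}(s,t)$ (rank of $H_q(X(s))\to H_q(X(t))$) for all $0\le s\le t<\infty$. $\mathcal{M}(\Delta)$ is the space of Radon measures on $\Delta$ with the vague topology (weakest making $\xi\mapsto\int f\,d\xi$ continuous for all compactly supported continuous $f$). $\mathbb{E}[\xi](A):=\mathbb{E}[\xi(A)]$. *)

theory Defs
  imports "HOL-Probability.Probability" "HOL-Library.Function_Algebras"
begin

text \<open>An elementary interval is [k,k] (represented (k,False)) or [k,k+1] (represented (k,True)).
  An elementary cube in R^d is a list of d elementary intervals (their product).\<close>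

type_synonym cube = "(int \<times> bool) list"

definition cubes :: "nat \<Rightarrow> cube set" where
  "cubes d = {Q. length Q = d}"

definition cube_dim :: "cube \<Rightarrow> nat" where
  "cube_dim Q = card {i. i < length Q \<and> snd (Q ! i)}"

definition lo :: "cube \<Rightarrow> nat \<Rightarrow> int" where "lo Q i = fst (Q ! i)"
definition hi :: "cube \<Rightarrow> nat \<Rightarrow> int" where
  "hi Q i = fst (Q ! i) + (if snd (Q ! i) then 1 else 0)"

definition cube_set :: "cube \<Rightarrow> (nat \<Rightarrow> real) set" where
  "cube_set Q = {x. (\<forall>i<length Q. of_int (lo Q i) \<le> x i \<and> x i \<le> of_int (hi Q i))
                    \<and> (\<forall>i\<ge>length Q. x i = 0)}"

definition is_face :: "cube \<Rightarrow> cube \<Rightarrow> bool" where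
  "is_face P Q \<longleftrightarrow> length P = length Q \<and> cube_set P \<subseteq> cube_set Q"

text \<open>A cubical set in R^d, represented by the collection of its elementary cubes
  (closed under taking faces).  It need not be finite.\<close>
definition cubical_set :: "nat \<Rightarrow> cube set \<Rightarrow> bool" where
  "cubical_set d K \<longleftrightarrow> K \<subseteq> cubes d \<and> (\<forall>Q\<in>K. \<forall>P. is_face P Q \<longrightarrow> P \<in> K)"

definition cubical_filtration :: "nat \<Rightarrow> (real \<Rightarrow> cube set) \<Rightarrow> bool" where
  "cubical_filtration d X \<longleftrightarrow>
     (\<forall>t\<ge>0. cubical_set d (X t)) \<and>
     (\<forall>s t. 0 \<le> s \<longrightarrow> s \<le> t \<longrightarrow> X s \<subseteq> X t) \<and>
     (\<forall>t\<ge>0. X t = (\<Inter>t'\<in>{t<..}. X t'))"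

definition bounded_filtration :: "(real \<Rightarrow> cube set) \<Rightarrow> bool" where
  "bounded_filtration X \<longleftrightarrow> (\<exists>F. finite F \<and> (\<forall>t\<ge>0. X t \<subseteq> F))"

definition birth :: "(real \<Rightarrow> cube set) \<Rightarrow> cube \<Rightarrow> ennreal" where
  "birth X Q = (INF t\<in>{t. 0 \<le> t \<and> Q \<in> X t}. ennreal t)"

text \<open>Lambda^n = [-n,n]^d and X^n(t) = X(t) \<inter> Lambda^n (its elementary cubes are
  exactly the cubes of X(t) contained in Lambda^n).\<close>
definition in_box :: "nat \<Rightarrow> cube \<Rightarrow> bool" where
  "in_box n Q \<longleftrightarrow> (\<forall>i<length Q. - int n \<le> lo Q i \<and> hi Q i \<le> int n)"

definition restrict_box :: "nat \<Rightarrow> (real \<Rightarrow> cube set) \<Rightarrow> (real \<Rightarrow> cube set)" where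
  "restrict_box n X = (\<lambda>t. {Q \<in> X t. in_box n Q})"

definition box_volume :: "nat \<Rightarrow> nat \<Rightarrow> real" where
  "box_volume d n = (2 * real n) ^ d"

definition shift_cube :: "int list \<Rightarrow> cube \<Rightarrow> cube" where
  "shift_cube z Q = map2 (\<lambda>(k, b) zi. (k + zi, b)) Q z"

definition cube_dist :: "cube \<Rightarrow> cube \<Rightarrow> real" where
  "cube_dist P Q = (INF (x, y)\<in>cube_set P \<times> cube_set Q. (SUP i\<in>{..<length P}. \<bar>x i - y i\<bar>))"

definition chain_scale :: "real \<Rightarrow> (cube \<Rightarrow> real) \<Rightarrow> (cube \<Rightarrow> real)" where
  "chain_scale r c = (\<lambda>Q. r * c Q)"

definition vdim :: "(cube \<Rightarrow> real) set \<Rightarrow> nat" where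
  "vdim V = vector_space.dim chain_scale V"

definition chains :: "cube set \<Rightarrow> nat \<Rightarrow> (cube \<Rightarrow> real) set" where
  "chains K q = {c. \<forall>Q. c Q \<noteq> 0 \<longrightarrow> Q \<in> K \<and> cube_dim Q = q}"

text \<open>incidence number [Q : P] of the standard cubical boundary
  d(I_1 x ... x I_d) = sum_j (-1)^{sigma_j} I_1 x ... x dI_j x ... x I_d, d[k,k+1] = [k+1] - [k]\<close>
definition incidence :: "cube \<Rightarrow> cube \<Rightarrow> real" where
  "incidence Q P = (\<Sum>j<length Q. if snd (Q ! j) then
       (-1) ^ card {i. i < j \<and> snd (Q ! i)} *
       ((if P = Q[j := (fst (Q ! j) + 1, False)] then 1 else 0)
        - (if P = Q[j := (fst (Q ! j), False)] then 1 else 0))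
     else 0)"

definition boundary :: "cube set \<Rightarrow> (cube \<Rightarrow> real) \<Rightarrow> (cube \<Rightarrow> real)" where
  "boundary K c = (\<lambda>P. \<Sum>Q\<in>K. c Q * incidence Q P)"

definition cycles :: "cube set \<Rightarrow> nat \<Rightarrow> (cube \<Rightarrow> real) set" where
  "cycles K q = {c \<in> chains K q. boundary K c = (\<lambda>_. 0)}"

definition boundaries :: "cube set \<Rightarrow> nat \<Rightarrow> (cube \<Rightarrow> real) set" where
  "boundaries K q = boundary K ` chains K (Suc q)"

text \<open>rank of H_q(K) -> H_q(L) induced by inclusion K \<subseteq> L (finite):
  the image is (Z_q(K) + B_q(L)) / B_q(L).\<close>
definition hom_rank :: "nat \<Rightarrow> cube set \<Rightarrow> cube set \<Rightarrow> nat" where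
  "hom_rank q K L =
     vdim {(\<lambda>Q. z Q + b Q) | z b. z \<in> cycles K q \<and> b \<in> boundaries L q}
     - vdim (boundaries L q)"

definition betti :: "nat \<Rightarrow> (real \<Rightarrow> cube set) \<Rightarrow> real \<Rightarrow> real \<Rightarrow> nat" where
  "betti q X s t = hom_rank q (X s) (X t)"

definition Delta :: "(ennreal \<times> ennreal) set" where
  "Delta = {(s, t). s < t}"

definition Delta_borel :: "(ennreal \<times> ennreal) measure" where
  "Delta_borel = restrict_space borel Delta"

text \<open>the multiset of birth-death pairs: the unique finite counting measure on Delta with
  xi([0,s] x (t,\<infinity>]) = beta_q(s,t) for all 0 \<le> s \<le> t < \<infinity>\<close>
definition pd_points :: "nat \<Rightarrow> (real \<Rightarrow> cube set) \<Rightarrow> (ennreal \<times> ennreal) multiset" where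
  "pd_points q X = (THE D. set_mset D \<subseteq> Delta \<and>
      (\<forall>s t. 0 \<le> s \<longrightarrow> s \<le> t \<longrightarrow>
         size (filter_mset (\<lambda>(b, d). b \<le> ennreal s \<and> ennreal t < d) D) = betti q X s t))"

definition pd :: "nat \<Rightarrow> (real \<Rightarrow> cube set) \<Rightarrow> (ennreal \<times> ennreal) measure" where
  "pd q X = measure_of Delta (sets Delta_borel)
              (\<lambda>A. of_nat (size (filter_mset (\<lambda>p. p \<in> A) (pd_points q X))))"

definition expected_measure :: "'w measure \<Rightarrow> ('w \<Rightarrow> (ennreal \<times> ennreal) measure)
      \<Rightarrow> (ennreal \<times> ennreal) measure" where
  "expected_measure P Xi = measure_of Delta (sets Delta_borel)
              (\<lambda>A. \<integral>\<^sup>+ w. emeasure (Xi w) A \<partial>P)"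

definition radon_Delta :: "(ennreal \<times> ennreal) measure \<Rightarrow> bool" where
  "radon_Delta \<mu> \<longleftrightarrow> sets \<mu> = sets Delta_borel \<and>
     (\<forall>K. compact K \<and> K \<subseteq> Delta \<longrightarrow> emeasure \<mu> K < \<infinity>)"

definition Cc_Delta :: "(ennreal \<times> ennreal \<Rightarrow> real) \<Rightarrow> bool" where
  "Cc_Delta f \<longleftrightarrow> continuous_on Delta f \<and>
     (\<exists>K. compact K \<and> K \<subseteq> Delta \<and> (\<forall>x\<in>Delta - K. f x = 0))"

definition vague_lim :: "(nat \<Rightarrow> (ennreal \<times> ennreal) measure) \<Rightarrow> (ennreal \<times> ennreal) measure \<Rightarrow> bool" where
  "vague_lim \<mu>s \<mu> \<longleftrightarrow>
     (\<forall>f. Cc_Delta f \<longrightarrow> (\<lambda>n. integral\<^sup>L (\<mu>s n) f) \<longlonglongrightarrow> integral\<^sup>L \<mu> f)"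

definition birth_family :: "nat \<Rightarrow> (real \<Rightarrow> cube set) \<Rightarrow> (cube \<Rightarrow> ennreal)" where
  "birth_family d X = restrict (birth X) (cubes d)"

definition random_cubical_filtration ::
  "'w measure \<Rightarrow> nat \<Rightarrow> ('w \<Rightarrow> real \<Rightarrow> cube set) \<Rightarrow> bool" where
  "random_cubical_filtration P d X \<longleftrightarrow>
     prob_space P \<and> (\<forall>w\<in>space P. cubical_filtration d (X w)) \<and>
     (\<forall>Q\<in>cubes d. (\<lambda>w. birth (X w) Q) \<in> borel_measurable P)"

definition stationary :: "'w measure \<Rightarrow> nat \<Rightarrow> ('w \<Rightarrow> real \<Rightarrow> cube set) \<Rightarrow> bool" where
  "stationary P d X \<longleftrightarrow>
     (\<forall>z. length z = d \<longrightarrow>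
        distr P (PiM (cubes d) (\<lambda>_. borel))
            (\<lambda>w. restrict (\<lambda>Q. birth (X w) (shift_cube z Q)) (cubes d))
        = distr P (PiM (cubes d) (\<lambda>_. borel)) (\<lambda>w. birth_family d (X w)))"

definition R_dependent :: "'w measure \<Rightarrow> nat \<Rightarrow> nat \<Rightarrow> ('w \<Rightarrow> real \<Rightarrow> cube set) \<Rightarrow> bool" where
  "R_dependent P d R X \<longleftrightarrow>
     (\<forall>A B. A \<subseteq> cubes d \<longrightarrow> B \<subseteq> cubes d \<longrightarrow>
        (\<forall>Q\<in>A. \<forall>Q'\<in>B. cube_dist Q Q' > real R) \<longrightarrow>
        prob_space.indep_var P
          (PiM A (\<lambda>_. borel)) (\<lambda>w. restrict (birth (X w)) A)
          (PiM B (\<lambda>_. borel)) (\<lambda>w. restrict (birth (X w)) B))"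

end

theory Submission
  imports Defs
begin

text \<open>
  The persistent Betti numbers of the boxes are nearly additive: inserting one cube changes them by at
  most one, and they are additive over collections of cubes without common faces. Cutting a box into
  translates of a smaller box at mutual distance more than \<open>R\<close> therefore expresses
  them, up to a boundary term, as a sum of pairwise independent, identically distributed bounded
  variables; a second moment estimate along squares and interpolation give almost sure
  convergence of the normalised Betti numbers to constants, for all rational parameters at once.
  The diagrams have normalised mass at most \<open>3 ^ d\<close>, and the Betti numbers are
  their masses of the corners \<open>[0, s] \<times> (t, \<infinity>]\<close>, which determine integrals of
  compactly supported continuous functions up to a uniform error. Hence any two sequences with the
  same corner limits have the same vague limit points, and it suffices to find one limit point. For
  the diagrams of a single good outcome this comes from Helly's theorem on the line, pulled
  back along a space-filling curve.
\<close>

section \<open>Dimension and persistent Betti numbers of cubical sets\<close>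

text \<open>Ranks in homology are treated through dimensions of spans of chains: near additivity,
  monotonicity and the nonnegativity of multiplicities in a diagram all become dimension counts. The
  second moment bound decays like the inverse number of blocks, which in dimension one is only of
  order \<open>1 / n\<close>; at \<open>n = k ^ 2\<close> it becomes summable, hence the squares.
  The limits of the normalised Betti numbers cannot simply be read as corner masses of the limit
  measure: atoms of the limit may sit on the boundary of a corner, and mass may escape to the
  diagonal. For this reason no measure is reconstructed from the limiting function of
  \<open>s\<close> and \<open>t\<close>; two sequences of measures are compared with each other
  instead, where only their corner masses at equal index enter. The curve reduces compactness over
  the square to laws on an interval. It has to be continuous, so that test functions pull back to
  bounded continuous functions, and onto, so that atoms can be lifted one by one.\<close>

context vector_space
begin

lemma subset_span_trans: "A \<subseteq> span B \<Longrightarrow> B \<subseteq> span C \<Longrightarrow> A \<subseteq> span C"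
  by (meson span_minimal subset_trans subspace_span)

text \<open>Chains on all cubes form an infinite-dimensional space, and \<open>dim\<close> is 0 for
  a subspace with an infinite basis. The finite set \<open>F\<close> here and in the following
  bounds keeps every dimension a genuine one.\<close>

lemma finite_basis_exists:
  assumes "V \<subseteq> span F" "finite F"
  obtains B where "B \<subseteq> V" "independent B" "V \<subseteq> span B" "finite B" "card B = dim V"
  using basis_exists[of V] independent_span_bound[of F] assms by (metis subset_trans)

lemma dim_mono_span:
  assumes "U \<subseteq> span V" "V \<subseteq> span F" "finite F"
  shows "dim U \<le> dim V"
proof -
  obtain B where B: "B \<subseteq> V" "V \<subseteq> span B" "finite B" "card B = dim V"
    using finite_basis_exists[OF assms(2,3)] by metis
  have "span V \<subseteq> span B" using B(2) by (metis span_mono span_span)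
  then show ?thesis using assms(1) B dim_le_card[of U B] by auto
qed

lemma dim_le_add_card:
  assumes "S \<subseteq> span (V \<union> G)" "V \<subseteq> span F" "finite F" "finite G"
  shows "dim S \<le> dim V + card G"
proof -
  obtain B where B: "B \<subseteq> V" "V \<subseteq> span B" "finite B" "card B = dim V"
    using finite_basis_exists[OF assms(2,3)] by metis
  have "V \<union> G \<subseteq> span (B \<union> G)"
    using B(2) span_mono[of B "B \<union> G"] span_superset[of "B \<union> G"] by auto
  then have "S \<subseteq> span (B \<union> G)" using assms(1) by (rule subset_span_trans[rotated])
  then have "dim S \<le> card (B \<union> G)" using B(3) assms(4) by (intro dim_le_card) auto
  also have "\<dots> \<le> card B + card G" by (rule card_Un_le)
  finally show ?thesis using B by simp
qed

text \<open>A basis of \<open>W\<close> extends to bases of both spans, and counting it only once in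
  their union gives the bound. Since only inclusions are asked of \<open>W\<close> and
  \<open>S\<close>, no intersection of spans ever has to be computed.\<close>

lemma dim_submodular:
  assumes "W \<subseteq> span U" "W \<subseteq> span V" "S \<subseteq> span (U \<union> V)"
    and "U \<subseteq> span F" "V \<subseteq> span F" "finite F"
  shows "dim S + dim W \<le> dim U + dim V"
proof -
  have sub: "span U \<subseteq> span F" "span V \<subseteq> span F" using assms by (metis span_mono span_span)+
  then have "W \<subseteq> span F" using assms by auto
  then obtain A where A: "A \<subseteq> W" "independent A" "W \<subseteq> span A" "finite A" "card A = dim W"
    using finite_basis_exists assms(6) by metis
  obtain B where B: "A \<subseteq> B" "B \<subseteq> span U" "independent B" "span U \<subseteq> span B"
    using maximal_independent_subset_extend[OF subset_trans[OF A(1) assms(1)] A(2)] by metis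
  obtain C where C: "A \<subseteq> C" "C \<subseteq> span V" "independent C" "span V \<subseteq> span C"
    using maximal_independent_subset_extend[OF subset_trans[OF A(1) assms(2)] A(2)] by metis
  have fB: "finite B" and fC: "finite C"
    using independent_span_bound[OF assms(6) B(3)] independent_span_bound[OF assms(6) C(3)] B C sub
    by auto
  have cB: "card B = dim U" and cC: "card C = dim V"
    using B C basis_card_eq_dim[of B "span U"] basis_card_eq_dim[of C "span V"] by auto
  have "U \<union> V \<subseteq> span (B \<union> (C - A))"
  proof -
    have "U \<subseteq> span B" "V \<subseteq> span C" using B C span_superset by blast+
    moreover have "B \<union> (C - A) = B \<union> C" using B(1) by auto
    ultimately show ?thesis using span_mono[of B "B \<union> C"] span_mono[of C "B \<union> C"] by auto
  qed
  then have "S \<subseteq> span (B \<union> (C - A))" using assms(3) by (rule subset_span_trans[rotated])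
  then have "dim S \<le> card (B \<union> (C - A))" using fB fC by (intro dim_le_card) auto
  also have "\<dots> \<le> card B + card (C - A)" by (rule card_Un_le)
  also have "card (C - A) = card C - card A" using C A fC by (intro card_Diff_subset) auto
  finally show ?thesis using cB cC A card_mono[OF fC C(1)] by linarith
qed

lemma dim_Un_direct:
  assumes "span U \<inter> span V \<subseteq> {0}" "U \<subseteq> span F" "V \<subseteq> span F" "finite F"
  shows "dim (U \<union> V) = dim U + dim V"
proof -
  obtain A where A: "A \<subseteq> U" "independent A" "U \<subseteq> span A" "finite A" "card A = dim U"
    using finite_basis_exists[OF assms(2,4)] by metis
  obtain B where B: "B \<subseteq> V" "independent B" "V \<subseteq> span B" "finite B" "card B = dim V"
    using finite_basis_exists[OF assms(3,4)] by metis
  have "0 \<notin> A" using A(2) dependent_zero by auto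
  then have disj: "A \<inter> B = {}" using A(1) B(1) span_superset[of U] span_superset[of V] assms(1) by blast
  have "independent (A \<union> B)"
  proof (rule ccontr)
    assume "\<not> independent (A \<union> B)"
    then obtain u where u: "\<exists>v\<in>A \<union> B. u v \<noteq> 0" "(\<Sum>v\<in>A \<union> B. scale (u v) v) = 0"
      using dependent_finite[of "A \<union> B"] A B by auto
    define x where "x = (\<Sum>v\<in>A. scale (u v) v)"
    define y where "y = (\<Sum>v\<in>B. scale (u v) v)"
    have xy: "x + y = 0" using u(2) disj A B by (simp add: x_def y_def sum.union_disjoint)
    have xU: "x \<in> span U" unfolding x_def using A(1)
      by (intro span_sum span_scale span_base) auto
    have yV: "y \<in> span V" unfolding y_def using B(1)
      by (intro span_sum span_scale span_base) auto
    have "x = - y" using xy by (simp add: eq_neg_iff_add_eq_0)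
    then have "x \<in> span V" using yV by (simp add: span_neg)
    then have "x = 0" using xU assms(1) by auto
    then have "y = 0" using xy by simp
    have "\<forall>v\<in>A. u v = 0" using independentD[OF A(2) A(4) order_refl] \<open>x = 0\<close> x_def by auto
    moreover have "\<forall>v\<in>B. u v = 0" using independentD[OF B(2) B(4) order_refl] \<open>y = 0\<close> y_def by auto
    ultimately show False using u(1) by auto
  qed
  moreover have "U \<union> V \<subseteq> span (A \<union> B)"
    using A(3) B(3) span_mono[of A "A \<union> B"] span_mono[of B "A \<union> B"] by auto
  ultimately have "dim (U \<union> V) = card (A \<union> B)"
    using A(1) B(1) basis_card_eq_dim[of "A \<union> B" "U \<union> V"] by (metis Un_mono)
  also have "\<dots> = card A + card B" using A B disj by (intro card_Un_disjoint) auto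
  finally show ?thesis using A B by simp
qed

end

section \<open>Chains, cycles and boundaries as subspaces\<close>

interpretation chain: vector_space chain_scale
  by unfold_locales (auto simp: chain_scale_def fun_eq_iff algebra_simps)

lemma sum_fun_apply: "(\<Sum>i\<in>A. f i) x = (\<Sum>i\<in>A. f i x)"
  for f :: "'i \<Rightarrow> 'b \<Rightarrow> 'c::comm_monoid_add"
  by (induction A rule: infinite_finite_induct) auto

lemma vdim_eq_dim: "vdim = chain.dim"
  by (rule ext) (simp add: vdim_def)

lemma boundary_eq_sum: "boundary K c = (\<Sum>Q\<in>K. chain_scale (c Q) (incidence Q))"
  by (rule ext) (simp add: boundary_def sum_fun_apply chain_scale_def)

lemma boundary_mono_neutral:
  assumes "finite L" "K \<subseteq> L" "\<And>Q. c Q \<noteq> 0 \<Longrightarrow> Q \<in> K"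
  shows "boundary L c = boundary K c"
  unfolding boundary_def using assms by (intro ext sum.mono_neutral_right) auto

lemma boundary_add: "boundary K (c + c') = boundary K c + boundary K c'"
  by (rule ext) (simp add: boundary_def algebra_simps sum.distrib)

lemma boundary_scale: "boundary K (chain_scale r c) = chain_scale r (boundary K c)"
  by (rule ext) (simp add: boundary_def chain_scale_def sum_distrib_left mult.assoc)

lemma zero_chain: "(\<lambda>_. 0) = (0 :: cube \<Rightarrow> real)"
  by (rule ext) simp

lemma chains_subspace: "chain.subspace (chains K q)"
  unfolding chain.subspace_def chains_def by (auto simp: chain_scale_def) (metis add_0)+

lemma boundary_zero: "boundary K 0 = 0"
  by (rule ext) (simp add: boundary_def)

lemma cycles_subspace: "chain.subspace (cycles K q)"
  using chains_subspace[of K q]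
  by (auto simp: chain.subspace_def cycles_def boundary_zero boundary_add boundary_scale zero_chain)

lemma boundaries_subspace: "chain.subspace (boundaries K q)"
  unfolding chain.subspace_def boundaries_def
  using chains_subspace[of K "Suc q"]
  by (auto simp: chain.subspace_def image_iff simp flip: boundary_add boundary_scale)
    (metis boundary_zero)

definition unit_chain :: "cube \<Rightarrow> cube \<Rightarrow> real" where
  "unit_chain Q P = (if P = Q then 1 else 0)"

lemma chains_subset_span:
  assumes "finite K"
  shows "chains K q \<subseteq> chain.span (unit_chain ` K)"
proof
  fix c assume c: "c \<in> chains K q"
  have "c = (\<Sum>Q\<in>K. chain_scale (c Q) (unit_chain Q))"
  proof (rule ext)
    fix P
    have "(\<Sum>Q\<in>K. chain_scale (c Q) (unit_chain Q)) P = (\<Sum>Q\<in>K. if P = Q then c Q else 0)"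
      unfolding sum_fun_apply by (intro sum.cong) (auto simp: chain_scale_def unit_chain_def)
    also have "\<dots> = c P" using c assms by (auto simp: chains_def)
    finally show "c P = (\<Sum>Q\<in>K. chain_scale (c Q) (unit_chain Q)) P" by simp
  qed
  also have "\<dots> \<in> chain.span (unit_chain ` K)"
    by (intro chain.span_sum chain.span_scale chain.span_base) auto
  finally show "c \<in> chain.span (unit_chain ` K)" .
qed

lemma boundary_in_span: "boundary L c \<in> chain.span (incidence ` L)"
  unfolding boundary_eq_sum by (intro chain.span_sum chain.span_scale chain.span_base) auto

lemma boundaries_subset_span: "boundaries L q \<subseteq> chain.span (incidence ` L)"
  unfolding boundaries_def using boundary_in_span by auto

lemma cycles_subset_span: "finite K \<Longrightarrow> cycles K q \<subseteq> chain.span (unit_chain ` K)"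
  using chains_subset_span[of K q] by (auto simp: cycles_def)

lemma cycles_boundaries_subset_span:
  assumes "finite K"
  shows "cycles K q \<union> boundaries L q \<subseteq> chain.span (unit_chain ` K \<union> incidence ` L)"
proof -
  have "chain.span (unit_chain ` K) \<subseteq> chain.span (unit_chain ` K \<union> incidence ` L)"
    "chain.span (incidence ` L) \<subseteq> chain.span (unit_chain ` K \<union> incidence ` L)"
    by (intro chain.span_mono; auto)+
  then show ?thesis using cycles_subset_span[OF assms, of q] boundaries_subset_span[of L q] by blast
qed

lemma dim_boundaries_le:
  assumes "finite K" "finite L"
  shows "chain.dim (boundaries L q) \<le> chain.dim (cycles K q \<union> boundaries L q)"
  using cycles_boundaries_subset_span[OF assms(1), of q L] assms
  by (intro chain.dim_mono_span) (auto intro: chain.span_base)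

text \<open>A dimension depends only on the span, so the set of sums in \<open>hom_rank_def\<close>
  may be replaced by a union. Adding the subtracted dimension back avoids truncated subtraction, and
  later inequalities between ranks reduce to dimensions.\<close>

lemma hom_rank_add:
  assumes "finite K" "finite L"
  shows "hom_rank q K L + chain.dim (boundaries L q) = chain.dim (cycles K q \<union> boundaries L q)"
proof -
  let ?S = "{(\<lambda>Q. z Q + b Q) | z b. z \<in> cycles K q \<and> b \<in> boundaries L q}"
  let ?F = "unit_chain ` K \<union> incidence ` L"
  have S: "?S = {z + b | z b. z \<in> cycles K q \<and> b \<in> boundaries L q}"
    by (simp add: plus_fun_def)
  have 1: "?S \<subseteq> chain.span (cycles K q \<union> boundaries L q)"
    unfolding S by (auto intro!: chain.span_add intro: chain.span_base)
  have "cycles K q \<union> boundaries L q \<subseteq> ?S"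
  proof
    fix c assume "c \<in> cycles K q \<union> boundaries L q"
    moreover have "c = c + 0" "c = 0 + c" by simp_all
    ultimately show "c \<in> ?S"
      unfolding S using chain.subspace_0[OF cycles_subspace] chain.subspace_0[OF boundaries_subspace]
      by blast
  qed
  then have 2: "cycles K q \<union> boundaries L q \<subseteq> chain.span ?S"
    using chain.span_superset by blast
  have 3: "cycles K q \<union> boundaries L q \<subseteq> chain.span ?F"
    using cycles_boundaries_subset_span[OF assms(1)] .
  then have "?S \<subseteq> chain.span ?F"
    using 1 by (rule chain.subset_span_trans[rotated])
  then have "chain.dim ?S = chain.dim (cycles K q \<union> boundaries L q)"
    using 1 2 3 assms by (intro antisym chain.dim_mono_span[where F="?F"]) auto
  then show ?thesis
    using dim_boundaries_le[OF assms, of q] by (simp add: hom_rank_def vdim_eq_dim)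
qed

section \<open>Inequalities for ranks under growing complexes\<close>

lemma chains_mono: "K \<subseteq> K' \<Longrightarrow> chains K q \<subseteq> chains K' q"
  by (auto simp: chains_def)

lemma cycles_mono:
  assumes "finite K'" "K \<subseteq> K'"
  shows "cycles K q \<subseteq> cycles K' q"
  using boundary_mono_neutral[OF assms] chains_mono[OF assms(2), of q]
  by (auto simp: cycles_def chains_def)

lemma boundaries_mono:
  assumes "finite L'" "L \<subseteq> L'"
  shows "boundaries L q \<subseteq> boundaries L' q"
proof -
  have "boundary L c = boundary L' c" if "c \<in> chains L (Suc q)" for c
    using boundary_mono_neutral[OF assms, of c] that by (auto simp: chains_def)
  then show ?thesis using chains_mono[OF assms(2), of "Suc q"] by (auto simp: boundaries_def)
qed

text \<open>Evaluation at \<open>Q\<close> is a linear functional on the larger cycle space, and its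
  kernel lies in \<open>cycles K q\<close>; one extra vector spans the rest.\<close>

lemma cycles_insert_subset_span:
  assumes "finite K"
  obtains z where "cycles (insert Q K) q \<subseteq> chain.span (insert z (cycles K q))"
proof (cases "\<exists>z\<in>cycles (insert Q K) q. z Q \<noteq> 0")
  case False
  have "c \<in> cycles K q" if c: "c \<in> cycles (insert Q K) q" for c
  proof -
    have "c \<in> chains K q" using c False by (auto simp: cycles_def chains_def)
    moreover have "boundary (insert Q K) c = boundary K c"
      using calculation assms by (intro boundary_mono_neutral) (auto simp: chains_def)
    ultimately show ?thesis using c by (auto simp: cycles_def)
  qed
  then show ?thesis using that[of 0] chain.span_superset[of "insert 0 (cycles K q)"] by blast
next
  case True
  then obtain z where z: "z \<in> cycles (insert Q K) q" "z Q \<noteq> 0" by auto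
  have "c \<in> chain.span (insert z (cycles K q))" if c: "c \<in> cycles (insert Q K) q" for c
  proof -
    define e where "e = c - chain_scale (c Q / z Q) z"
    have e: "e \<in> cycles (insert Q K) q"
      unfolding e_def using c z cycles_subspace
      by (intro chain.subspace_diff chain.subspace_scale) auto
    have "e Q = 0" using z by (simp add: e_def chain_scale_def)
    then have "e \<in> chains K q" using e by (auto simp: cycles_def chains_def)
    moreover have "boundary (insert Q K) e = boundary K e"
      using calculation assms by (intro boundary_mono_neutral) (auto simp: chains_def)
    ultimately have "e \<in> cycles K q" using e by (auto simp: cycles_def)
    then have "e + chain_scale (c Q / z Q) z \<in> chain.span (insert z (cycles K q))"
      by (intro chain.span_add chain.span_scale chain.span_base) auto
    then show ?thesis by (simp add: e_def)
  qed
  then show ?thesis using that[of z] by blast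
qed

lemma cycles_Un_subset_span:
  assumes "finite K" "finite D"
  shows "\<exists>G. finite G \<and> card G \<le> card D \<and> cycles (K \<union> D) q \<subseteq> chain.span (cycles K q \<union> G)"
  using assms(2)
proof (induction D rule: finite_induct)
  case empty
  show ?case by (rule exI[of _ "{}"]) (auto intro: chain.span_base)
next
  case (insert Q D)
  then obtain G where G: "finite G" "card G \<le> card D"
    "cycles (K \<union> D) q \<subseteq> chain.span (cycles K q \<union> G)" by auto
  obtain z where z: "cycles (insert Q (K \<union> D)) q \<subseteq> chain.span (insert z (cycles (K \<union> D) q))"
    using cycles_insert_subset_span[of "K \<union> D"] assms insert by (metis finite_Un)
  have "insert z (cycles (K \<union> D) q) \<subseteq> chain.span (cycles K q \<union> insert z G)"
    using G(3) chain.span_mono[of "cycles K q \<union> G" "cycles K q \<union> insert z G"]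
    by (auto intro: chain.span_base)
  then have "cycles (insert Q (K \<union> D)) q \<subseteq> chain.span (cycles K q \<union> insert z G)"
    by (rule chain.subset_span_trans[OF z])
  then show ?case using G insert
    by (intro exI[of _ "insert z G"]) (auto simp: card_insert_if)
qed

lemma boundaries_subset_span_Un:
  assumes "finite L'" "L \<subseteq> L'"
  shows "boundaries L' q \<subseteq> chain.span (boundaries L q \<union> incidence ` (L' - L))"
proof
  fix b assume "b \<in> boundaries L' q"
  then obtain c where c: "c \<in> chains L' (Suc q)" "b = boundary L' c" by (auto simp: boundaries_def)
  define c1 where "c1 = (\<lambda>Q. if Q \<in> L then c Q else 0)"
  have "b = boundary L c + boundary (L' - L) c"
    unfolding c(2) boundary_eq_sum using assms by (simp add: add.commute sum.subset_diff)
  also have "boundary L c = boundary L c1" by (auto simp: boundary_def c1_def fun_eq_iff)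
  finally have b: "b = boundary L c1 + boundary (L' - L) c" .
  have "c1 \<in> chains L (Suc q)" using c by (auto simp: chains_def c1_def)
  then have "boundary L c1 \<in> boundaries L q" by (auto simp: boundaries_def)
  moreover have "boundary (L' - L) c \<in> chain.span (boundaries L q \<union> incidence ` (L' - L))"
    using boundary_in_span[of "L' - L" c] chain.span_mono[of "incidence ` (L' - L)"] by blast
  ultimately show "b \<in> chain.span (boundaries L q \<union> incidence ` (L' - L))"
    unfolding b by (intro chain.span_add) (auto intro: chain.span_base)
qed

text \<open>By \<open>hom_rank_add\<close> the rank is a difference of two dimensions, both monotone
  in the complexes. The first grows by at most one for each new cube of either complex, the
  subtracted one by at most one for each new cube of \<open>L'\<close>.\<close>

lemma hom_rank_lipschitz:
  assumes fin: "finite K'" "finite L'" and sub: "K \<subseteq> K'" "L \<subseteq> L'"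
  shows "\<bar>real (hom_rank q K' L') - real (hom_rank q K L)\<bar> \<le> card (K' - K) + card (L' - L)"
proof -
  have fK: "finite K" "finite L" using assms finite_subset by auto
  let ?Z = "cycles K q" and ?B = "boundaries L q" and ?Z' = "cycles K' q" and ?B' = "boundaries L' q"
  have "K \<union> (K' - K) = K'" using sub by auto
  then obtain G where G: "finite G" "card G \<le> card (K' - K)" "?Z' \<subseteq> chain.span (?Z \<union> G)"
    using cycles_Un_subset_span[OF fK(1), of "K' - K" q] fin by auto
  let ?I = "incidence ` (L' - L)"
  have cI: "card ?I \<le> card (L' - L)" "finite ?I" using fin card_image_le[of "L' - L" incidence] by auto
  have B': "?B' \<subseteq> chain.span (?B \<union> ?I)" by (rule boundaries_subset_span_Un[OF fin(2) sub(2)])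
  have "?Z' \<union> ?B' \<subseteq> chain.span ((?Z \<union> ?B) \<union> (G \<union> ?I))"
    using G(3) B' chain.span_mono[of "?Z \<union> G" "(?Z \<union> ?B) \<union> (G \<union> ?I)"]
      chain.span_mono[of "?B \<union> ?I" "(?Z \<union> ?B) \<union> (G \<union> ?I)"] by blast
  then have "chain.dim (?Z' \<union> ?B') \<le> chain.dim (?Z \<union> ?B) + card (G \<union> ?I)"
    by (rule chain.dim_le_add_card[OF _ cycles_boundaries_subset_span[OF fK(1)]]) (use fK G cI in auto)
  moreover have "card (G \<union> ?I) \<le> card G + card ?I" by (rule card_Un_le)
  moreover have "chain.dim ?B' \<le> chain.dim ?B + card ?I"
    by (rule chain.dim_le_add_card[OF B' boundaries_subset_span]) (use fK cI in auto)
  moreover have "chain.dim ?B \<le> chain.dim ?B'"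
    using boundaries_mono[OF fin(2) sub(2), of q] boundaries_subset_span[of L' q] fin
    by (intro chain.dim_mono_span) (auto intro: chain.span_base)
  moreover have "chain.dim (?Z \<union> ?B) \<le> chain.dim (?Z' \<union> ?B')"
    using boundaries_mono[OF fin(2) sub(2), of q] cycles_mono[OF fin(1) sub(1), of q]
      cycles_boundaries_subset_span[OF fin(1), of q L'] fin
    by (intro chain.dim_mono_span) (auto intro: chain.span_base)
  ultimately show ?thesis
    using hom_rank_add[OF fin, of q] hom_rank_add[OF fK, of q] G(2) cI(1) by linarith
qed

lemma dim_cycles_le_card: "finite K \<Longrightarrow> chain.dim (cycles K q) \<le> card K"
  using chain.dim_le_card[OF cycles_subset_span[of K q]] card_image_le[of K unit_chain]
  by (meson finite_imageI le_trans)

text \<open>Submodularity with \<open>cycles K q\<close> in the role of the intersection. It bounds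
  the number of points of a diagram: summed along a filtration, the increments of
  \<open>chain.dim\<close> of the cycles telescope.\<close>

lemma hom_rank_increment_le:
  assumes "finite K'" "finite L" "K \<subseteq> K'"
  shows "hom_rank q K' L + chain.dim (cycles K q) \<le> hom_rank q K L + chain.dim (cycles K' q)"
proof -
  have fK: "finite K" using assms finite_subset by auto
  let ?F = "unit_chain ` K' \<union> incidence ` L"
  have F: "cycles K' q \<union> boundaries L q \<subseteq> chain.span ?F"
    by (rule cycles_boundaries_subset_span[OF assms(1)])
  have "chain.dim (cycles K' q \<union> boundaries L q) + chain.dim (cycles K q)
      \<le> chain.dim (cycles K' q) + chain.dim (cycles K q \<union> boundaries L q)"
    using F cycles_mono[OF assms(1,3), of q] assms
    by (intro chain.dim_submodular[where F="?F"])
      (auto intro: chain.span_base)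
  then show ?thesis using hom_rank_add[OF assms(1,2), of q] hom_rank_add[OF fK assms(2), of q]
    by linarith
qed

lemma hom_rank_mono:
  assumes "finite K'" "finite L" "K \<subseteq> K'"
  shows "hom_rank q K L \<le> hom_rank q K' L"
proof -
  have fK: "finite K" using assms finite_subset by auto
  have "chain.dim (cycles K q \<union> boundaries L q) \<le> chain.dim (cycles K' q \<union> boundaries L q)"
    using cycles_mono[OF assms(1,3), of q] cycles_boundaries_subset_span[OF assms(1), of q L] assms
    by (intro chain.dim_mono_span) (auto intro: chain.span_base)
  then show ?thesis using hom_rank_add[OF assms(1,2), of q] hom_rank_add[OF fK assms(2), of q]
    by linarith
qed

lemma hom_rank_le_card:
  assumes "finite K" "finite L"
  shows "hom_rank q K L \<le> card K"
proof -
  have "chain.dim (cycles K q \<union> boundaries L q) + chain.dim {} \<le> chain.dim (cycles K q) + chain.dim (boundaries L q)"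
    using cycles_boundaries_subset_span[OF assms(1), of q L] assms
    by (intro chain.dim_submodular[where F="unit_chain ` K \<union> incidence ` L"] chain.span_superset) auto
  then show ?thesis
    using hom_rank_add[OF assms, of q] dim_cycles_le_card[OF assms(1), of q] by linarith
qed

text \<open>This becomes the nonnegativity of multiplicities in a diagram. It is submodularity for
  \<open>Z(K') + B(L)\<close> and \<open>Z(K) + B(L')\<close>, whose sum is
  \<open>Z(K') + B(L')\<close> and whose intersection contains \<open>Z(K) + B(L)\<close>; the
  dimensions of the boundary spaces cancel.\<close>

lemma hom_rank_rectangle:
  assumes fin: "finite K'" "finite L'" and sub: "K \<subseteq> K'" "L \<subseteq> L'"
  shows "hom_rank q K' L' + hom_rank q K L \<le> hom_rank q K' L + hom_rank q K L'"
proof -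
  have fK: "finite K" "finite L" using assms finite_subset by auto
  let ?F = "unit_chain ` K' \<union> incidence ` L'"
  let ?U = "cycles K' q \<union> boundaries L q" and ?V = "cycles K q \<union> boundaries L' q"
  note Z = cycles_mono[OF fin(1) sub(1), of q] and B = boundaries_mono[OF fin(2) sub(2), of q]
  have F: "cycles K' q \<union> boundaries L' q \<subseteq> chain.span ?F"
    by (rule cycles_boundaries_subset_span[OF fin(1)])
  have "chain.dim (cycles K' q \<union> boundaries L' q) + chain.dim (cycles K q \<union> boundaries L q)
      \<le> chain.dim ?U + chain.dim ?V"
    using F Z B fin by (intro chain.dim_submodular[where F="?F"]) (auto intro: chain.span_base)
  then show ?thesis
    using hom_rank_add[OF fin, of q] hom_rank_add[OF fK, of q]
      hom_rank_add[OF fin(1) fK(2), of q] hom_rank_add[OF fK(1) fin(2), of q] by linarith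
qed

section \<open>Additivity over collections without common faces\<close>

definition face_closed :: "cube set \<Rightarrow> bool" where
  "face_closed S \<longleftrightarrow> (\<forall>Q\<in>S. \<forall>P. incidence Q P \<noteq> 0 \<longrightarrow> P \<in> S)"

lemma face_closed_UN: "(\<And>i. i \<in> I \<Longrightarrow> face_closed (S i)) \<Longrightarrow> face_closed (\<Union>i\<in>I. S i)"
  unfolding face_closed_def by blast

lemma boundary_supported:
  assumes "face_closed S" "K \<subseteq> S" "P \<notin> S"
  shows "boundary K c P = 0"
  unfolding boundary_def using assms by (intro sum.neutral) (auto simp: face_closed_def)

definition supported_on :: "cube set \<Rightarrow> (cube \<Rightarrow> real) set" where
  "supported_on S = {c. \<forall>Q. c Q \<noteq> 0 \<longrightarrow> Q \<in> S}"

lemma supported_on_subspace: "chain.subspace (supported_on S)"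
  unfolding chain.subspace_def supported_on_def
  by (auto simp: chain_scale_def) (metis add_0)+

lemma span_supported_on: "V \<subseteq> supported_on S \<Longrightarrow> chain.span V \<subseteq> supported_on S"
  by (rule chain.span_minimal[OF _ supported_on_subspace])

text \<open>Face-closedness keeps the boundary of a chain on \<open>S1\<close> inside
  \<open>S1\<close>, and likewise for \<open>S2\<close>. So cycles and boundaries split by support,
  and chains with disjoint supports meet only in 0; both dimensions of \<open>hom_rank_add\<close>
  therefore add up.\<close>

lemma hom_rank_Un_disjoint:
  assumes S: "face_closed S1" "face_closed S2" "S1 \<inter> S2 = {}"
    and sub: "K1 \<subseteq> S1" "K2 \<subseteq> S2" "L1 \<subseteq> S1" "L2 \<subseteq> S2"
    and fin: "finite K1" "finite K2" "finite L1" "finite L2"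
  shows "hom_rank q (K1 \<union> K2) (L1 \<union> L2) = hom_rank q K1 L1 + hom_rank q K2 L2"
proof -
  define cut :: "cube set \<Rightarrow> (cube \<Rightarrow> real) \<Rightarrow> cube \<Rightarrow> real"
    where "cut T c = (\<lambda>Q. if Q \<in> T then c Q else 0)" for T c
  have split: "c = cut T1 c + cut T2 c" if "c \<in> chains (T1 \<union> T2) r" "T1 \<subseteq> S1" "T2 \<subseteq> S2" for c T1 T2 r
    using that S(3) by (force simp: cut_def chains_def fun_eq_iff)
  have cutc: "cut T1 c \<in> chains T1 r" "cut T2 c \<in> chains T2 r" if "c \<in> chains (T1 \<union> T2) r" for c T1 T2 r
    using that by (auto simp: cut_def chains_def)
  have bsplit: "boundary (T1 \<union> T2) c = boundary T1 (cut T1 c) + boundary T2 (cut T2 c)"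
    if "T1 \<subseteq> S1" "T2 \<subseteq> S2" "finite T1" "finite T2" for c T1 T2
  proof -
    have "boundary (T1 \<union> T2) c = boundary T1 c + boundary T2 c"
      unfolding boundary_eq_sum using that S(3) by (intro sum.union_disjoint) auto
    also have "boundary T1 c = boundary T1 (cut T1 c)" by (auto simp: boundary_def cut_def fun_eq_iff)
    also have "boundary T2 c = boundary T2 (cut T2 c)" by (auto simp: boundary_def cut_def fun_eq_iff)
    finally show ?thesis .
  qed
  let ?Z = "cycles (K1 \<union> K2) q" and ?B = "boundaries (L1 \<union> L2) q"
  let ?Z1 = "cycles K1 q" and ?B1 = "boundaries L1 q" and ?Z2 = "cycles K2 q" and ?B2 = "boundaries L2 q"
  have Z12: "?Z1 \<subseteq> ?Z" "?Z2 \<subseteq> ?Z" "?B1 \<subseteq> ?B" "?B2 \<subseteq> ?B"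
    using fin by (simp_all add: cycles_mono boundaries_mono)
  have Z: "?Z \<subseteq> chain.span (?Z1 \<union> ?Z2)"
  proof
    fix c assume c: "c \<in> ?Z"
    then have cc: "c \<in> chains (K1 \<union> K2) q" by (simp add: cycles_def)
    have b0: "boundary K1 (cut K1 c) + boundary K2 (cut K2 c) = 0"
      using c bsplit[OF sub(1,2) fin(1,2), of c] by (simp add: cycles_def zero_chain)
    \<comment> \<open>On \<open>S1\<close> the second boundary vanishes, off \<open>S1\<close> the
      first one does; as they sum to 0, both are 0 everywhere.\<close>
    have "boundary K1 (cut K1 c) P = 0 \<and> boundary K2 (cut K2 c) P = 0" for P
    proof (cases "P \<in> S1")
      case True
      then have "boundary K2 (cut K2 c) P = 0" using boundary_supported[OF S(2) sub(2)] S(3) by auto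
      then show ?thesis using fun_cong[OF b0, of P] by simp
    next
      case False
      then have "boundary K1 (cut K1 c) P = 0" using boundary_supported[OF S(1) sub(1)] by auto
      then show ?thesis using fun_cong[OF b0, of P] by simp
    qed
    then have "cut K1 c \<in> ?Z1" "cut K2 c \<in> ?Z2" using cutc[OF cc] by (auto simp: cycles_def)
    then have "cut K1 c + cut K2 c \<in> chain.span (?Z1 \<union> ?Z2)"
      by (intro chain.span_add chain.span_base) auto
    then show "c \<in> chain.span (?Z1 \<union> ?Z2)" using split[OF cc sub(1,2)] by simp
  qed
  have B: "?B \<subseteq> chain.span (?B1 \<union> ?B2)"
  proof
    fix b assume "b \<in> ?B"
    then obtain c where c: "c \<in> chains (L1 \<union> L2) (Suc q)" "b = boundary (L1 \<union> L2) c"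
      by (auto simp: boundaries_def)
    have "boundary L1 (cut L1 c) \<in> ?B1" "boundary L2 (cut L2 c) \<in> ?B2"
      using cutc[OF c(1)] by (auto simp: boundaries_def)
    then have "boundary L1 (cut L1 c) + boundary L2 (cut L2 c) \<in> chain.span (?B1 \<union> ?B2)"
      by (intro chain.span_add chain.span_base) auto
    then show "b \<in> chain.span (?B1 \<union> ?B2)" using c bsplit[OF sub(3,4) fin(3,4)] by simp
  qed
  have sp: "?Z1 \<union> ?B1 \<subseteq> supported_on S1" "?Z2 \<union> ?B2 \<subseteq> supported_on S2"
    using sub boundary_supported[OF S(1) sub(3)] boundary_supported[OF S(2) sub(4)]
    by (auto simp: supported_on_def cycles_def chains_def boundaries_def)
  have direct: "chain.span U \<inter> chain.span V \<subseteq> {0}" if "U \<subseteq> supported_on S1" "V \<subseteq> supported_on S2" for U V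
    using span_supported_on[OF that(1)] span_supported_on[OF that(2)] S(3)
    by (force simp: supported_on_def fun_eq_iff)
  let ?F = "unit_chain ` (K1 \<union> K2) \<union> incidence ` (L1 \<union> L2)"
  have F: "?Z \<union> ?B \<subseteq> chain.span ?F" "finite ?F"
    using cycles_boundaries_subset_span[of "K1 \<union> K2" q "L1 \<union> L2"] fin by auto
  have sB: "?B1 \<union> ?B2 \<subseteq> ?Z \<union> ?B" "?Z1 \<union> ?B1 \<union> (?Z2 \<union> ?B2) \<subseteq> ?Z \<union> ?B" using Z12 by blast+
  have "chain.dim ?B = chain.dim (?B1 \<union> ?B2)"
    using B Z12 F sB by (intro antisym chain.dim_mono_span[where F="?F"]) (auto intro: chain.span_base)
  also have "\<dots> = chain.dim ?B1 + chain.dim ?B2"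
    using sp F sB by (intro chain.dim_Un_direct[where F="?F"] direct) auto
  finally have dB: "chain.dim ?B = chain.dim ?B1 + chain.dim ?B2" .
  have "?Z \<union> ?B \<subseteq> chain.span ((?Z1 \<union> ?B1) \<union> (?Z2 \<union> ?B2))"
    using Z B chain.span_mono[of "?Z1 \<union> ?Z2" "(?Z1 \<union> ?B1) \<union> (?Z2 \<union> ?B2)"]
      chain.span_mono[of "?B1 \<union> ?B2" "(?Z1 \<union> ?B1) \<union> (?Z2 \<union> ?B2)"] by blast
  then have "chain.dim (?Z \<union> ?B) = chain.dim ((?Z1 \<union> ?B1) \<union> (?Z2 \<union> ?B2))"
    using F sB by (intro antisym chain.dim_mono_span[where F="?F"]) (auto intro: chain.span_base)
  also have "\<dots> = chain.dim (?Z1 \<union> ?B1) + chain.dim (?Z2 \<union> ?B2)"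
    using sp F sB by (intro chain.dim_Un_direct[where F="?F"] direct) auto
  finally show ?thesis
    using dB hom_rank_add[of "K1 \<union> K2" "L1 \<union> L2" q] hom_rank_add[OF fin(1,3), of q]
      hom_rank_add[OF fin(2,4), of q] fin by simp
qed

lemma hom_rank_UN_disjoint:
  assumes "finite I" "\<And>i. i \<in> I \<Longrightarrow> face_closed (S i)" "disjoint_family_on S I" "finite K" "finite L"
  shows "hom_rank q (K \<inter> (\<Union>i\<in>I. S i)) (L \<inter> (\<Union>i\<in>I. S i)) = (\<Sum>i\<in>I. hom_rank q (K \<inter> S i) (L \<inter> S i))"
  using assms
proof (induction I rule: finite_induct)
  case empty
  then show ?case using hom_rank_le_card[of "{}" "{}" q] by simp
next
  case (insert i I)
  have "hom_rank q ((K \<inter> S i) \<union> (K \<inter> (\<Union>i\<in>I. S i))) ((L \<inter> S i) \<union> (L \<inter> (\<Union>i\<in>I. S i)))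
     = hom_rank q (K \<inter> S i) (L \<inter> S i) + hom_rank q (K \<inter> (\<Union>i\<in>I. S i)) (L \<inter> (\<Union>i\<in>I. S i))"
    using insert.prems insert.hyps
    by (intro hom_rank_Un_disjoint[of "S i" "\<Union>i\<in>I. S i"] face_closed_UN)
      (auto simp: disjoint_family_on_def)
  moreover have "disjoint_family_on S I" using insert.prems by (auto simp: disjoint_family_on_def)
  ultimately show ?case using insert by (simp add: Int_Un_distrib)
qed

section \<open>Translations, boxes and blocks\<close>

lemma length_shift_cube [simp]: "length z = length Q \<Longrightarrow> length (shift_cube z Q) = length Q"
  by (simp add: shift_cube_def)

lemma shift_cube_nth:
  "length z = length Q \<Longrightarrow> i < length Q \<Longrightarrow> shift_cube z Q ! i = (fst (Q ! i) + z ! i, snd (Q ! i))"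
  by (simp add: shift_cube_def case_prod_unfold)

lemma shift_cube_uminus:
  "length z = length Q \<Longrightarrow> shift_cube (map uminus z) (shift_cube z Q) = Q"
  "length z = length Q \<Longrightarrow> shift_cube z (shift_cube (map uminus z) Q) = Q"
  by (intro nth_equalityI; simp add: shift_cube_nth)+

lemma shift_cube_eq_iff:
  assumes "length z = length P" "length z = length Q"
  shows "shift_cube z P = shift_cube z Q \<longleftrightarrow> P = Q"
  using shift_cube_uminus(1)[OF assms(1)] shift_cube_uminus(1)[OF assms(2)] by metis

lemma shift_cube_update:
  assumes "length z = length Q" "j < length Q"
  shows "shift_cube z (Q[j := (k, b)]) = (shift_cube z Q)[j := (k + z ! j, b)]"
  using assms by (intro nth_equalityI) (auto simp: shift_cube_nth nth_list_update)

lemma cube_dim_shift_cube: "length z = length Q \<Longrightarrow> cube_dim (shift_cube z Q) = cube_dim Q"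
  unfolding cube_dim_def by (rule arg_cong[where f=card]) (auto simp: shift_cube_nth)

lemma incidence_shift_cube:
  assumes "length z = length Q" "length z = length P"
  shows "incidence (shift_cube z Q) (shift_cube z P) = incidence Q P"
proof -
  have eq: "shift_cube z P = (shift_cube z Q)[j := (fst (shift_cube z Q ! j) + a, False)]
      \<longleftrightarrow> P = Q[j := (fst (Q ! j) + a, False)]" if "j < length Q" for j a
  proof -
    have "(shift_cube z Q)[j := (fst (shift_cube z Q ! j) + a, False)]
        = shift_cube z (Q[j := (fst (Q ! j) + a, False)])"
      using that assms by (simp add: shift_cube_nth shift_cube_update algebra_simps)
    then show ?thesis using assms by (simp add: shift_cube_eq_iff)
  qed
  have c: "{i. i < j \<and> snd (shift_cube z Q ! i)} = {i. i < j \<and> snd (Q ! i)}" if "j < length Q" for j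
    using that assms by (auto simp: shift_cube_nth)
  show ?thesis
    unfolding incidence_def
  proof (rule sum.cong)
    fix j assume "j \<in> {..<length Q}"
    then have j: "j < length Q" by simp
    have s: "snd (shift_cube z Q ! j) = snd (Q ! j)" using j assms by (simp add: shift_cube_nth)
    show "(if snd (shift_cube z Q ! j) then
       (-1) ^ card {i. i < j \<and> snd (shift_cube z Q ! i)} *
       ((if shift_cube z P = (shift_cube z Q)[j := (fst (shift_cube z Q ! j) + 1, False)] then 1 else 0)
        - (if shift_cube z P = (shift_cube z Q)[j := (fst (shift_cube z Q ! j), False)] then 1 else 0))
     else 0) = (if snd (Q ! j) then
       (-1) ^ card {i. i < j \<and> snd (Q ! i)} *
       ((if P = Q[j := (fst (Q ! j) + 1, False)] then 1 else 0)
        - (if P = Q[j := (fst (Q ! j), False)] then 1 else 0))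
     else (0 :: real))"
      by (simp only: s c[OF j] eq[OF j, of 0, unfolded add_0_right] eq[OF j, of 1])
  qed (use assms in simp)
qed

lemma incidence_nonzero:
  assumes "incidence Q P \<noteq> 0"
  obtains j a where "j < length Q" "snd (Q ! j)" "a = 0 \<or> a = 1" "P = Q[j := (fst (Q ! j) + a, False)]"
proof -
  obtain j where "j < length Q" "snd (Q ! j)"
      "P = Q[j := (fst (Q ! j) + 1, False)] \<or> P = Q[j := (fst (Q ! j), False)]"
    using assms unfolding incidence_def
    by (smt (verit, ccfv_threshold) lessThan_iff mult_eq_0_iff sum.neutral)
  then show ?thesis using that[of j 0] that[of j 1] by auto
qed

lemma incidence_length: "incidence Q P \<noteq> 0 \<Longrightarrow> length P = length Q"
  by (erule incidence_nonzero) simp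

text \<open>Push-forward of a chain along the translation. Cubes of any other length get 0, because
  \<open>shift_cube\<close> truncates them.\<close>

definition shift_chain :: "int list \<Rightarrow> (cube \<Rightarrow> real) \<Rightarrow> cube \<Rightarrow> real" where
  "shift_chain z c = (\<lambda>Q. if length Q = length z then c (shift_cube (map uminus z) Q) else 0)"

lemma shift_chain_apply: "length z = length Q \<Longrightarrow> shift_chain z c (shift_cube z Q) = c Q"
  by (simp add: shift_chain_def shift_cube_uminus)

lemma shift_chain_hom: "module_hom chain_scale chain_scale (shift_chain z)"
  by unfold_locales (auto simp: shift_chain_def chain_scale_def fun_eq_iff algebra_simps)

lemma dim_shift_chain_le:
  assumes "V \<subseteq> chain.span F" "finite F"
  shows "chain.dim (shift_chain z ` V) \<le> chain.dim V"
proof -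
  interpret module_hom chain_scale chain_scale "shift_chain z" by (rule shift_chain_hom)
  obtain B where B: "V \<subseteq> chain.span B" "finite B" "card B = chain.dim V"
    using chain.finite_basis_exists[OF assms] by metis
  have "shift_chain z ` V \<subseteq> chain.span (shift_chain z ` B)"
    unfolding span_image using B(1) by auto
  then have "chain.dim (shift_chain z ` V) \<le> card (shift_chain z ` B)"
    using B by (intro chain.dim_le_card) auto
  also have "\<dots> \<le> card B" using B by (intro card_image_le) auto
  finally show ?thesis using B by simp
qed

lemma shift_chain_inverse:
  assumes "c \<in> supported_on (cubes (length z))"
  shows "shift_chain (map uminus z) (shift_chain z c) = c"
proof
  fix Q
  have [simp]: "uminus \<circ> uminus = (id :: int \<Rightarrow> int)" by auto
  show "shift_chain (map uminus z) (shift_chain z c) Q = c Q"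
    using assms shift_cube_uminus(1)[of z Q] by (auto simp: shift_chain_def supported_on_def cubes_def)
qed

lemma shift_chain_chains:
  assumes "K \<subseteq> cubes (length z)" "c \<in> chains K q"
  shows "shift_chain z c \<in> chains (shift_cube z ` K) q"
proof -
  have "Q \<in> shift_cube z ` K \<and> cube_dim Q = q" if "shift_chain z c Q \<noteq> 0" for Q
  proof -
    have l: "length Q = length z" and "c (shift_cube (map uminus z) Q) \<noteq> 0"
      using that by (auto simp: shift_chain_def split: if_splits)
    then have "shift_cube (map uminus z) Q \<in> K" "cube_dim (shift_cube (map uminus z) Q) = q"
      using assms by (auto simp: chains_def)
    then show ?thesis using l shift_cube_uminus(2)[of z Q] cube_dim_shift_cube[of "map uminus z" Q]
      by (metis image_eqI length_map)
  qed
  then show ?thesis by (simp add: chains_def)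
qed

lemma boundary_shift_chain:
  assumes "K \<subseteq> cubes (length z)"
  shows "boundary (shift_cube z ` K) (shift_chain z c) = shift_chain z (boundary K c)"
proof
  fix P
  have len: "length z = length Q" if "Q \<in> K" for Q using that assms by (auto simp: cubes_def)
  have inj: "inj_on (shift_cube z) K"
    by (intro inj_onI) (metis len shift_cube_eq_iff)
  have "boundary (shift_cube z ` K) (shift_chain z c) P
      = (\<Sum>Q\<in>K. shift_chain z c (shift_cube z Q) * incidence (shift_cube z Q) P)"
    by (simp add: boundary_def sum.reindex[OF inj])
  also have "\<dots> = (\<Sum>Q\<in>K. c Q * incidence (shift_cube z Q) P)"
    by (intro sum.cong refl) (simp only: shift_chain_apply len)
  also have "\<dots> = shift_chain z (boundary K c) P"
  proof (cases "length P = length z")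
    case True
    have "incidence (shift_cube z Q) P = incidence Q (shift_cube (map uminus z) P)" if "Q \<in> K" for Q
      using incidence_shift_cube[OF len[OF that], of "shift_cube (map uminus z) P"] shift_cube_uminus(2)[of z P] True
      by simp
    then show ?thesis using True by (simp add: shift_chain_def boundary_def)
  next
    case False
    have "incidence (shift_cube z Q) P = 0" if "Q \<in> K" for Q
    proof (rule ccontr)
      assume "incidence (shift_cube z Q) P \<noteq> 0"
      then have "length P = length (shift_cube z Q)" by (rule incidence_length)
      then show False using len[OF that] False by simp
    qed
    then show ?thesis using False by (simp add: shift_chain_def)
  qed
  finally show "boundary (shift_cube z ` K) (shift_chain z c) P = shift_chain z (boundary K c) P" .
qed

lemma face_closed_cubes: "face_closed (cubes d)"
  unfolding face_closed_def cubes_def using incidence_length by auto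

text \<open>The shift is injective on chains of cubes of length \<open>length z\<close>, so
  dimensions cannot drop. The reverse inequality comes from the same statement for the opposite
  shift.\<close>

lemma dim_shift_cube_le:
  assumes K: "K \<subseteq> cubes (length z)" and L: "L \<subseteq> cubes (length z)" and fin: "finite K" "finite L"
  shows "chain.dim (cycles K q \<union> boundaries L q)
      \<le> chain.dim (cycles (shift_cube z ` K) q \<union> boundaries (shift_cube z ` L) q)"
    and "chain.dim (boundaries L q) \<le> chain.dim (boundaries (shift_cube z ` L) q)"
proof -
  interpret module_hom chain_scale chain_scale "shift_chain z" by (rule shift_chain_hom)
  let ?K = "shift_cube z ` K" and ?L = "shift_cube z ` L"
  have Z: "shift_chain z ` cycles K q \<subseteq> cycles ?K q"
    using boundary_shift_chain[OF K] shift_chain_chains[OF K]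
    by (auto simp: cycles_def zero_chain zero)
  have B: "shift_chain z ` boundaries L q \<subseteq> boundaries ?L q"
    using boundary_shift_chain[OF L] shift_chain_chains[OF L]
    by (auto simp: boundaries_def simp flip: boundary_shift_chain[OF L])
  have sup: "cycles K q \<union> boundaries L q \<subseteq> supported_on (cubes (length z))"
    using K boundary_supported[OF face_closed_cubes L]
    by (auto simp: supported_on_def cycles_def chains_def boundaries_def)
  \<comment> \<open>The opposite shift recovers \<open>V\<close> from its image, and a linear image
    never has larger dimension.\<close>
  have *: "chain.dim V \<le> chain.dim W"
    if "V \<subseteq> supported_on (cubes (length z))" "shift_chain z ` V \<subseteq> W" "W \<subseteq> chain.span F" "finite F" for V W F
  proof -
    have "V = shift_chain (map uminus z) ` shift_chain z ` V"
      using that(1) shift_chain_inverse by (force simp: image_image)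
    then have "chain.dim V \<le> chain.dim (shift_chain z ` V)"
      using dim_shift_chain_le[of "shift_chain z ` V" F "map uminus z"] that by auto
    also have "\<dots> \<le> chain.dim W"
      using that chain.span_superset[of W] by (intro chain.dim_mono_span[where F=F]) auto
    finally show ?thesis .
  qed
  show "chain.dim (cycles K q \<union> boundaries L q) \<le> chain.dim (cycles ?K q \<union> boundaries ?L q)"
    using *[OF sup _ cycles_boundaries_subset_span[of ?K q ?L]] Z B fin by auto
  show "chain.dim (boundaries L q) \<le> chain.dim (boundaries ?L q)"
    using *[OF _ B boundaries_subset_span] sup fin by auto
qed

lemma hom_rank_shift_cube:
  assumes K: "K \<subseteq> cubes (length z)" and L: "L \<subseteq> cubes (length z)" and fin: "finite K" "finite L"
  shows "hom_rank q (shift_cube z ` K) (shift_cube z ` L) = hom_rank q K L"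
proof -
  let ?K = "shift_cube z ` K" and ?L = "shift_cube z ` L"
  have inv: "shift_cube (map uminus z) ` shift_cube z ` M = M" if "M \<subseteq> cubes (length z)" for M
  proof -
    have "shift_cube (map uminus z) (shift_cube z Q) = Q" if "Q \<in> M" for Q
      using that \<open>M \<subseteq> cubes (length z)\<close> shift_cube_uminus(1)[of z Q] by (auto simp: cubes_def)
    then show ?thesis by (simp add: image_image cong: image_cong)
  qed
  have sub: "?K \<subseteq> cubes (length (map uminus z))" "?L \<subseteq> cubes (length (map uminus z))"
    using K L by (auto simp: cubes_def)
  have fin': "finite ?K" "finite ?L" using fin by auto
  show ?thesis
    using dim_shift_cube_le[OF assms, of q] dim_shift_cube_le[OF sub fin', of q]
      hom_rank_add[OF fin, of q] hom_rank_add[OF fin', of q]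
    unfolding inv[OF K] inv[OF L] by linarith
qed

section \<open>Cubes of a box and separated blocks\<close>

definition box_cubes :: "nat \<Rightarrow> nat \<Rightarrow> cube set" where
  "box_cubes d n = {Q \<in> cubes d. in_box n Q}"

text \<open>Each coordinate is chosen independently among \<open>2 * n + 1\<close> points and
  \<open>2 * n\<close> unit intervals. This is the origin of the count
  \<open>(4 * n + 1) ^ d\<close>, which serves as normalisation until the volume
  \<open>(2 * n) ^ d\<close> returns at the end.\<close>

lemma box_cubes_eq:
  "box_cubes d n = {Q. set Q \<subseteq> ({- int n..int n} \<times> {False} \<union> {- int n..int n - 1} \<times> {True}) \<and> length Q = d}"
proof -
  have "in_box n Q \<longleftrightarrow> set Q \<subseteq> ({- int n..int n} \<times> {False} \<union> {- int n..int n - 1} \<times> {True})" for Q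
  proof -
    have "in_box n Q \<longleftrightarrow> (\<forall>p\<in>set Q. - int n \<le> fst p \<and> fst p + (if snd p then 1 else 0) \<le> int n)"
      unfolding in_box_def lo_def hi_def by (metis in_set_conv_nth)
    also have "\<dots> \<longleftrightarrow> (\<forall>p\<in>set Q. p \<in> {- int n..int n} \<times> {False} \<union> {- int n..int n - 1} \<times> {True})"
      by (intro ball_cong) (auto split: if_splits)
    finally show ?thesis by auto
  qed
  then show ?thesis by (auto simp: box_cubes_def cubes_def)
qed

lemma finite_box_cubes [simp]: "finite (box_cubes d n)"
  unfolding box_cubes_eq by (rule finite_lists_length_eq) auto

lemma card_box_cubes: "card (box_cubes d n) = (4 * n + 1) ^ d"
proof -
  have "card ({- int n..int n} \<times> {False} \<union> {- int n..int n - 1} \<times> {True}) = 4 * n + 1"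
    by (subst card_Un_disjoint) (auto simp: card_cartesian_product)
  then show ?thesis unfolding box_cubes_eq by (subst card_lists_length_eq) auto
qed

definition block :: "nat \<Rightarrow> nat \<Rightarrow> int list \<Rightarrow> cube set" where
  "block d m z = shift_cube z ` box_cubes d m"

lemma block_iff:
  assumes "length z = d"
  shows "Q \<in> block d m z \<longleftrightarrow>
    length Q = d \<and> (\<forall>i<d. z ! i - int m \<le> lo Q i \<and> hi Q i \<le> z ! i + int m)" (is "?l \<longleftrightarrow> ?r")
proof
  assume ?l
  then show ?r using assms
    by (auto simp: block_def box_cubes_def cubes_def in_box_def lo_def hi_def shift_cube_nth)
next
  assume r: ?r
  let ?P = "shift_cube (map uminus z) Q"
  have "?P \<in> box_cubes d m"
    using r assms by (auto simp: box_cubes_def cubes_def in_box_def lo_def hi_def shift_cube_nth)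
  moreover have "Q = shift_cube z ?P" using shift_cube_uminus(2)[of z Q] r assms by simp
  ultimately show ?l unfolding block_def by blast
qed

lemma finite_block [simp]: "finite (block d m z)"
  by (simp add: block_def)

lemma card_block:
  assumes "length z = d"
  shows "card (block d m z) = (4 * m + 1) ^ d"
proof -
  have "inj_on (shift_cube z) (box_cubes d m)"
    using assms by (intro inj_onI) (simp add: box_cubes_def cubes_def shift_cube_eq_iff)
  then show ?thesis by (simp only: block_def card_image card_box_cubes)
qed

lemma face_closed_block:
  assumes "length z = d"
  shows "face_closed (block d m z)"
  unfolding face_closed_def
proof (intro ballI allI impI)
  fix Q P assume Q: "Q \<in> block d m z" and "incidence Q P \<noteq> 0"
  then obtain j a where ja: "j < length Q" "snd (Q ! j)" "a = 0 \<or> a = 1" "P = Q[j := (fst (Q ! j) + a, False)]"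
    by (elim incidence_nonzero)
  have "lo Q i \<le> lo P i \<and> hi P i \<le> hi Q i" if "i < length Q" for i
    using ja that by (auto simp: lo_def hi_def nth_list_update)
  then show "P \<in> block d m z"
    using Q ja(4) unfolding block_iff[OF assms] by (auto intro: order_trans)
qed

definition grid :: "nat \<Rightarrow> nat \<Rightarrow> int list set" where
  "grid d J = {v. set v \<subseteq> {- int J..int J} \<and> length v = d}"

lemma finite_grid [simp]: "finite (grid d J)"
  unfolding grid_def by (rule finite_lists_length_eq) auto

lemma card_grid: "card (grid d J) = (2 * J + 1) ^ d"
proof -
  have "card {- int J..int J} = 2 * J + 1" by (simp add: nat_eq_iff)
  then show ?thesis unfolding grid_def by (subst card_lists_length_eq) auto
qed

definition lattice_point :: "nat \<Rightarrow> int list \<Rightarrow> int list" where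
  "lattice_point N v = map (\<lambda>x. int N * x) v"

lemma length_lattice_point [simp]: "length (lattice_point N v) = length v"
  by (simp add: lattice_point_def)

text \<open>In some coordinate the centres differ by at least \<open>N\<close>, while a block
  extends \<open>m\<close> to either side, which leaves a gap of \<open>N - 2 * m\<close>. This
  yields disjointness for \<open>2 * m < N\<close> as well as distance above \<open>R\<close> for
  \<open>N = 2 * m + R + 1\<close>.\<close>

lemma blocks_separated:
  assumes "length v = d" "length v' = d" "v \<noteq> v'" "Q \<in> block d m (lattice_point N v)"
    "Q' \<in> block d m (lattice_point N v')"
  obtains i where "i < d" "hi Q i + int N \<le> lo Q' i + 2 * int m \<or> hi Q' i + int N \<le> lo Q i + 2 * int m"
proof -
  obtain i where i: "i < d" "v ! i \<noteq> v' ! i" using assms nth_equalityI by metis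
  have b: "hi Q i \<le> int N * v ! i + int m" "int N * v ! i - int m \<le> lo Q i"
    "hi Q' i \<le> int N * v' ! i + int m" "int N * v' ! i - int m \<le> lo Q' i"
    using assms i by (auto simp: block_iff lattice_point_def)
  consider "v ! i + 1 \<le> v' ! i" | "v' ! i + 1 \<le> v ! i" using i by linarith
  then show ?thesis
  proof cases
    case 1
    then have "int N * (v ! i + 1) \<le> int N * v' ! i" by (intro mult_left_mono) auto
    then show ?thesis using that[of i] i b by (auto simp: algebra_simps)
  next
    case 2
    then have "int N * (v' ! i + 1) \<le> int N * v ! i" by (intro mult_left_mono) auto
    then show ?thesis using that[of i] i b by (auto simp: algebra_simps)
  qed
qed

lemma lo_le_hi: "lo Q i \<le> hi Q i"
  by (simp add: lo_def hi_def)

lemma disjoint_blocks: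
  assumes "2 * m < N"
  shows "disjoint_family_on (\<lambda>v. block d m (lattice_point N v)) (grid d J)"
  unfolding disjoint_family_on_def
proof (intro ballI impI)
  fix v v' assume v: "v \<in> grid d J" "v' \<in> grid d J" "v \<noteq> v'"
  show "block d m (lattice_point N v) \<inter> block d m (lattice_point N v') = {}"
  proof (rule ccontr)
    assume "\<not> ?thesis"
    then obtain Q where "Q \<in> block d m (lattice_point N v)" "Q \<in> block d m (lattice_point N v')" by auto
    moreover have "length v = d" "length v' = d" using v by (auto simp: grid_def)
    ultimately obtain i where "hi Q i + int N \<le> lo Q i + 2 * int m"
      using blocks_separated[of v d v' Q m N Q] v(3) by metis
    then show False using lo_le_hi[of Q i] assms by linarith
  qed
qed

lemma block_subset_box:
  assumes "v \<in> grid d J" "N * J + m \<le> n"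
  shows "block d m (lattice_point N v) \<subseteq> box_cubes d n"
proof
  fix Q assume Q: "Q \<in> block d m (lattice_point N v)"
  have v: "length v = d" "\<And>i. i < d \<Longrightarrow> v ! i \<in> {- int J..int J}"
    using assms(1) nth_mem by (auto simp: grid_def subset_iff)
  have le: "int N * int J + int m \<le> int n" using assms(2) by (metis of_nat_add of_nat_le_iff of_nat_mult)
  have "- int n \<le> lo Q i \<and> hi Q i \<le> int n" if "i < d" for i
  proof -
    have "int N * v ! i \<le> int N * int J" "int N * (- int J) \<le> int N * v ! i"
      using v(2)[OF that] by (intro mult_left_mono; auto)+
    then show ?thesis using Q v(1) that le by (auto simp: block_iff lattice_point_def)
  qed
  then show "Q \<in> box_cubes d n" using Q v(1) by (auto simp: box_cubes_def cubes_def in_box_def block_iff)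
qed

text \<open>Each of the two complexes loses at most the cubes of \<open>F\<close> outside
  \<open>U\<close>, hence the factor 2.\<close>

lemma hom_rank_restrict:
  assumes K: "K \<subseteq> F" "L \<subseteq> F" and U: "U \<subseteq> F" and F: "finite F"
  shows "\<bar>real (hom_rank q K L) - real (hom_rank q (K \<inter> U) (L \<inter> U))\<bar> \<le> 2 * (real (card F) - real (card U))"
proof -
  have fin: "finite K" "finite L" using K F finite_subset by blast+
  have cD: "real (card (M - M \<inter> U)) \<le> real (card F) - real (card U)" if "M \<subseteq> F" for M
  proof -
    have "card (M - M \<inter> U) \<le> card (F - U)" using that F by (intro card_mono) auto
    also have "\<dots> = card F - card U" using U F finite_subset by (intro card_Diff_subset) auto
    finally show ?thesis using card_mono[OF F U] by linarith
  qed
  have "\<bar>real (hom_rank q K L) - real (hom_rank q (K \<inter> U) (L \<inter> U))\<bar> \<le> card (K - K \<inter> U) + card (L - L \<inter> U)"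
    by (rule hom_rank_lipschitz[OF fin]) auto
  then show ?thesis using cD[OF K(1)] cD[OF K(2)] by simp
qed

text \<open>On the union of the blocks the rank is exactly additive, so the error is at most twice
  the number of cubes of the box that lie in no block.\<close>

lemma hom_rank_blocks:
  assumes "2 * m < N" "N * J + m \<le> n" "K \<subseteq> box_cubes d n" "L \<subseteq> box_cubes d n"
  shows "\<bar>real (hom_rank q K L) - (\<Sum>v\<in>grid d J. real (hom_rank q (K \<inter> block d m (lattice_point N v)) (L \<inter> block d m (lattice_point N v))))\<bar>
    \<le> 2 * (real ((4 * n + 1) ^ d) - real (((2 * J + 1) * (4 * m + 1)) ^ d))"
proof -
  let ?b = "\<lambda>v. block d m (lattice_point N v)"
  let ?U = "\<Union>v\<in>grid d J. ?b v"
  have U: "?U \<subseteq> box_cubes d n" using block_subset_box[OF _ assms(2)] by blast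
  have fin: "finite K" "finite L" using assms(3,4) finite_subset finite_box_cubes by blast+
  have "card ?U = (\<Sum>v\<in>grid d J. card (?b v))"
    using disjoint_blocks[OF assms(1)] by (intro card_UN_disjoint) (auto simp: disjoint_family_on_def)
  also have "\<dots> = (2 * J + 1) ^ d * (4 * m + 1) ^ d"
  proof -
    have "card (?b v) = (4 * m + 1) ^ d" if "v \<in> grid d J" for v
      using that by (intro card_block) (simp add: grid_def)
    then show ?thesis by (simp only: sum_constant card_grid of_nat_id cong: sum.cong)
  qed
  finally have cU: "card ?U = ((2 * J + 1) * (4 * m + 1)) ^ d" by (simp only: power_mult_distrib)
  have "hom_rank q (K \<inter> ?U) (L \<inter> ?U) = (\<Sum>v\<in>grid d J. hom_rank q (K \<inter> ?b v) (L \<inter> ?b v))"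
    using disjoint_blocks[OF assms(1)] fin
    by (intro hom_rank_UN_disjoint face_closed_block finite_grid) (auto simp: grid_def)
  then show ?thesis
    using hom_rank_restrict[OF assms(3,4) U finite_box_cubes, of q]
    by (simp only: cU card_box_cubes of_nat_sum)
qed

lemma box_cubes_mono: "n \<le> n' \<Longrightarrow> box_cubes d n \<subseteq> box_cubes d n'"
  by (force simp: box_cubes_def in_box_def)

text \<open>This controls the passage from square box sizes to all box sizes.\<close>

lemma hom_rank_box_diff:
  assumes "n \<le> n'" "K \<subseteq> box_cubes d n'" "L \<subseteq> box_cubes d n'"
  shows "\<bar>real (hom_rank q K L) - real (hom_rank q (K \<inter> box_cubes d n) (L \<inter> box_cubes d n))\<bar>
    \<le> 2 * (real ((4 * n' + 1) ^ d) - real ((4 * n + 1) ^ d))"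
  using hom_rank_restrict[OF assms(2,3) box_cubes_mono[OF assms(1)] finite_box_cubes, of q]
  by (simp only: card_box_cubes)

lemma cube_set_nonempty: "cube_set Q \<noteq> {}"
proof -
  have "(\<lambda>i. if i < length Q then of_int (lo Q i) else 0) \<in> cube_set Q"
    using lo_le_hi[of Q] by (auto simp: cube_set_def)
  then show ?thesis by auto
qed

lemma cube_dist_blocks:
  assumes "length v = d" "length v' = d" "v \<noteq> v'" "Q \<in> block d m (lattice_point N v)"
    "Q' \<in> block d m (lattice_point N v')" "N = 2 * m + R + 1"
  shows "cube_dist Q Q' > real R"
proof -
  obtain i where i: "i < d" "hi Q i + int N \<le> lo Q' i + 2 * int m \<or> hi Q' i + int N \<le> lo Q i + 2 * int m"
    using blocks_separated[OF assms(1-5)] by metis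
  have len: "length Q = d" "length Q' = d" using assms by (auto simp: block_iff)
  \<comment> \<open>A strict bound above \<open>R\<close> would not survive the infimum; the spacing
    provides the full gap \<open>R + 1\<close>.\<close>
  have "real R + 1 \<le> cube_dist Q Q'"
    unfolding cube_dist_def
  proof (rule cINF_greatest)
    show "cube_set Q \<times> cube_set Q' \<noteq> {}" using cube_set_nonempty by auto
    fix p assume "p \<in> cube_set Q \<times> cube_set Q'"
    then obtain x y where p: "p = (x, y)" "x \<in> cube_set Q" "y \<in> cube_set Q'" by auto
    have "real_of_int (lo Q i) \<le> x i" "x i \<le> real_of_int (hi Q i)" "real_of_int (lo Q' i) \<le> y i" "y i \<le> real_of_int (hi Q' i)"
      using p len i by (auto simp: cube_set_def)
    moreover have "real_of_int (hi Q i) + real R + 1 \<le> real_of_int (lo Q' i) \<or> real_of_int (hi Q' i) + real R + 1 \<le> real_of_int (lo Q i)"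
      using i(2) assms(6) by linarith
    ultimately have "real R + 1 \<le> \<bar>x i - y i\<bar>" by linarith
    also have "\<dots> \<le> (SUP i\<in>{..<length Q}. \<bar>x i - y i\<bar>)"
      using i len by (intro cSUP_upper) auto
    finally show "real R + 1 \<le> (case p of (x, y) \<Rightarrow> (SUP i\<in>{..<length Q}. \<bar>x i - y i\<bar>))"
      by (simp add: p)
  qed
  then show ?thesis by linarith
qed

section \<open>Vague convergence on the half-plane above the diagonal\<close>

text \<open>The function of period 2 in Schoenberg's construction, with value 0 on
  \<open>[0, 1/3]\<close> and 1 on \<open>[2/3, 1]\<close>. Clipping a cosine makes continuity and
  periodicity immediate, and \<open>cos (pi / 3) = 1 / 2\<close> places the thresholds.\<close>

definition zigzag :: "real \<Rightarrow> real" where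
  "zigzag t = max 0 (min 1 (1 / 2 - cos (pi * t)))"

lemma zigzag_bounds: "0 \<le> zigzag t" "zigzag t \<le> 1"
  by (auto simp: zigzag_def)

lemma zigzag_periodic: "zigzag (2 * real m + t) = zigzag t"
proof (induction m)
  case (Suc m)
  have "pi * (2 * real (Suc m) + t) = pi * (2 * real m + t) + 2 * pi" by (simp add: algebra_simps)
  then have "zigzag (2 * real (Suc m) + t) = zigzag (2 * real m + t)"
    by (simp only: zigzag_def cos_periodic)
  then show ?case using Suc by simp
qed simp

lemma zigzag_eq_0:
  assumes "0 \<le> t" "t \<le> 1 / 3"
  shows "zigzag t = 0"
proof -
  have "cos (pi / 3) \<le> cos (pi * t)"
    using assms pi_gt_zero by (intro cos_monotone_0_pi_le) (auto simp: field_simps)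
  then show ?thesis by (simp add: zigzag_def cos_60)
qed

lemma zigzag_eq_1:
  assumes "2 / 3 \<le> t" "t \<le> 1"
  shows "zigzag t = 1"
proof -
  have "cos (pi * t) \<le> cos (2 * pi / 3)"
    using assms pi_gt_zero by (intro cos_monotone_0_pi_le) (auto simp: field_simps)
  also have "\<dots> = - (1 / 2)" by (simp add: cos_120)
  finally show ?thesis by (simp add: zigzag_def)
qed

lemma continuous_zigzag: "continuous_on S zigzag"
  unfolding zigzag_def by (intro continuous_intros)

text \<open>Schoenberg's space-filling curve: on the Cantor set, evaluating \<^const>\<open>zigzag\<close> at \<open>3 ^ k * t\<close>
  reads off the \<open>k\<close>-th ternary digit, so the two coordinates get the even and the odd digits.\<close>
definition schoenberg :: "nat \<Rightarrow> real \<Rightarrow> real" where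
  "schoenberg p t = (\<Sum>k. zigzag (3 ^ (2 * k + p) * t) * (1 / 2) ^ Suc k)"

lemma schoenberg_term_le: "norm (zigzag x * (1 / 2) ^ Suc k) \<le> (1 / 2) ^ Suc k"
  using zigzag_bounds[of x] by (simp add: mult_left_le_one_le)

lemma half_sums: "(\<lambda>k. (1 / 2 :: real) ^ Suc k) sums 1"
  using power_half_series .

lemma continuous_schoenberg: "continuous_on UNIV (schoenberg p)"
proof -
  have "uniform_limit UNIV (\<lambda>n t. \<Sum>k<n. zigzag (3 ^ (2 * k + p) * t) * (1 / 2) ^ Suc k)
     (schoenberg p) sequentially"
    unfolding schoenberg_def[abs_def]
    by (rule Weierstrass_m_test[OF schoenberg_term_le sums_summable[OF half_sums]])
  then show ?thesis
    by (rule uniform_limit_theorem[rotated])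
      (auto intro!: always_eventually continuous_intros continuous_on_compose2[OF continuous_zigzag])
qed

lemma schoenberg_bounds: "0 \<le> schoenberg p t" "schoenberg p t \<le> 1"
proof -
  have s: "summable (\<lambda>k. zigzag (3 ^ (2 * k + p) * t) * (1 / 2) ^ Suc k)"
    by (rule summable_comparison_test'[OF sums_summable[OF half_sums] schoenberg_term_le])
  show "0 \<le> schoenberg p t"
    unfolding schoenberg_def using zigzag_bounds by (intro suminf_nonneg[OF s]) auto
  have "schoenberg p t \<le> (\<Sum>k. (1 / 2) ^ Suc k)"
    unfolding schoenberg_def
  proof (rule suminf_le[OF _ s sums_summable[OF half_sums]])
    show "zigzag (3 ^ (2 * k + p) * t) * (1 / 2) ^ Suc k \<le> (1 / 2) ^ Suc k" for k
      using schoenberg_term_le[of "3 ^ (2 * k + p) * t" k] unfolding real_norm_def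
      by (rule order_trans[OF abs_ge_self])
  qed
  then show "schoenberg p t \<le> 1" using sums_unique[OF half_sums] by linarith
qed

lemma binary_digits_exist:
  assumes "0 \<le> u" "u \<le> 1"
  obtains a :: "nat \<Rightarrow> real" where "\<And>k. a k = 0 \<or> a k = 1" "(\<lambda>k. a k * (1 / 2) ^ Suc k) sums u"
proof -
  \<comment> \<open>Remainders of the doubling map, with digit 1 from 1/2 on. They stay in
    \<open>[0, 1]\<close>, and \<open>u = 1\<close> simply produces the digit 1 forever.\<close>
  define r where "r = rec_nat u (\<lambda>_ x. 2 * x - (if x \<ge> 1 / 2 then 1 else 0))"
  define a :: "nat \<Rightarrow> real" where "a k = (if r k \<ge> 1 / 2 then 1 else 0)" for k
  have r: "r 0 = u" "r (Suc k) = 2 * r k - a k" for k by (simp_all add: r_def a_def)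
  have rb: "0 \<le> r k \<and> r k \<le> 1" for k
    by (induction k) (use assms in \<open>auto simp: r a_def\<close>)
  have p: "(\<Sum>k<n. a k * (1 / 2) ^ Suc k) = u - r n * (1 / 2) ^ n" for n
    by (induction n) (auto simp: r field_simps)
  have "(\<lambda>n. r n * (1 / 2) ^ n) \<longlonglongrightarrow> 0"
  proof (rule Lim_null_comparison)
    show "\<forall>\<^sub>F n in sequentially. norm (r n * (1 / 2) ^ n) \<le> (1 / 2) ^ n"
      using rb by (auto simp: mult_left_le_one_le)
  qed (intro LIMSEQ_realpow_zero; simp)
  then have "(\<lambda>n. u - r n * (1 / 2) ^ n) \<longlonglongrightarrow> u - 0" by (intro tendsto_intros)
  then have "(\<lambda>k. a k * (1 / 2) ^ Suc k) sums u" by (simp only: sums_def p diff_zero)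
  then show ?thesis using that[of a] by (auto simp: a_def)
qed

lemma schoenberg_surj:
  assumes "0 \<le> u" "u \<le> 1" "0 \<le> v" "v \<le> 1"
  obtains t where "0 \<le> t" "t \<le> 1" "schoenberg 0 t = u" "schoenberg 1 t = v"
proof -
  obtain a where a: "\<And>k. a k = 0 \<or> a k = 1" "(\<lambda>k. a k * (1 / 2) ^ Suc k) sums u"
    using binary_digits_exist[OF assms(1,2)] by metis
  obtain b where b: "\<And>k. b k = 0 \<or> b k = 1" "(\<lambda>k. b k * (1 / 2) ^ Suc k) sums v"
    using binary_digits_exist[OF assms(3,4)] by metis
  define c :: "nat \<Rightarrow> real" where "c j = (if even j then a (j div 2) else b (j div 2))" for j
  have c: "c j = 0 \<or> c j = 1" for j using a b by (auto simp: c_def)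
  \<comment> \<open>\<open>T n\<close> is the point of the Cantor set whose ternary digits are
    \<open>2 * c n\<close>, \<open>2 * c (n + 1)\<close>, and so on. The parameter sought is
    \<open>T 0\<close>; the tails are needed for the induction on digits.\<close>
  define T where "T n = (\<Sum>j. 2 * c (n + j) * (1 / 3) ^ Suc j)" for n
  have geo: "(\<lambda>j. 2 * (1 / 3 :: real) ^ Suc j) sums 1"
  proof -
    have "(\<lambda>j. 2 / 3 * (1 / 3 :: real) ^ j) sums (2 / 3 * (1 / (1 - 1 / 3)))"
      by (intro sums_mult geometric_sums) simp
    moreover have "(\<lambda>j. 2 * (1 / 3 :: real) ^ Suc j) = (\<lambda>j. 2 / 3 * (1 / 3) ^ j)" by auto
    moreover have "2 / 3 * (1 / (1 - 1 / 3)) = (1 :: real)" by simp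
    ultimately show ?thesis by simp
  qed
  have le: "norm (2 * c (n + j) * (1 / 3) ^ Suc j) \<le> 2 * (1 / 3) ^ Suc j" for n j
    using c[of "n + j"] by auto
  have s: "summable (\<lambda>j. 2 * c (n + j) * (1 / 3) ^ Suc j)" for n
    by (rule summable_comparison_test'[OF sums_summable[OF geo] le])
  have c0: "0 \<le> c j" "c j \<le> 1" for j using c[of j] by auto
  have T0: "0 \<le> T n" for n unfolding T_def using c0 by (intro suminf_nonneg[OF s]) auto
  have "T n \<le> (\<Sum>j. 2 * (1 / 3) ^ Suc j)" for n
    unfolding T_def
  proof (rule suminf_le[OF _ s sums_summable[OF geo]])
    show "2 * c (n + j) * (1 / 3) ^ Suc j \<le> 2 * (1 / 3) ^ Suc j" for j using c[of "n + j"] by auto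
  qed
  then have T1: "T n \<le> 1" for n using sums_unique[OF geo] by metis
  have T: "3 * T n = 2 * c n + T (Suc n)" for n
  proof -
    have "T n = (\<Sum>j. 2 * c (n + Suc j) * (1 / 3) ^ Suc (Suc j)) + 2 * c n / 3"
      unfolding T_def using suminf_split_head[OF s[of n]] by simp
    also have "(\<Sum>j. 2 * c (n + Suc j) * (1 / 3) ^ Suc (Suc j)) = (\<Sum>j. (1 / 3) * (2 * c (Suc n + j) * (1 / 3) ^ Suc j))"
      by simp
    also have "\<dots> = 1 / 3 * T (Suc n)" unfolding T_def by (rule suminf_mult[OF s])
    finally show ?thesis by simp
  qed
  \<comment> \<open>The leading digit puts \<open>T n\<close> into the first or the last third of
    the unit interval, where \<open>zigzag\<close> is constant.\<close>
  have digit0: "zigzag (T n) = c n" for n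
    using c[of n] T[of n] T0[of "Suc n"] T1[of "Suc n"] zigzag_eq_0[of "T n"] zigzag_eq_1[of "T n"] by auto
  have digit: "zigzag (3 ^ k * T n) = c (n + k)" for k n
  proof (induction k arbitrary: n)
    case 0
    then show ?case by (simp add: digit0)
  next
    case (Suc k)
    obtain m where m: "c n = real m" using c[of n] by (metis of_nat_0 of_nat_1)
    have "3 ^ Suc k * T n = 3 ^ k * (3 * T n)" by simp
    \<comment> \<open>The leading digit contributes an even integer, which \<open>zigzag\<close>
      ignores by periodicity; what remains is the same statement for the tail.\<close>
    also have "\<dots> = 2 * real (3 ^ k * m) + 3 ^ k * T (Suc n)" unfolding T m by (simp add: algebra_simps)
    finally show ?case using Suc[of "Suc n"] by (simp only: zigzag_periodic) simp
  qed
  have "schoenberg 0 (T 0) = u" "schoenberg 1 (T 0) = v"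
    using a(2) b(2) unfolding schoenberg_def digit by (simp_all add: c_def sums_iff)
  then show ?thesis using that[of "T 0"] T0 T1 by auto
qed

text \<open>This coordinate change maps rationals below 1 to rationals, so that grids in the unit interval
  only need corners with rational parameters.\<close>
definition stretch :: "real \<Rightarrow> ennreal" where
  "stretch u = (if u < 1 then ennreal (u / (1 - u)) else \<top>)"

lemma stretch_mono:
  assumes "0 \<le> u" "u \<le> v"
  shows "stretch u \<le> stretch v"
proof (cases "v < 1")
  case True
  then have "u / (1 - u) \<le> v / (1 - v)" using assms by (simp add: field_simps)
  then show ?thesis using True assms by (simp add: stretch_def ennreal_leI)
qed (simp add: stretch_def)

lemma stretch_strict_mono:
  assumes "0 \<le> u" "u < v" "v \<le> 1"
  shows "stretch u < stretch v"
proof (cases "v < 1")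
  case True
  then have "u / (1 - u) < v / (1 - v)" using assms by (simp add: field_simps)
  then show ?thesis using True assms by (simp add: stretch_def ennreal_lessI)
qed (use assms in \<open>simp add: stretch_def\<close>)

lemma stretch_le_iff: "0 \<le> u \<Longrightarrow> u \<le> 1 \<Longrightarrow> 0 \<le> v \<Longrightarrow> v \<le> 1 \<Longrightarrow> stretch u \<le> stretch v \<longleftrightarrow> u \<le> v"
  using stretch_mono[of u v] stretch_strict_mono[of v u] by (meson leD not_le)

lemma stretch_surj: obtains u where "0 \<le> u" "u \<le> 1" "stretch u = x"
proof (cases x)
  case (real r)
  have "stretch (r / (1 + r)) = x" using real by (simp add: stretch_def field_simps)
  then show ?thesis using that[of "r / (1 + r)"] real by (simp add: field_simps)
next
  case top
  then show ?thesis using that[of 1] by (simp add: stretch_def)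
qed

lemma continuous_stretch: "continuous_on {0..1} stretch"
proof (rule continuous_onI_mono)
  have "stretch ` {0..1} = UNIV" using stretch_surj by (metis UNIV_eq_I atLeastAtMost_iff image_eqI)
  then show "open (stretch ` {0..1})" by simp
qed (auto intro: stretch_mono)

definition curve :: "real \<Rightarrow> ennreal \<times> ennreal" where
  "curve t = (stretch (schoenberg 0 t), stretch (schoenberg 1 t))"

lemma continuous_curve: "continuous_on UNIV curve"
  unfolding curve_def
  using schoenberg_bounds
  by (intro continuous_on_Pair continuous_on_compose2[OF continuous_stretch continuous_schoenberg]) auto

lemma curve_surj: obtains t where "0 \<le> t" "t \<le> 1" "curve t = p"
proof -
  obtain u v where uv: "0 \<le> u" "u \<le> 1" "stretch u = fst p" "0 \<le> v" "v \<le> 1" "stretch v = snd p"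
    using stretch_surj by metis
  then obtain t where "0 \<le> t" "t \<le> 1" "schoenberg 0 t = u" "schoenberg 1 t = v"
    using schoenberg_surj by metis
  then show ?thesis using that[of t] uv by (simp add: curve_def)
qed

section \<open>Test functions and compactness of normalised atomic measures\<close>

lemma open_Delta: "open Delta"
  unfolding Delta_def case_prod_unfold by (intro open_Collect_less continuous_intros)

lemma space_Delta_borel [simp]: "space Delta_borel = Delta"
  by (simp add: Delta_borel_def space_restrict_space)

lemma Cc_Delta_measurable:
  assumes "Cc_Delta f" "sets M = sets Delta_borel"
  shows "f \<in> borel_measurable M"
proof -
  have "f \<in> borel_measurable Delta_borel"
    unfolding Delta_borel_def using assms(1)
    by (intro borel_measurable_continuous_on_restrict) (simp add: Cc_Delta_def)
  then show ?thesis using measurable_cong_sets[OF assms(2) refl] by blast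
qed

definition zero_ext :: "(ennreal \<times> ennreal \<Rightarrow> real) \<Rightarrow> ennreal \<times> ennreal \<Rightarrow> real" where
  "zero_ext f p = (if p \<in> Delta then f p else 0)"

text \<open>The support stays away from the diagonal, so extension by zero keeps \<open>f\<close>
  continuous. In stretched coordinates it lives on the compact unit square, which makes it bounded
  and uniformly continuous.\<close>

lemma continuous_zero_ext:
  assumes "Cc_Delta f"
  shows "continuous_on UNIV (zero_ext f)"
proof -
  obtain K where f: "continuous_on Delta f" and K: "compact K" "K \<subseteq> Delta" "\<forall>x\<in>Delta - K. f x = 0"
    using assms by (auto simp: Cc_Delta_def)
  have "continuous_on Delta (zero_ext f)"
    using f by (rule continuous_on_eq) (simp add: zero_ext_def)
  moreover have "continuous_on (- K) (zero_ext f)"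
    by (rule continuous_on_eq[OF continuous_on_const[of _ 0]]) (use K in \<open>auto simp: zero_ext_def\<close>)
  ultimately have "continuous_on (Delta \<union> - K) (zero_ext f)"
    using open_Delta compact_imp_closed[OF K(1)] by (intro continuous_on_open_Un) auto
  moreover have "Delta \<union> - K = UNIV" using K by auto
  ultimately show ?thesis by simp
qed

lemma continuous_zero_ext_stretch:
  assumes "Cc_Delta f"
  shows "continuous_on ({0..1} \<times> {0..1}) (\<lambda>(u, v). zero_ext f (stretch u, stretch v))"
  unfolding case_prod_unfold
  by (intro continuous_on_compose2[OF continuous_zero_ext[OF assms]] continuous_on_Pair
      continuous_on_compose2[OF continuous_stretch] continuous_intros) auto

lemma zero_ext_bounded:
  assumes "Cc_Delta f"
  obtains B where "\<And>p. \<bar>zero_ext f p\<bar> \<le> B"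
proof -
  have "compact ((\<lambda>(u, v). zero_ext f (stretch u, stretch v)) ` ({0..1} \<times> {0..1}))"
    by (intro compact_continuous_image continuous_zero_ext_stretch[OF assms] compact_Times) auto
  then obtain B where B: "\<And>x. x \<in> (\<lambda>(u, v). zero_ext f (stretch u, stretch v)) ` ({0..1} \<times> {0..1}) \<Longrightarrow> norm x \<le> B"
    using compact_imp_bounded bounded_iff by metis
  have "\<bar>zero_ext f p\<bar> \<le> B" for p
  proof -
    obtain u v where "0 \<le> u" "u \<le> 1" "stretch u = fst p" "0 \<le> v" "v \<le> 1" "stretch v = snd p"
      using stretch_surj by metis
    then have "zero_ext f p \<in> (\<lambda>(u, v). zero_ext f (stretch u, stretch v)) ` ({0..1} \<times> {0..1})"
      by (intro image_eqI[of _ _ "(u, v)"]) auto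
    then show ?thesis using B by fastforce
  qed
  then show ?thesis using that by auto
qed

text \<open>Any choice of preimages under the curve lifts the atoms to the unit interval, where a
  common bounded support makes the laws tight. The limit law on the line is pushed forward along the
  curve; the curve takes each lifted atom back to its point, so integrals of test functions are
  unchanged.\<close>

theorem atomic_measures_vague_compact:
  fixes xs :: "nat \<Rightarrow> (ennreal \<times> ennreal) list" and V :: "nat \<Rightarrow> nat"
  assumes V: "\<And>n. length (xs n) \<le> V n" "\<And>n. 0 < V n" and sub: "\<And>n. set (xs n) \<subseteq> Delta"
  obtains r M where "strict_mono (r :: nat \<Rightarrow> nat)" "finite_measure M" "sets M = sets Delta_borel"
    "\<And>f. Cc_Delta f \<Longrightarrow> (\<lambda>n. (\<Sum>p\<leftarrow>xs (r n). f p) / V (r n)) \<longlonglongrightarrow> integral\<^sup>L M f"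
proof -
  have "\<forall>p. \<exists>t. 0 \<le> t \<and> t \<le> 1 \<and> curve t = p" using curve_surj by blast
  then obtain y where y: "\<And>p. 0 \<le> y p" "\<And>p. y p \<le> 1" "\<And>p. curve (y p) = p" by metis
  \<comment> \<open>Padding to exactly \<open>V n\<close> entries gives every atom the weight
    \<open>1 / V n\<close> in a probability measure. The added atoms lie over \<open>(0, 0)\<close>,
    on the diagonal, where \<open>zero_ext f\<close> is 0.\<close>
  define ys where "ys n = map y (xs n) @ replicate (V n - length (xs n)) (y (0, 0))" for n
  have lys: "length (ys n) = V n" for n using V by (simp add: ys_def)
  define \<mu> where "\<mu> n = distr (measure_pmf (pmf_of_set {..<V n})) borel (\<lambda>i. ys n ! i)" for n
  have ne: "{..<V n} \<noteq> {}" for n using V(2)[of n] by (auto simp: lessThan_empty_iff)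
  have prob: "prob_space (\<mu> n)" for n
    unfolding \<mu>_def by (intro measure_pmf.prob_space_distr) auto
  have rd: "real_distribution (\<mu> n)" for n
    using prob[of n] by (simp add: real_distribution_def real_distribution_axioms_def \<mu>_def)
  \<comment> \<open>The atoms lie in \<open>[0, 1]\<close>; the left end moves to -1 because
    tightness is phrased with half-open intervals and 0 has to be included.\<close>
  have supp: "measure (\<mu> n) {- 1<..1} = 1" for n
  proof -
    interpret prob_space "\<mu> n" by (rule prob)
    have "-1 < ys n ! i \<and> ys n ! i \<le> 1" if "i < V n" for i
    proof -
      have "ys n ! i \<in> set (ys n)" using that lys by (metis nth_mem)
      moreover have "-1 < z \<and> z \<le> 1" if z: "z \<in> set (ys n)" for z
      proof -
        obtain p where "z = y p" using z by (auto simp: ys_def)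
        then show ?thesis using y(1,2)[of p] by linarith
      qed
      ultimately show ?thesis by blast
    qed
    then have "AE x in \<mu> n. x \<in> {-1<..1}"
      unfolding \<mu>_def by (subst AE_distr_iff) (auto simp: AE_measure_pmf_iff set_pmf_of_set[OF ne])
    moreover have "{-1<..1} \<in> events" by (simp add: \<mu>_def)
    ultimately show ?thesis using prob_eq_1 by blast
  qed
  have "tight \<mu>"
    unfolding tight_def
  proof (intro conjI allI impI)
    fix \<epsilon> :: real assume "\<epsilon> > 0"
    then show "\<exists>a b. a < b \<and> (\<forall>n. 1 - \<epsilon> < measure (\<mu> n) {a<..b})"
      using supp by (intro exI[of _ "-1"] exI[of _ 1]) auto
  qed (use rd in auto)
  then obtain r \<nu> where r: "strict_mono r" and \<nu>: "real_distribution \<nu>" and w: "weak_conv_m (\<mu> \<circ> id \<circ> r) \<nu>"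
    using tight_imp_convergent_subsubsequence[of \<mu> id] strict_mono_id by auto
  interpret \<nu>: real_distribution \<nu> by (rule \<nu>)
  have [measurable]: "curve \<in> borel_measurable borel"
    using continuous_curve by (rule borel_measurable_continuous_onI)
  \<comment> \<open>Restriction discards whatever the limit puts outside \<open>Delta\<close>, such
    as the padding and mass that has reached the diagonal; \<open>zero_ext f\<close> vanishes
    there.\<close>
  define M where "M = restrict_space (distr \<nu> borel curve) Delta"
  have Db: "Delta \<in> sets borel" using open_Delta by auto
  have sM: "sets M = sets Delta_borel"
    by (simp add: M_def Delta_borel_def sets_restrict_space)
  have "finite_measure M"
    unfolding M_def using Db
    by (intro finite_measure_restrict_space finite_measure.finite_measure_distr \<nu>.finite_measure_axioms) auto
  moreover have "(\<lambda>n. (\<Sum>p\<leftarrow>xs (r n). f p) / V (r n)) \<longlonglongrightarrow> integral\<^sup>L M f" if f: "Cc_Delta f" for f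
  proof -
    obtain B where B: "\<And>p. \<bar>zero_ext f p\<bar> \<le> B" using zero_ext_bounded[OF f] by blast
    have cont: "continuous_on UNIV (\<lambda>t. zero_ext f (curve t))"
      by (intro continuous_on_compose2[OF continuous_zero_ext[OF f] continuous_curve]) auto
    have "(\<lambda>n. integral\<^sup>L ((\<mu> \<circ> id \<circ> r) n) (\<lambda>t. zero_ext f (curve t))) \<longlonglongrightarrow> integral\<^sup>L \<nu> (\<lambda>t. zero_ext f (curve t))"
      by (rule weak_conv_imp_integral_bdd_continuous_conv[OF _ \<nu> w, where B=B])
        (use rd B cont in \<open>auto simp: continuous_on_eq_continuous_at\<close>)
    moreover have "integral\<^sup>L (\<mu> n) (\<lambda>t. zero_ext f (curve t)) = (\<Sum>p\<leftarrow>xs n. f p) / V n" for n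
    proof -
      have [measurable]: "(\<lambda>t. zero_ext f (curve t)) \<in> borel_measurable borel"
        using cont by (rule borel_measurable_continuous_onI)
      have "integral\<^sup>L (\<mu> n) (\<lambda>t. zero_ext f (curve t))
          = measure_pmf.expectation (pmf_of_set {..<V n}) (\<lambda>i. zero_ext f (curve (ys n ! i)))"
        unfolding \<mu>_def by (subst integral_distr) auto
      also have "\<dots> = (\<Sum>i<V n. zero_ext f (curve (ys n ! i))) / V n"
        using ne by (subst integral_pmf_of_set) auto
      also have "(\<Sum>i<V n. zero_ext f (curve (ys n ! i))) = (\<Sum>z\<leftarrow>ys n. zero_ext f (curve z))"
        by (simp add: sum_list_sum_nth lys lessThan_atLeast0)
      also have "\<dots> = (\<Sum>p\<leftarrow>xs n. zero_ext f p)"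
        by (simp add: ys_def y o_def sum_list_replicate zero_ext_def[of f "(0, 0)"] Delta_def map_replicate)
      also have "\<dots> = (\<Sum>p\<leftarrow>xs n. f p)"
        using sub[of n] by (intro arg_cong[where f=sum_list] map_cong) (auto simp: zero_ext_def)
      finally show ?thesis .
    qed
    moreover have "integral\<^sup>L \<nu> (\<lambda>t. zero_ext f (curve t)) = integral\<^sup>L M f"
    proof -
      have [measurable]: "zero_ext f \<in> borel_measurable borel"
        using continuous_zero_ext[OF f] by (rule borel_measurable_continuous_onI)
      have "integral\<^sup>L M f = integral\<^sup>L (distr \<nu> borel curve) (\<lambda>p. indicator Delta p *\<^sub>R f p)"
        unfolding M_def using Db by (subst integral_restrict_space) auto
      also have "(\<lambda>p. indicator Delta p *\<^sub>R f p) = zero_ext f"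
        by (auto simp: zero_ext_def fun_eq_iff indicator_def)
      also have "integral\<^sup>L (distr \<nu> borel curve) (zero_ext f) = integral\<^sup>L \<nu> (\<lambda>t. zero_ext f (curve t))"
        by (rule integral_distr) auto
      finally show ?thesis by simp
    qed
    ultimately show ?thesis by simp
  qed
  ultimately show ?thesis using that r sM by blast
qed

section \<open>Step functions built from corners\<close>

definition corner :: "real \<Rightarrow> real \<Rightarrow> (ennreal \<times> ennreal) set" where
  "corner s t = {(b, d). b \<le> ennreal s \<and> ennreal t < d}"

lemma corner_subset_Delta: "s \<le> t \<Longrightarrow> corner s t \<subseteq> Delta"
  by (auto simp: corner_def Delta_def dest: ennreal_leI)

lemma corner_borel: "corner s t \<in> sets borel"
proof -
  have "corner s t = {..ennreal s} \<times> {ennreal t<..}" by (auto simp: corner_def)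
  also have "\<dots> \<in> sets (borel \<Otimes>\<^sub>M borel)" by auto
  finally show ?thesis unfolding borel_prod .
qed

lemma corner_sets: "s \<le> t \<Longrightarrow> corner s t \<in> sets Delta_borel"
  using corner_subset_Delta[of s t] corner_borel[of s t]
  by (auto simp: Delta_borel_def sets_restrict_space image_iff intro!: bexI[of _ "corner s t"])

text \<open>The index \<open>k\<close> is shifted by one, so that \<open>k = 0\<close> stands for the empty set. Then the off-diagonal cell
  \<open>(i, Suc j)\<close> of the grid with \<open>N\<close> cells per side is a combination of four quadrants
  without case distinctions at the boundary.\<close>
definition quadrant :: "nat \<Rightarrow> nat \<Rightarrow> nat \<Rightarrow> (ennreal \<times> ennreal) set" where
  "quadrant N k j = (if k = 0 then {} else
     {p. fst p \<le> stretch (real (k - 1) / real N) \<and> stretch (real j / real N) < snd p})"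

text \<open>Each grid cell carries the value of \<open>f\<close> at its upper right corner, and the
  indicator of the cell is written by inclusion and exclusion over four quadrants. Integrals of such
  functions are therefore fixed linear combinations of corner masses.\<close>

definition step_fun :: "(ennreal \<times> ennreal \<Rightarrow> real) \<Rightarrow> nat \<Rightarrow> ennreal \<times> ennreal \<Rightarrow> real" where
  "step_fun f N p = (\<Sum>j<N. \<Sum>i\<le>j. zero_ext f (stretch (real i / real N), stretch (real (Suc j) / real N)) *
     (indicator (quadrant N (Suc i) j) p - indicator (quadrant N i j) p
      - indicator (quadrant N (Suc i) (Suc j)) p + indicator (quadrant N i (Suc j)) p))"

lemma quadrant_eq_corner:
  assumes "0 < k" "k \<le> Suc j" "j < N"
  shows "quadrant N k j = corner (real (k - 1) / real (N - (k - 1))) (real j / real (N - j))"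
proof -
  have st: "stretch (real i / real N) = ennreal (real i / real (N - i))" if "i < N" for i
  proof -
    have "real i / real N / (1 - real i / real N) = real i / real (N - i)"
      using that by (simp add: field_simps of_nat_diff)
    then show ?thesis using that by (simp add: stretch_def)
  qed
  show ?thesis using assms st[of "k - 1"] st[of j] by (auto simp: quadrant_def corner_def)
qed

lemma quadrant_empty: "quadrant N 0 j = {}" "N > 0 \<Longrightarrow> quadrant N k N = {}"
  by (auto simp: quadrant_def stretch_def)

text \<open>Births are compared by a weak and deaths by a strict inequality, so membership depends
  on both coordinates only through the same rounding, upwards to the grid.\<close>

lemma indicator_quadrant:
  assumes "0 \<le> u" "u \<le> 1" "0 \<le> v" "v \<le> 1" "k \<le> Suc N" "j \<le> N" "N > 0"
  shows "indicator (quadrant N k j) (stretch u, stretch v)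
    = (if nat \<lceil>real N * u\<rceil> < k \<and> j < nat \<lceil>real N * v\<rceil> then 1 else (0 :: real))"
proof (cases k)
  case (Suc i)
  define a where "a = nat \<lceil>real N * u\<rceil>"
  define c where "c = nat \<lceil>real N * v\<rceil>"
  have "stretch u \<le> stretch (real i / real N) \<longleftrightarrow> u \<le> real i / real N"
    using assms Suc by (intro stretch_le_iff) auto
  also have "\<dots> \<longleftrightarrow> a < Suc i"
    using assms by (simp add: a_def less_Suc_eq_le nat_le_iff ceiling_le_iff field_simps)
  finally have 1: "stretch u \<le> stretch (real i / real N) \<longleftrightarrow> a < Suc i" .
  have "stretch v \<le> stretch (real j / real N) \<longleftrightarrow> v \<le> real j / real N"
    using assms by (intro stretch_le_iff) auto
  also have "\<dots> \<longleftrightarrow> c \<le> j"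
    using assms by (simp add: c_def nat_le_iff ceiling_le_iff field_simps)
  finally have 2: "stretch (real j / real N) < stretch v \<longleftrightarrow> j < c" by (simp add: not_le[symmetric])
  show ?thesis unfolding a_def[symmetric] c_def[symmetric] using 1 2 Suc
    by (simp add: quadrant_def indicator_def)
qed (simp add: quadrant_def)

lemma step_fun_eq:
  assumes "0 \<le> u" "u < v" "v \<le> 1" "N > 0"
  shows "step_fun f N (stretch u, stretch v)
    = zero_ext f (stretch (real (nat \<lceil>real N * u\<rceil>) / real N), stretch (real (nat \<lceil>real N * v\<rceil>) / real N))"
proof -
  define a where "a = nat \<lceil>real N * u\<rceil>"
  define c where "c = nat \<lceil>real N * v\<rceil>"
  let ?g = "\<lambda>i j. zero_ext f (stretch (real i / real N), stretch (real j / real N))"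
  have "0 < real N * v" using assms by simp
  then have "0 < c" by (simp add: c_def)
  then obtain c' where c': "c = Suc c'" by (cases c) auto
  have "real N * v \<le> real N" using assms by simp
  then have "c \<le> N" by (simp add: c_def nat_le_iff ceiling_le_iff)
  have "real N * u \<le> real N * v" using assms by simp
  then have "a \<le> c" unfolding a_def c_def by (intro nat_mono ceiling_mono)
  have ind: "indicator (quadrant N k j) (stretch u, stretch v) = (if a < k \<and> j < c then 1 else (0 :: real))"
    if "k \<le> Suc N" "j \<le> N" for k j
    unfolding a_def c_def using that assms by (intro indicator_quadrant) auto
  have "step_fun f N (stretch u, stretch v)
      = (\<Sum>j<N. \<Sum>i\<le>j. if j = c' then (if i = a then ?g a c else 0) else 0)"
    unfolding step_fun_def
    by (intro sum.cong refl) (auto simp: ind c')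
  also have "\<dots> = (\<Sum>j<N. if j = c' then (\<Sum>i\<le>j. if i = a then ?g a c else 0) else 0)"
    by (intro sum.cong) auto
  also have "\<dots> = (\<Sum>i\<le>c'. if i = a then ?g a c else 0)" using \<open>c \<le> N\<close> c' by simp
  also have "\<dots> = (if a \<le> c' then ?g a c else 0)" by simp
  also have "\<dots> = ?g a c"
  proof (cases "a \<le> c'")
    \<comment> \<open>The point lies in a diagonal cell, which no summand covers. The value claimed
      for it is that of \<open>zero_ext f\<close> on the diagonal, which is 0.\<close>
    case False
    then have "a = c" using \<open>a \<le> c\<close> c' by simp
    then show ?thesis using False by (simp add: zero_ext_def Delta_def)
  qed simp
  finally show ?thesis by (simp add: a_def c_def)
qed

lemma step_fun_approx:
  assumes "Cc_Delta f" "0 < e"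
  obtains N where "N > 0" "\<And>p. p \<in> Delta \<Longrightarrow> \<bar>f p - step_fun f N p\<bar> \<le> e"
proof -
  let ?g = "\<lambda>(u, v). zero_ext f (stretch u, stretch v)"
  have "uniformly_continuous_on ({0..1} \<times> {0..1}) ?g"
    by (intro compact_uniformly_continuous continuous_zero_ext_stretch[OF assms(1)] compact_Times) auto
  then obtain \<delta> where \<delta>: "\<delta> > 0" "\<And>x x'. x \<in> {0..1} \<times> {0..1} \<Longrightarrow> x' \<in> {0..1} \<times> {0..1} \<Longrightarrow> dist x' x < \<delta> \<Longrightarrow> dist (?g x') (?g x) < e"
    using assms(2) unfolding uniformly_continuous_on_def by metis
  \<comment> \<open>Rounding moves each coordinate by at most \<open>1 / N\<close>, hence the pair
    by at most \<open>2 / N\<close>.\<close>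
  obtain N :: nat where N: "2 / \<delta> < real N" using reals_Archimedean2 by blast
  have "0 < 2 / \<delta>" using \<delta> by simp
  then have "0 < real N" using N by linarith
  then have N0: "N > 0" by simp
  have "\<bar>f p - step_fun f N p\<bar> \<le> e" if p: "p \<in> Delta" for p
  proof -
    obtain u where u: "0 \<le> u" "u \<le> 1" "stretch u = fst p" using stretch_surj .
    obtain v where v: "0 \<le> v" "v \<le> 1" "stretch v = snd p" using stretch_surj .
    have pe: "p = (stretch u, stretch v)" using u v by simp
    have "stretch u < stretch v" using p pe by (simp add: Delta_def)
    then have "u < v" using stretch_mono[of v u] v(1) by (meson leD not_le)
    have near: "\<bar>real (nat \<lceil>real N * w\<rceil>) / real N - w\<bar> \<le> 1 / real N \<and> real (nat \<lceil>real N * w\<rceil>) / real N \<in> {0..1}"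
      if "0 \<le> w" "w \<le> 1" for w
    proof -
      have nn: "0 \<le> \<lceil>real N * w\<rceil>" using that mult_nonneg_nonneg[of "real N" w] by linarith
      then have c: "real (nat \<lceil>real N * w\<rceil>) = of_int \<lceil>real N * w\<rceil>" by simp
      have "real N * w \<le> real N" using that by (simp add: mult_left_le)
      then have "\<lceil>real N * w\<rceil> \<le> int N" by (simp add: ceiling_le_iff)
      then have "real (nat \<lceil>real N * w\<rceil>) \<le> real N"
        unfolding c by (metis of_int_le_iff of_int_of_nat_eq)
      moreover have up: "real N * w \<le> real (nat \<lceil>real N * w\<rceil>)" "real (nat \<lceil>real N * w\<rceil>) \<le> real N * w + 1"
        unfolding c using ceiling_correct[of "real N * w"] by linarith+
      ultimately have "w \<le> real (nat \<lceil>real N * w\<rceil>) / real N" "real (nat \<lceil>real N * w\<rceil>) / real N \<le> 1"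
        using N0 by (simp_all only: pos_le_divide_eq pos_divide_le_eq of_nat_0_less_iff mult.commute mult_1_right)
      moreover have "real (nat \<lceil>real N * w\<rceil>) / real N \<le> (real N * w + 1) / real N"
        by (rule divide_right_mono[OF up(2)]) simp
      moreover have "(real N * w + 1) / real N = w + 1 / real N" using N0 by (simp add: add_divide_distrib)
      ultimately show ?thesis using that by (simp add: abs_le_iff)
    qed
    let ?u = "real (nat \<lceil>real N * u\<rceil>) / real N" and ?v = "real (nat \<lceil>real N * v\<rceil>) / real N"
    have "dist (?u, ?v) (u, v) \<le> \<bar>?u - u\<bar> + \<bar>?v - v\<bar>"
      by (simp add: dist_Pair_Pair dist_real_def sqrt_sum_squares_le_sum_abs)
    also have "\<dots> \<le> 2 / real N" using near[OF u(1,2)] near[OF v(1,2)] by (simp add: field_simps)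
    also have "\<dots> < \<delta>" using N N0 \<delta> by (simp add: field_simps)
    finally have close: "dist (?u, ?v) (u, v) < \<delta>" .
    have "(u, v) \<in> {0..1} \<times> {0..1}" using u(1,2) v(1,2) by simp
    moreover have "(?u, ?v) \<in> {0..1} \<times> {0..1}"
      unfolding mem_Sigma_iff using near[OF u(1,2)] near[OF v(1,2)] by blast
    ultimately have "dist (?g (?u, ?v)) (?g (u, v)) < e" using close by (rule \<delta>(2))
    moreover have "?g (u, v) = f p" using p pe by (simp add: zero_ext_def)
    moreover have "?g (?u, ?v) = step_fun f N p"
      using step_fun_eq[OF u(1) \<open>u < v\<close> v(2) N0, of f] by (simp add: pe)
    ultimately show ?thesis by (simp add: dist_real_def abs_minus_commute)
  qed
  then show ?thesis using that N0 by blast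
qed

lemma integral_step_fun:
  assumes "finite_measure M" "sets M = sets Delta_borel"
  shows "integrable M (step_fun f N)"
    and "integral\<^sup>L M (step_fun f N) = (\<Sum>j<N. \<Sum>i\<le>j. zero_ext f (stretch (real i / real N), stretch (real (Suc j) / real N)) *
     (measure M (quadrant N (Suc i) j) - measure M (quadrant N i j)
      - measure M (quadrant N (Suc i) (Suc j)) + measure M (quadrant N i (Suc j))))" (is "?L = ?S")
proof -
  interpret finite_measure M by fact
  have q: "quadrant N k j \<in> sets M" if "k \<le> Suc j" "j \<le> N" "0 < N" for k j
  proof (cases "k = 0 \<or> j = N")
    case True
    then show ?thesis using quadrant_empty[of N] that by auto
  next
    case False
    have "real (k - 1) / real (N - (k - 1)) \<le> real j / real (N - j)"
      using False that by (intro frac_le) auto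
    then have "corner (real (k - 1) / real (N - (k - 1))) (real j / real (N - j)) \<in> sets M"
      unfolding assms(2) by (rule corner_sets)
    moreover have "quadrant N k j = corner (real (k - 1) / real (N - (k - 1))) (real j / real (N - j))"
      using False that by (intro quadrant_eq_corner) auto
    ultimately show ?thesis by (simp only:)
  qed
  have i: "integrable M (indicator (quadrant N k j) :: _ \<Rightarrow> real)" 
    and m: "integral\<^sup>L M (indicator (quadrant N k j) :: _ \<Rightarrow> real) = measure M (quadrant N k j)"
    if "k \<le> Suc j" "j \<le> N" "0 < N" for k j
    using q[OF that] by (auto simp: emeasure_eq_measure sets.Int_space_eq1 Int_absorb1 sets.sets_into_space)
  show "integrable M (step_fun f N)"
    unfolding step_fun_def
    by (intro Bochner_Integration.integrable_sum integrable_mult_right Bochner_Integration.integrable_add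
      Bochner_Integration.integrable_diff i) auto
  show "?L = ?S"
    unfolding step_fun_def
  proof (subst Bochner_Integration.integral_sum, goal_cases)
    case 2
    show ?case
    proof (intro sum.cong refl, subst Bochner_Integration.integral_sum, goal_cases)
      case (2 j)
      show ?case
      proof (rule sum.cong, goal_cases)
        case (2 i)
        then have *: "Suc i \<le> Suc j" "i \<le> Suc j" "Suc i \<le> Suc (Suc j)" "i \<le> Suc (Suc j)" "j \<le> N" "Suc j \<le> N" "0 < N"
          using \<open>j \<in> {..<N}\<close> by auto
        note I = i[OF *(1,5,7)] i[OF *(2,5,7)] i[OF *(3,6,7)] i[OF *(4,6,7)]
        show ?case
          unfolding integral_mult_right_zero
          by (simp only: Bochner_Integration.integral_add Bochner_Integration.integral_diff
              Bochner_Integration.integrable_diff I m[OF *(1,5,7)] m[OF *(2,5,7)] m[OF *(3,6,7)] m[OF *(4,6,7)])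
      qed simp
    qed (intro integrable_mult_right Bochner_Integration.integrable_add
      Bochner_Integration.integrable_diff i; auto)
  qed (intro Bochner_Integration.integrable_sum integrable_mult_right Bochner_Integration.integrable_add
      Bochner_Integration.integrable_diff i; auto)
qed

lemma Cc_Delta_integrable:
  assumes "finite_measure M" "sets M = sets Delta_borel" "Cc_Delta f"
  shows "integrable M f"
proof -
  interpret finite_measure M by fact
  obtain B where B: "\<And>p. \<bar>zero_ext f p\<bar> \<le> B" using zero_ext_bounded[OF assms(3)] by blast
  have sp: "space M = Delta" using sets_eq_imp_space_eq[OF assms(2)] by simp
  show ?thesis
  proof (rule integrable_const_bound[of _ B])
    show "AE p in M. norm (f p) \<le> B"
    proof (rule AE_I2)
      fix p assume "p \<in> space M"
      then show "norm (f p) \<le> B" using B[of p] sp by (simp add: zero_ext_def)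
    qed
  qed (rule Cc_Delta_measurable[OF assms(3,2)])
qed

lemma integral_step_fun_approx:
  assumes "finite_measure M" "sets M = sets Delta_borel" "Cc_Delta f"
    and e: "\<And>p. p \<in> Delta \<Longrightarrow> \<bar>f p - step_fun f N p\<bar> \<le> e"
  shows "\<bar>integral\<^sup>L M f - integral\<^sup>L M (step_fun f N)\<bar> \<le> e * measure M Delta"
proof -
  interpret finite_measure M by fact
  have sp: "space M = Delta" using sets_eq_imp_space_eq[OF assms(2)] by simp
  note i = Cc_Delta_integrable[OF assms(1-3)] integral_step_fun(1)[OF assms(1,2), of f N]
  have "\<bar>integral\<^sup>L M f - integral\<^sup>L M (step_fun f N)\<bar> = \<bar>\<integral>p. f p - step_fun f N p \<partial>M\<bar>"
    using i by simp
  also have "\<dots> \<le> (\<integral>p. \<bar>f p - step_fun f N p\<bar> \<partial>M)" by (rule integral_abs_bound)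
  also have "\<dots> \<le> (\<integral>p. e \<partial>M)" using i e sp by (intro integral_mono) auto
  also have "\<dots> = e * measure M Delta" by (simp add: sp)
  finally show ?thesis .
qed

text \<open>Two sequences are compared, since the corner masses of a vague limit may differ from the
  limits of the corner masses. One step function serves both sides and all indices: its integrals
  approach each other by hypothesis, and \<open>C\<close> bounds the two approximation errors
  uniformly.\<close>

theorem vague_comparison:
  fixes M M' :: "nat \<Rightarrow> (ennreal \<times> ennreal) measure"
  assumes M: "\<And>n. finite_measure (M n)" "\<And>n. sets (M n) = sets Delta_borel" "\<And>n. measure (M n) Delta \<le> C"
    and M': "\<And>n. finite_measure (M' n)" "\<And>n. sets (M' n) = sets Delta_borel" "\<And>n. measure (M' n) Delta \<le> C"
    and lim: "\<And>s t. s \<in> \<rat> \<Longrightarrow> t \<in> \<rat> \<Longrightarrow> 0 \<le> s \<Longrightarrow> s \<le> t \<Longrightarrow>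
      (\<lambda>n. measure (M n) (corner s t) - measure (M' n) (corner s t)) \<longlonglongrightarrow> 0"
    and f: "Cc_Delta f"
  shows "(\<lambda>n. integral\<^sup>L (M n) f - integral\<^sup>L (M' n) f) \<longlonglongrightarrow> 0"
proof (rule LIMSEQ_I)
  fix r :: real assume "r > 0"
  have C: "0 \<le> C" using M(3)[of 0] measure_nonneg[of "M 0" Delta] by linarith
  \<comment> \<open>The three thirds are the two approximation errors and the difference of the step
    integrals; \<open>C + 1\<close> avoids a zero denominator.\<close>
  define e where "e = r / (3 * (C + 1))"
  have e: "0 < e" "e * C \<le> r / 3" using \<open>r > 0\<close> C by (auto simp: e_def field_simps)
  obtain N where N: "N > 0" "\<And>p. p \<in> Delta \<Longrightarrow> \<bar>f p - step_fun f N p\<bar> \<le> e"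
    using step_fun_approx[OF f e(1)] by blast
  have q: "(\<lambda>n. measure (M n) (quadrant N k j) - measure (M' n) (quadrant N k j)) \<longlonglongrightarrow> 0"
    if "k \<le> Suc j" "j \<le> N" for k j
  proof (cases "k = 0 \<or> j = N")
    case True
    then show ?thesis using quadrant_empty[of N] N(1) by auto
  next
    case False
    then have "quadrant N k j = corner (real (k - 1) / real (N - (k - 1))) (real j / real (N - j))"
      using that by (intro quadrant_eq_corner) auto
    moreover have "real (k - 1) / real (N - (k - 1)) \<le> real j / real (N - j)"
      using False that by (intro frac_le) auto
    ultimately show ?thesis using lim by simp
  qed
  let ?g = "\<lambda>i j. zero_ext f (stretch (real i / real N), stretch (real (Suc j) / real N))"
  let ?D = "\<lambda>n k j. measure (M n) (quadrant N k j) - measure (M' n) (quadrant N k j)"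
  have "(\<lambda>n. \<Sum>j<N. \<Sum>i\<le>j. ?g i j * (?D n (Suc i) j - ?D n i j - ?D n (Suc i) (Suc j) + ?D n i (Suc j)))
     \<longlonglongrightarrow> (\<Sum>j<N. \<Sum>i\<le>j. ?g i j * (0 - 0 - 0 + 0))"
    by (intro tendsto_sum tendsto_mult tendsto_const tendsto_add tendsto_diff q) auto
  moreover have "integral\<^sup>L (M n) (step_fun f N) - integral\<^sup>L (M' n) (step_fun f N) =
     (\<Sum>j<N. \<Sum>i\<le>j. ?g i j * (?D n (Suc i) j - ?D n i j - ?D n (Suc i) (Suc j) + ?D n i (Suc j)))" for n
    unfolding integral_step_fun(2)[OF M(1,2)] integral_step_fun(2)[OF M'(1,2)] sum_subtractf[symmetric]
    by (intro sum.cong refl) (simp only: right_diff_distrib[symmetric], simp add: algebra_simps)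
  ultimately have "(\<lambda>n. integral\<^sup>L (M n) (step_fun f N) - integral\<^sup>L (M' n) (step_fun f N)) \<longlonglongrightarrow> 0"
    by simp
  from LIMSEQ_D[OF this, of "r / 3"] obtain n0 where n0: "\<And>n. n \<ge> n0 \<Longrightarrow> \<bar>integral\<^sup>L (M n) (step_fun f N) - integral\<^sup>L (M' n) (step_fun f N)\<bar> < r / 3"
    using \<open>r > 0\<close> by auto
  have "norm (integral\<^sup>L (M n) f - integral\<^sup>L (M' n) f - 0) < r" if "n \<ge> n0" for n
  proof -
    have "\<bar>integral\<^sup>L (M n) f - integral\<^sup>L (M n) (step_fun f N)\<bar> \<le> e * measure (M n) Delta"
      by (intro integral_step_fun_approx M f N)
    also have "\<dots> \<le> e * C" using M(3) e by (intro mult_left_mono) auto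
    finally have 1: "\<bar>integral\<^sup>L (M n) f - integral\<^sup>L (M n) (step_fun f N)\<bar> \<le> r / 3" using e by linarith
    have "\<bar>integral\<^sup>L (M' n) f - integral\<^sup>L (M' n) (step_fun f N)\<bar> \<le> e * measure (M' n) Delta"
      by (intro integral_step_fun_approx M' f N)
    also have "\<dots> \<le> e * C" using M'(3) e by (intro mult_left_mono) auto
    finally have "\<bar>integral\<^sup>L (M' n) f - integral\<^sup>L (M' n) (step_fun f N)\<bar> \<le> r / 3" using e by linarith
    then show ?thesis using 1 n0[OF that] unfolding real_norm_def diff_zero by linarith
  qed
  then show "\<exists>no. \<forall>n\<ge>no. norm (integral\<^sup>L (M n) f - integral\<^sup>L (M' n) f - 0) < r" by blast
qed

section \<open>Persistence diagrams\<close>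

abbreviation corners :: "(ennreal \<times> ennreal) set set" where
  "corners \<equiv> {corner s t | s t. 0 \<le> s \<and> s \<le> t}"

lemma ennreal_min: "ennreal (min x y) = min (ennreal x) (ennreal y)"
  by (rule min_of_mono[symmetric]) (simp add: mono_def ennreal_leI)

lemma ennreal_max: "ennreal (max x y) = max (ennreal x) (ennreal y)"
  by (rule max_of_mono[symmetric]) (simp add: mono_def ennreal_leI)

lemma Int_stable_corners: "Int_stable corners"
proof (rule Int_stableI)
  fix A B assume "A \<in> corners" "B \<in> corners"
  then obtain s t s' t' where *: "A = corner s t" "B = corner s' t'" "0 \<le> s" "s \<le> t" "0 \<le> s'" "s' \<le> t'"
    by auto
  have "A \<inter> B = corner (min s s') (max t t')"
    using * by (auto simp: corner_def ennreal_min ennreal_max)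
  moreover have "0 \<le> min s s'" "min s s' \<le> max t t'" using * by auto
  ultimately show "A \<inter> B \<in> corners" by blast
qed

lemma corners_subset_Pow: "corners \<subseteq> Pow Delta"
  using corner_subset_Delta by auto

text \<open>A rational between birth and death places the point in \<open>corner r r\<close>. Such
  countable choices replace arbitrary real parameters in the covers and unions below.\<close>

lemma Delta_separating:
  assumes "p \<in> Delta"
  obtains r where "r \<in> \<rat>" "0 \<le> r" "fst p \<le> ennreal r" "ennreal r < snd p"
proof -
  obtain b where b: "fst p < b" "b < snd p" using assms dense[of "fst p" "snd p"] by (auto simp: Delta_def)
  obtain x where x: "fst p = ennreal x" "0 \<le> x" using b(1) by (cases "fst p") auto
  obtain y where y: "b = ennreal y" "0 \<le> y" using b(2) by (cases b) auto
  have "x < y" using b x y by (metis ennreal_leI leD not_le)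
  then obtain r where r: "r \<in> \<rat>" "x < r" "r < y" using Rats_dense_in_real by blast
  have "ennreal r < ennreal y" using r x by (intro ennreal_lessI) auto
  then have "ennreal r < snd p" using b(2) y by simp
  moreover have "fst p \<le> ennreal r" using r x by (simp add: ennreal_leI)
  ultimately show ?thesis using that[of r] r x by auto
qed

lemma Delta_eq_Union_corners: "Delta = (\<Union>r\<in>\<rat> \<inter> {0..}. corner r r)"
proof
  show "Delta \<subseteq> (\<Union>r\<in>\<rat> \<inter> {0..}. corner r r)"
    by (auto simp: corner_def elim!: Delta_separating)
qed (use corner_subset_Delta in auto)

lemma countable_corner_cover:
  obtains C :: "nat \<Rightarrow> _" where "\<And>i. C i \<in> corners" "(\<Union>i. C i) = Delta"
proof -
  have "\<rat> \<inter> {0..} \<noteq> ({} :: real set)" by auto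
  then obtain r :: "nat \<Rightarrow> real" where r: "range r = \<rat> \<inter> {0..}"
    using range_from_nat_into[of "\<rat> \<inter> {0..} :: real set"] countable_Int1[OF countable_rat, of "{0..}"] by metis
  have "r i \<in> \<rat> \<inter> {0..}" for i using r by blast
  then have "0 \<le> r i" for i by simp
  then have "corner (r i) (r i) \<in> corners" for i by blast
  moreover have "(\<Union>i. corner (r i) (r i)) = Delta" unfolding Delta_eq_Union_corners r[symmetric] by simp
  ultimately show ?thesis by (rule that)
qed

text \<open>The nontrivial inclusion reduces to measurability of both projections for the
  sigma-algebra of the corners, since half-planes are countable unions of corners.\<close>

lemma sets_Delta_borel: "sets Delta_borel = sigma_sets Delta corners"
proof
  show "sigma_sets Delta corners \<subseteq> sets Delta_borel"
    using sets.sigma_sets_subset[of corners Delta_borel] corner_sets by auto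
  let ?S = "sigma Delta corners"
  have sp: "space ?S = Delta" by (simp add: space_measure_of corners_subset_Pow)
  have ss: "sets ?S = sigma_sets Delta corners" by (simp add: sets_measure_of corners_subset_Pow)
  have c: "corner s t \<in> sets ?S" if "0 \<le> s" "s \<le> t" for s t
    unfolding ss using that by (intro sigma_sets.Basic) auto
  have cnt: "countable (\<rat> \<inter> {0..} :: real set)" by (intro countable_Int1 countable_rat)
  have f: "fst \<in> borel_measurable ?S"
  proof (rule borel_measurableI_le)
    fix y :: ennreal
    \<comment> \<open>A corner needs real parameters with \<open>s \<le> t\<close>: cutting
      \<open>y\<close> at \<open>r\<close> makes it finite and at most \<open>r\<close>. Nothing is
      lost, since each point has a separating rational.\<close>
    have "{p \<in> space ?S. fst p \<le> y} = (\<Union>r\<in>\<rat> \<inter> {0..}. corner (enn2real (min y (ennreal r))) r)"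
    proof -
      have e: "ennreal (enn2real (min y (ennreal r))) = min y (ennreal r)" for r
        by (rule ennreal_enn2real) (simp add: min_less_iff_disj)
      show ?thesis
        unfolding sp by (auto simp: corner_def e elim!: Delta_separating)
          (auto simp: Delta_def intro: le_less_trans)
    qed
    also have "\<dots> \<in> sets ?S"
    proof (intro sets.countable_UN''[OF cnt] c)
      fix r :: real assume "r \<in> \<rat> \<inter> {0..}"
      have "enn2real (min y (ennreal r)) \<le> enn2real (ennreal r)" by (intro enn2real_mono) auto
      then show "enn2real (min y (ennreal r)) \<le> r" using \<open>r \<in> \<rat> \<inter> {0..}\<close> by simp
    qed simp
    finally show "{p \<in> space ?S. fst p \<le> y} \<in> sets ?S" .
  qed
  have s: "snd \<in> borel_measurable ?S"
  proof (rule borel_measurableI_greater)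
    fix y :: ennreal
    show "{p \<in> space ?S. y < snd p} \<in> sets ?S"
    proof (cases y)
      case (real t)
      \<comment> \<open>For a point of the left side, \<open>t\<close> and a separating
        \<open>r\<close> both lie below the death, hence so does their maximum, which also keeps
        \<open>s \<le> t\<close>.\<close>
      have "{p \<in> space ?S. y < snd p} = (\<Union>r\<in>\<rat> \<inter> {0..}. corner r (max t r))"
      proof -
        show ?thesis
          unfolding sp by (auto simp: corner_def ennreal_max real elim!: Delta_separating)
            (auto simp: Delta_def intro: le_less_trans)
      qed
      also have "\<dots> \<in> sets ?S"
        by (intro sets.countable_UN''[OF cnt] c) auto
      finally show ?thesis .
    qed simp
  qed
  have "(\<lambda>p. (fst p, snd p)) \<in> ?S \<rightarrow>\<^sub>M borel \<Otimes>\<^sub>M borel"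
    by (intro measurable_Pair f s)
  then have id: "(\<lambda>p. p) \<in> ?S \<rightarrow>\<^sub>M borel" by (simp add: borel_prod)
  show "sets Delta_borel \<subseteq> sigma_sets Delta corners"
  proof
    fix A assume "A \<in> sets Delta_borel"
    then obtain B where B: "B \<in> sets borel" "A = Delta \<inter> B"
      by (auto simp: Delta_borel_def sets_restrict_space)
    have "(\<lambda>p. p) -` B \<inter> space ?S \<in> sets ?S" using measurable_sets[OF id B(1)] .
    then show "A \<in> sigma_sets Delta corners" unfolding sp ss B(2) by (simp add: Int_commute)
  qed
qed

text \<open>As the image of counting measure on the positions of a list, this counts repetitions and
  turns integrals into finite sums.\<close>

definition atoms :: "(ennreal \<times> ennreal) list \<Rightarrow> (ennreal \<times> ennreal) measure" where
  "atoms xs = distr (count_space {..<length xs}) Delta_borel (\<lambda>i. xs ! i)"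

lemma sets_atoms [simp]: "sets (atoms xs) = sets Delta_borel"
  by (simp add: atoms_def)

lemma space_atoms [simp]: "space (atoms xs) = Delta"
  by (simp add: atoms_def)

lemma nth_measurable: "set xs \<subseteq> Delta \<Longrightarrow> (\<lambda>i. xs ! i) \<in> count_space {..<length xs} \<rightarrow>\<^sub>M Delta_borel"
  by (rule measurableI) (auto dest: nth_mem)

lemma emeasure_atoms:
  assumes "set xs \<subseteq> Delta" "A \<in> sets Delta_borel"
  shows "emeasure (atoms xs) A = of_nat (size (filter_mset (\<lambda>p. p \<in> A) (mset xs)))"
proof -
  have "emeasure (atoms xs) A = emeasure (count_space {..<length xs}) ((\<lambda>i. xs ! i) -` A \<inter> {..<length xs})"
    unfolding atoms_def by (subst emeasure_distr[OF nth_measurable[OF assms(1)] assms(2)]) simp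
  also have "\<dots> = of_nat (card {i. i < length xs \<and> xs ! i \<in> A})"
  proof -
    have "(\<lambda>i. xs ! i) -` A \<inter> {..<length xs} = {i. i < length xs \<and> xs ! i \<in> A}" by auto
    then show ?thesis by (subst emeasure_count_space_finite) auto
  qed
  also have "card {i. i < length xs \<and> xs ! i \<in> A} = size (filter_mset (\<lambda>p. p \<in> A) (mset xs))"
    using length_filter_conv_card[of "\<lambda>p. p \<in> A" xs] by (simp only: mset_filter[symmetric] size_mset)
  finally show ?thesis .
qed

lemma integral_atoms:
  assumes "set xs \<subseteq> Delta" "f \<in> borel_measurable Delta_borel"
  shows "integral\<^sup>L (atoms xs) f = (\<Sum>p\<leftarrow>xs. f p :: real)"
  unfolding atoms_def using assms nth_measurable[OF assms(1)]
  by (subst integral_distr) (auto simp: lebesgue_integral_count_space_finite sum_list_sum_nth lessThan_atLeast0)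

section \<open>Uniqueness and existence of the diagram\<close>

lemma corner_filter: "filter_mset (\<lambda>(b, d). b \<le> ennreal s \<and> ennreal t < d) D = filter_mset (\<lambda>p. p \<in> corner s t) D"
  by (rule filter_mset_cong) (auto simp: corner_def)

text \<open>Measures that agree and are finite on an intersection-stable generator coincide, and
  multiplicities are masses of singletons. This is the uniqueness behind the definite description in
  \<open>pd_points\<close>.\<close>

lemma diagram_unique:
  assumes D: "set_mset D \<subseteq> Delta" and D': "set_mset D' \<subseteq> Delta"
    and eq: "\<And>s t. 0 \<le> s \<Longrightarrow> s \<le> t \<Longrightarrow>
      size (filter_mset (\<lambda>p. p \<in> corner s t) D) = size (filter_mset (\<lambda>p. p \<in> corner s t) D')"
  shows "D = D'"
proof -
  obtain xs where xs: "mset xs = D" using ex_mset by blast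
  obtain xs' where xs': "mset xs' = D'" using ex_mset by blast
  have sub: "set xs \<subseteq> Delta" "set xs' \<subseteq> Delta" using D D' xs xs' by auto
  obtain C :: "nat \<Rightarrow> _" where C: "\<And>i. C i \<in> corners" "(\<Union>i. C i) = Delta"
    using countable_corner_cover by blast
  have m: "atoms xs = atoms xs'"
  proof (rule measure_eqI_generator_eq[OF Int_stable_corners corners_subset_Pow, where A=C])
    fix A assume "A \<in> corners"
    then obtain s t where A: "A = corner s t" "0 \<le> s" "s \<le> t" by auto
    show "emeasure (atoms xs) A = emeasure (atoms xs') A"
      unfolding A(1) emeasure_atoms[OF sub(1) corner_sets[OF A(3)]]
        emeasure_atoms[OF sub(2) corner_sets[OF A(3)]] xs xs' eq[OF A(2,3)] ..
  next
    show "range C \<subseteq> corners" using C(1) by blast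
    show "emeasure (atoms xs) (C i) \<noteq> \<infinity>" for i
      using C(1)[of i] by (auto simp: emeasure_atoms[OF sub(1) corner_sets])
  qed (auto simp: sets_Delta_borel C(2))
  have single: "{p} \<in> sets Delta_borel" if "p \<in> Delta" for p
    using that by (auto simp: Delta_borel_def sets_restrict_space image_iff intro!: bexI[of _ "{p}"])
  have "count D p = count D' p" for p
  proof (cases "p \<in> Delta")
    case True
    have "of_nat (size (filter_mset (\<lambda>x. x \<in> {p}) D)) = (of_nat (size (filter_mset (\<lambda>x. x \<in> {p}) D')) :: ennreal)"
      using emeasure_atoms[OF sub(1) single[OF True]] emeasure_atoms[OF sub(2) single[OF True]]
      unfolding m xs xs' by simp
    then show ?thesis by (simp add: filter_eq_replicate_mset)
  next
    case False
    then show ?thesis using D D' by (metis count_inI subsetD)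
  qed
  then show ?thesis by (rule multiset_eqI)
qed

lemma filter_replicate_mset: "filter_mset P (replicate_mset n x) = (if P x then replicate_mset n x else {#})"
  by (induction n) auto

lemma size_filter_sum_replicate:
  assumes "finite I"
  shows "size (filter_mset P (\<Sum>p\<in>I. replicate_mset (m p) (e p))) = (\<Sum>p\<in>I. if P (e p) then m p else 0)"
  using assms by (induction I rule: finite_induct) (auto simp: filter_replicate_mset)

lemma set_mset_sum_replicate:
  assumes "finite I"
  shows "set_mset (\<Sum>p\<in>I. replicate_mset (m p) (e p)) \<subseteq> e ` I"
  using assms by (induction I rule: finite_induct) (auto split: if_splits)

text \<open>Sublevel sets change at finitely many values only, so the multiplicities are the mixed
  second differences of a finite rank table. They are nonnegative by
  \<open>hom_rank_rectangle\<close>, in the last column by \<open>hom_rank_mono\<close>, and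
  telescoping recovers the ranks.\<close>

lemma diagram_exists:
  fixes \<eta> :: "cube \<Rightarrow> ennreal" and F :: "cube set"
  assumes F: "finite F"
  defines "Y \<equiv> \<lambda>t. {Q \<in> F. \<eta> Q \<le> ennreal t}"
  obtains D where "set_mset D \<subseteq> Delta" "size D \<le> card F"
    "\<And>s t. 0 \<le> s \<Longrightarrow> s \<le> t \<Longrightarrow> size (filter_mset (\<lambda>p. p \<in> corner s t) D) = hom_rank q (Y s) (Y t)"
proof -
  \<comment> \<open>The critical values. Including 0 gives every level \<open>s \<ge> 0\<close> a
    critical value not above it; infinite births are also sent to 0, which merely repeats this
    value.\<close>
  define T where "T = insert 0 ((\<lambda>Q. enn2real (\<eta> Q)) ` F)"
  define k where "k = card T"
  have fT: "finite T" using F by (simp add: T_def)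
  define e where "e i = sorted_list_of_set T ! i" for i
  have len: "length (sorted_list_of_set T) = k" by (simp add: k_def)
  have eT: "e ` {0..<k} = T"
    using fT len nth_image[of k "sorted_list_of_set T"] by (simp add: e_def)
  have eless1: "e i < e j" if "i < j" "j < k" for i j
    unfolding e_def using sorted_wrt_nth_less[OF strict_sorted_list_of_set[of T]] that len by simp
  have eless: "e i < e j \<longleftrightarrow> i < j" if "i < k" "j < k" for i j
    using eless1[of i j] eless1[of j i] that by (metis less_irrefl less_trans linorder_neqE_nat)
  have ele: "e i \<le> e j \<longleftrightarrow> i \<le> j" if "i < k" "j < k" for i j
    using eless[of j i] that by auto
  have enn: "0 \<le> e i" if "i < k" for i
  proof -
    have "e i \<in> T" using eT that by auto
    then show ?thesis by (auto simp: T_def)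
  qed
  define idx where "idx s = card {i \<in> {0..<k}. e i \<le> s}" for s
  have idx: "e i \<le> s \<longleftrightarrow> i < idx s" if "i < k" for i s
  proof
    assume "e i \<le> s"
    then have "e j \<le> s" if "j \<le> i" for j using ele[of j i] that \<open>i < k\<close> by linarith
    then have "{0..i} \<subseteq> {i \<in> {0..<k}. e i \<le> s}" using \<open>i < k\<close> by auto
    then have "card {0..i} \<le> idx s" unfolding idx_def by (intro card_mono) auto
    then show "i < idx s" by simp
  next
    assume i: "i < idx s"
    show "e i \<le> s"
    proof (rule ccontr)
      assume n: "\<not> e i \<le> s"
      have "{i \<in> {0..<k}. e i \<le> s} \<subseteq> {0..<i}"
      proof
        fix j assume "j \<in> {i \<in> {0..<k}. e i \<le> s}"
        then have "e j < e i" "j < k" using n by auto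
        then show "j \<in> {0..<i}" using eless[of j i] that by auto
      qed
      then have "idx s \<le> card {0..<i}" unfolding idx_def by (intro card_mono) auto
      then show False using i by simp
    qed
  qed
  have idx_le: "idx s \<le> k" for s
    unfolding idx_def using card_mono[of "{0..<k}" "{i \<in> {0..<k}. e i \<le> s}"] by fastforce
  have idx_pos: "0 < idx s" if "0 \<le> s" for s
  proof -
    have "0 \<in> e ` {0..<k}" unfolding eT by (simp add: T_def)
    then obtain i where "i < k" "e i = 0" by auto
    then show ?thesis using idx[of i s] that by auto
  qed
  have idx_mono: "idx s \<le> idx t" if "s \<le> t" for s t
    unfolding idx_def using that by (intro card_mono) auto
  \<comment> \<open>Shifted by one: \<open>K i\<close> is the sublevel set after the first
    \<open>i\<close> critical values, so \<open>K 0\<close> is empty and row 0 of the rank table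
    vanishes.\<close>
  define K where "K i = (if i = 0 then {} else Y (e (i - 1)))" for i
  have YK: "Y s = K (idx s)" if s: "0 \<le> s" for s
  proof -
    have p: "0 < idx s" "idx s \<le> k" using idx_pos[OF s] idx_le by auto
    have "\<eta> Q \<le> ennreal s \<longleftrightarrow> \<eta> Q \<le> ennreal (e (idx s - 1))" if "Q \<in> F" for Q
    proof (cases "\<eta> Q")
      case (real x)
      have "enn2real (\<eta> Q) \<in> T" using that by (simp add: T_def)
      then have "x \<in> e ` {0..<k}" using real unfolding eT by simp
      then obtain j where j: "j < k" "x = e j" by auto
      have "\<eta> Q \<le> ennreal s \<longleftrightarrow> j < idx s" using real j idx[OF j(1)] s by simp
      moreover have "\<eta> Q \<le> ennreal (e (idx s - 1)) \<longleftrightarrow> j < idx s"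
        using real j ele[of j "idx s - 1"] enn[of "idx s - 1"] p by auto
      ultimately show ?thesis by simp
    qed (simp add: top_unique)
    then show ?thesis using p by (auto simp: K_def Y_def)
  qed
  have KF: "K i \<subseteq> F" and fK: "finite (K i)" for i
    using F finite_subset by (auto simp: K_def Y_def)
  have Kmono: "K i \<subseteq> K (Suc i)" if "i < k" for i
  proof (cases "i = 0")
    case False
    have "ennreal (e (i - 1)) \<le> ennreal (e i)" using that ele[of "i - 1" i] by (intro ennreal_leI) auto
    then show ?thesis using False by (auto simp: K_def Y_def)
  qed (simp add: K_def)
  \<comment> \<open>The zero column \<open>Suc k\<close> lets the surviving classes die in a
    fictitious last step, which \<open>pt\<close> records as death at infinity.\<close>
  define b :: "nat \<Rightarrow> nat \<Rightarrow> int" where "b i j = (if j \<le> k then int (hom_rank q (K i) (K j)) else 0)" for i j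
  have b0: "b 0 j = 0" for j
    using hom_rank_le_card[of "K 0" "K j" q] fK by (simp add: b_def K_def)
  \<comment> \<open>For \<open>i < j\<close> this counts classes that are born in
    \<open>K (Suc i)\<close>, live in \<open>K j\<close> and die on entering
    \<open>K (Suc j)\<close>.\<close>
  define m where "m i j = b (Suc i) j - b (Suc i) (Suc j) - b i j + b i (Suc j)" for i j
  have m_nonneg: "0 \<le> m i j" if "i < k" "j \<le> k" for i j
  proof (cases "j < k")
    case True
    then show ?thesis
      using hom_rank_rectangle[OF fK fK Kmono[OF that(1)] Kmono[OF True], of q] by (simp add: m_def b_def)
  next
    case False
    then show ?thesis
      using hom_rank_mono[OF fK fK Kmono[OF that(1)], of q "j"] that by (simp add: m_def b_def)
  qed
  define pt where "pt = (\<lambda>(i, j). (ennreal (e i), if j < k then ennreal (e j) else \<top>))"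
  define I where "I = {(i, j). i < j \<and> j \<le> k}"
  have fI: "finite I" by (rule finite_subset[of _ "{..k} \<times> {..k}"]) (auto simp: I_def)
  define D where "D = (\<Sum>p\<in>I. replicate_mset (nat (case_prod m p)) (pt p))"
  have sum_cols: "(\<Sum>j=c..k. m i j) = b (Suc i) c - b i c" if "c \<le> k" for i c
  proof -
    have "(\<Sum>j=c..k. m i j) = (\<Sum>j=c..k. (b (Suc i) j - b i j) - (b (Suc i) (Suc j) - b i (Suc j)))"
      by (intro sum.cong) (auto simp: m_def)
    also have "\<dots> = (b (Suc i) c - b i c) - (b (Suc i) (Suc k) - b i (Suc k))"
    proof -
      have "(\<Sum>j=c..k. (b i (Suc j) - b (Suc i) (Suc j)) - (b i j - b (Suc i) j))
          = (b i (Suc k) - b (Suc i) (Suc k)) - (b i c - b (Suc i) c)"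
        using that by (intro sum_Suc_diff) simp
      moreover have "(\<Sum>j=c..k. (b i (Suc j) - b (Suc i) (Suc j)) - (b i j - b (Suc i) j))
          = (\<Sum>j=c..k. (b (Suc i) j - b i j) - (b (Suc i) (Suc j) - b i (Suc j)))"
        by (intro sum.cong) auto
      ultimately show ?thesis by simp
    qed
    finally show ?thesis by (simp add: b_def)
  qed
  have "set_mset D \<subseteq> pt ` I"
    unfolding D_def by (rule set_mset_sum_replicate[OF fI])
  moreover have "pt ` I \<subseteq> Delta"
  proof
    fix x assume "x \<in> pt ` I"
    then obtain i j where ij: "i < j" "j \<le> k" "x = pt (i, j)" by (auto simp: I_def)
    show "x \<in> Delta"
    proof (cases "j < k")
      case True
      then show ?thesis using ij eless1[of i j] enn[of i] by (simp add: pt_def Delta_def ennreal_lessI)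
    qed (simp add: ij(3) pt_def Delta_def)
  qed
  ultimately have "set_mset D \<subseteq> Delta" by blast
  moreover have "size D \<le> card F"
  proof -
    have "size D = size (filter_mset (\<lambda>_. True) D)" by simp
    also have "\<dots> = (\<Sum>p\<in>I. nat (case_prod m p))"
      unfolding D_def by (subst size_filter_sum_replicate[OF fI]) simp
    finally have "int (size D) = (\<Sum>p\<in>I. int (nat (case_prod m p)))" by simp
    also have "\<dots> = (\<Sum>p\<in>I. case_prod m p)"
      using m_nonneg by (intro sum.cong) (auto simp: I_def)
    also have "\<dots> = (\<Sum>(i, j)\<in>Sigma {..<k} (\<lambda>i. {Suc i..k}). m i j)"
      by (intro sum.cong) (auto simp: I_def)
    also have "\<dots> = (\<Sum>i<k. \<Sum>j=Suc i..k. m i j)" by (subst sum.Sigma) auto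
    also have "\<dots> = (\<Sum>i<k. b (Suc i) (Suc i) - b i (Suc i))"
      by (intro sum.cong refl sum_cols) auto
    \<comment> \<open>Each term on the left counts the classes born in step \<open>i\<close>, of
      which there are at most as many as new independent cycles; the dimensions of the cycle spaces
      telescope.\<close>
    also have "\<dots> \<le> (\<Sum>i<k. int (chain.dim (cycles (K (Suc i)) q)) - int (chain.dim (cycles (K i) q)))"
    proof (intro sum_mono)
      fix i assume "i \<in> {..<k}"
      then show "b (Suc i) (Suc i) - b i (Suc i) \<le> int (chain.dim (cycles (K (Suc i)) q)) - int (chain.dim (cycles (K i) q))"
        using hom_rank_increment_le[OF fK fK Kmono[of i], of q "Suc i"] by (simp add: b_def)
    qed
    also have "\<dots> = int (chain.dim (cycles (K k) q)) - int (chain.dim (cycles (K 0) q))"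
      by (rule sum_lessThan_telescope)
    also have "\<dots> \<le> int (card F)"
      using dim_cycles_le_card[OF fK, of k q] card_mono[OF F KF, of k] by linarith
    finally show ?thesis by simp
  qed
  moreover have "size (filter_mset (\<lambda>p. p \<in> corner s t) D) = hom_rank q (Y s) (Y t)" if st: "0 \<le> s" "s \<le> t" for s t
  proof -
    let ?A = "idx s" and ?C = "idx t"
    have AC: "?A \<le> ?C" "?C \<le> k" using idx_mono[OF st(2)] idx_le by auto
    have t: "0 \<le> t" using st by simp
    have mem: "pt p \<in> corner s t \<longleftrightarrow> fst p < ?A \<and> ?C \<le> snd p" if "p \<in> I" for p
    proof -
      obtain i j where p: "p = (i, j)" "i < j" "j \<le> k" using \<open>p \<in> I\<close> by (auto simp: I_def)
      have "ennreal (e i) \<le> ennreal s \<longleftrightarrow> i < ?A" using idx[of i s] p st by simp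
      moreover have "ennreal t < (if j < k then ennreal (e j) else \<top>) \<longleftrightarrow> ?C \<le> j"
        using idx[of j t] p t AC by (auto simp: ennreal_less_iff not_less[symmetric])
      ultimately show ?thesis by (simp add: p pt_def corner_def)
    qed
    have "int (size (filter_mset (\<lambda>p. p \<in> corner s t) D)) = (\<Sum>p\<in>I. if pt p \<in> corner s t then int (nat (case_prod m p)) else 0)"
      unfolding D_def by (subst size_filter_sum_replicate[OF fI]) (simp add: if_distrib cong: if_cong)
    also have "\<dots> = (\<Sum>p\<in>I. if pt p \<in> corner s t then case_prod m p else 0)"
      using m_nonneg by (intro sum.cong) (auto simp: I_def)
    also have "\<dots> = (\<Sum>p\<in>{p \<in> I. fst p < ?A \<and> ?C \<le> snd p}. case_prod m p)"
      using fI by (subst sum.inter_filter) (auto simp: mem intro!: sum.cong)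
    \<comment> \<open>From \<open>i < ?A\<close>, \<open>?A \<le> ?C\<close> and
      \<open>?C \<le> j\<close> the condition \<open>i < j\<close> is automatic, so the sum runs
      over a full rectangle and telescopes in both directions.\<close>
    also have "{p \<in> I. fst p < ?A \<and> ?C \<le> snd p} = {..<?A} \<times> {?C..k}"
      using AC by (auto simp: I_def)
    also have "(\<Sum>p\<in>{..<?A} \<times> {?C..k}. case_prod m p) = (\<Sum>i<?A. \<Sum>j=?C..k. m i j)"
      by (simp add: sum.cartesian_product)
    also have "\<dots> = (\<Sum>i<?A. b (Suc i) ?C - b i ?C)" by (intro sum.cong refl sum_cols AC)
    also have "\<dots> = b ?A ?C - b 0 ?C" by (rule sum_lessThan_telescope)
    also have "\<dots> = int (hom_rank q (Y s) (Y t))"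
      using AC(2) unfolding b0 YK[OF st(1)] YK[OF t] by (simp add: b_def)
    finally show ?thesis by simp
  qed
  ultimately show ?thesis by (rule that)
qed

lemma pd_points_spec:
  fixes \<eta> :: "cube \<Rightarrow> ennreal"
  assumes F: "finite F" and Y: "\<And>t. 0 \<le> t \<Longrightarrow> Y t = {Q \<in> F. \<eta> Q \<le> ennreal t}"
  shows "set_mset (pd_points q Y) \<subseteq> Delta" "size (pd_points q Y) \<le> card F"
    "0 \<le> s \<Longrightarrow> s \<le> t \<Longrightarrow> size (filter_mset (\<lambda>p. p \<in> corner s t) (pd_points q Y)) = hom_rank q (Y s) (Y t)"
proof -
  obtain D where D: "set_mset D \<subseteq> Delta" "size D \<le> card F"
    "\<And>s t. 0 \<le> s \<Longrightarrow> s \<le> t \<Longrightarrow> size (filter_mset (\<lambda>p. p \<in> corner s t) D)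
      = hom_rank q {Q \<in> F. \<eta> Q \<le> ennreal s} {Q \<in> F. \<eta> Q \<le> ennreal t}"
    by (rule diagram_exists[OF F, where \<eta>=\<eta> and q=q]) (rule that; assumption)
  have Dh: "size (filter_mset (\<lambda>p. p \<in> corner s t) D) = hom_rank q (Y s) (Y t)" if "0 \<le> s" "s \<le> t" for s t
    using D(3)[OF that] Y[of s] Y[of t] that by simp
  have "pd_points q Y = D"
    unfolding pd_points_def corner_filter betti_def
  proof (rule the_equality)
    show "set_mset D \<subseteq> Delta \<and> (\<forall>s t. 0 \<le> s \<longrightarrow> s \<le> t \<longrightarrow>
      size (filter_mset (\<lambda>p. p \<in> corner s t) D) = hom_rank q (Y s) (Y t))"
      using D Dh by auto
    show "D' = D" if "set_mset D' \<subseteq> Delta \<and> (\<forall>s t. 0 \<le> s \<longrightarrow> s \<le> t \<longrightarrow>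
      size (filter_mset (\<lambda>p. p \<in> corner s t) D') = hom_rank q (Y s) (Y t))" for D'
      using that D Dh by (intro diagram_unique) auto
  qed
  then show "set_mset (pd_points q Y) \<subseteq> Delta" "size (pd_points q Y) \<le> card F"
    "0 \<le> s \<Longrightarrow> s \<le> t \<Longrightarrow> size (filter_mset (\<lambda>p. p \<in> corner s t) (pd_points q Y)) = hom_rank q (Y s) (Y t)"
    using D Dh by auto
qed

lemma pd_eq_atoms:
  assumes "mset xs = pd_points q Y" "set xs \<subseteq> Delta"
  shows "pd q Y = atoms xs"
proof -
  have "pd q Y = measure_of Delta (sets Delta_borel) (emeasure (atoms xs))"
    unfolding pd_def using emeasure_atoms[OF assms(2)] assms(1) sets.space_closed[of Delta_borel]
      sets.sigma_sets_eq[of Delta_borel]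
    by (intro measure_of_eq) auto
  also have "\<dots> = atoms xs"
    using measure_of_of_measure[of "atoms xs"] by simp
  finally show ?thesis .
qed

section \<open>Laws of large numbers\<close>

context prob_space
begin

text \<open>Of the \<open>card G ^ 2\<close> products of centred variables only the diagonal ones
  contribute, each at most \<open>C ^ 2\<close>. Pairwise independence is the form in which
  R-dependence is applied, to two blocks at a time.\<close>

lemma second_moment_average_pairwise_indep:
  fixes Y :: "'i \<Rightarrow> 'a \<Rightarrow> real"
  assumes G: "finite G" "G \<noteq> {}"
    and Y: "\<And>v. v \<in> G \<Longrightarrow> random_variable borel (Y v)" "\<And>v w. v \<in> G \<Longrightarrow> w \<in> space M \<Longrightarrow> 0 \<le> Y v w \<and> Y v w \<le> C"
    and mean: "\<And>v. v \<in> G \<Longrightarrow> expectation (Y v) = e"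
    and indep: "\<And>v v'. v \<in> G \<Longrightarrow> v' \<in> G \<Longrightarrow> v \<noteq> v' \<Longrightarrow> indep_var borel (Y v) borel (Y v')"
  shows "expectation (\<lambda>w. ((\<Sum>v\<in>G. Y v w) / card G - e)\<^sup>2) \<le> C\<^sup>2 / card G"
proof -
  have int: "integrable M (Y v)" if "v \<in> G" for v
    using Y[OF that] by (intro integrable_const_bound[of _ C]) auto
  have e: "0 \<le> e \<and> e \<le> C"
  proof -
    obtain v where v: "v \<in> G" using G by auto
    have "0 \<le> expectation (Y v)" using Y[OF v] by (intro Bochner_Integration.integral_nonneg) auto
    moreover have "expectation (Y v) \<le> C" using Y(2)[OF v] int[OF v] by (intro integral_le_const) auto
    ultimately show ?thesis using mean[OF v] by simp
  qed
  define Z where "Z v w = Y v w - e" for v w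
  have Zm: "random_variable borel (Z v)" if "v \<in> G" for v using Y(1)[OF that] by (simp add: Z_def[abs_def])
  have Zb: "\<bar>Z v w\<bar> \<le> C" if "v \<in> G" "w \<in> space M" for v w
    using Y(2)[OF that] e by (auto simp: Z_def)
  have C0: "0 \<le> C" using e by linarith
  have ZZ: "integrable M (\<lambda>w. Z v w * Z v' w)" if "v \<in> G" "v' \<in> G" for v v'
  proof (rule integrable_const_bound[of _ "C * C"])
    show "AE w in M. norm (Z v w * Z v' w) \<le> C * C"
      using Zb that C0 by (intro AE_I2) (auto simp: abs_mult intro!: mult_mono)
    show "random_variable borel (\<lambda>w. Z v w * Z v' w)" using Zm that by measurable
  qed
  have cov: "expectation (\<lambda>w. Z v w * Z v' w) \<le> (if v = v' then C\<^sup>2 else 0)" if "v \<in> G" "v' \<in> G" for v v'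
  proof (cases "v = v'")
    case True
    have "expectation (\<lambda>w. Z v w * Z v' w) \<le> C\<^sup>2"
    proof (rule integral_le_const[OF ZZ[OF that]])
      show "AE w in M. Z v w * Z v' w \<le> C\<^sup>2"
        using Zb[OF that(1)] C0 unfolding True[symmetric]
        by (intro AE_I2) (auto simp: power2_eq_square[symmetric] abs_le_square_iff[symmetric])
    qed
    then show ?thesis using True by simp
  next
    case False
    have "expectation (\<lambda>w. Y v w * Y v' w) = e * e"
      using indep_var_lebesgue_integral[OF indep[OF that False] int int] that mean by simp
    moreover have YY: "integrable M (\<lambda>w. Y v w * Y v' w)"
      using indep_var_integrable[OF indep[OF that False] int int] that by simp
    moreover have "(\<lambda>w. Z v w * Z v' w) = (\<lambda>w. Y v w * Y v' w - e * Y v w - e * Y v' w + e * e)"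
      by (auto simp: Z_def algebra_simps)
    ultimately have "expectation (\<lambda>w. Z v w * Z v' w) = 0"
      using int[OF that(1)] int[OF that(2)] mean[OF that(1)] mean[OF that(2)] by (simp add: prob_space)
    then show ?thesis using False by simp
  qed
  have cG: "card G > 0" using G by (simp add: card_gt_0_iff)
  have "(\<Sum>v\<in>G. Y v w) / card G - e = (\<Sum>v\<in>G. Z v w) / card G" for w
    using cG by (simp add: Z_def sum_subtractf diff_divide_distrib)
  then have "expectation (\<lambda>w. ((\<Sum>v\<in>G. Y v w) / card G - e)\<^sup>2)
      = expectation (\<lambda>w. (\<Sum>v\<in>G. \<Sum>v'\<in>G. Z v w * Z v' w) / (card G)\<^sup>2)"
    by (simp add: power_divide power2_eq_square sum_product)
  also have "\<dots> = (\<Sum>v\<in>G. \<Sum>v'\<in>G. expectation (\<lambda>w. Z v w * Z v' w)) / (card G)\<^sup>2"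
    using ZZ by (simp add: Bochner_Integration.integral_sum)
  also have "\<dots> \<le> (\<Sum>v\<in>G. \<Sum>v'\<in>G. if v = v' then C\<^sup>2 else 0) / (card G)\<^sup>2"
    by (intro divide_right_mono sum_mono cov) auto
  also have "\<dots> = card G * C\<^sup>2 / (card G)\<^sup>2" using G by simp
  also have "\<dots> = C\<^sup>2 / card G" using cG by (simp add: power2_eq_square)
  finally show ?thesis .
qed

text \<open>The series of squares has finite expectation, so almost surely it converges and its
  terms tend to 0.\<close>

lemma AE_tendsto_0_if_second_moments_summable:
  fixes Z :: "nat \<Rightarrow> 'a \<Rightarrow> real"
  assumes Z: "\<And>k. random_variable borel (Z k)" "\<And>k. integrable M (\<lambda>w. (Z k w)\<^sup>2)"
    and a: "\<And>k. expectation (\<lambda>w. (Z k w)\<^sup>2) \<le> a k" "summable a"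
  shows "AE w in M. (\<lambda>k. Z k w) \<longlonglongrightarrow> 0"
proof -
  have [measurable]: "\<And>k. random_variable borel (Z k)" by (rule Z(1))
  have a0: "0 \<le> a k" for k
    by (rule order_trans[OF _ a(1)[of k]]) (intro Bochner_Integration.integral_nonneg, simp)
  have "(\<integral>\<^sup>+w. (\<Sum>k. ennreal ((Z k w)\<^sup>2)) \<partial>M) = (\<Sum>k. \<integral>\<^sup>+w. ennreal ((Z k w)\<^sup>2) \<partial>M)"
    by (rule nn_integral_suminf) measurable
  also have "\<dots> \<le> (\<Sum>k. ennreal (a k))"
  proof (intro suminf_le)
    show "(\<integral>\<^sup>+w. ennreal ((Z k w)\<^sup>2) \<partial>M) \<le> ennreal (a k)" for k
      using a(1)[of k] Z(2)[of k] by (subst nn_integral_eq_integral) (auto intro: ennreal_leI)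
  qed auto
  also have "\<dots> = ennreal (\<Sum>k. a k)" using a0 a(2) by (intro suminf_ennreal2) auto
  also have "\<dots> < \<infinity>" by simp
  finally have "(\<integral>\<^sup>+w. (\<Sum>k. ennreal ((Z k w)\<^sup>2)) \<partial>M) \<noteq> \<infinity>" by simp
  then have "AE w in M. (\<Sum>k. ennreal ((Z k w)\<^sup>2)) \<noteq> \<infinity>"
    by (intro nn_integral_PInf_AE) auto
  then show ?thesis
  proof eventually_elim
    case (elim w)
    have "summable (\<lambda>k. (Z k w)\<^sup>2)"
      using elim by (intro summable_suminf_not_top) (auto simp: infinity_ennreal_def)
    then have "(\<lambda>k. (Z k w)\<^sup>2) \<longlonglongrightarrow> 0" by (rule summable_LIMSEQ_zero)
    then have "(\<lambda>k. sqrt ((Z k w)\<^sup>2)) \<longlonglongrightarrow> sqrt 0" by (rule tendsto_real_sqrt)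
    then show "(\<lambda>k. Z k w) \<longlonglongrightarrow> 0" by (simp add: tendsto_rabs_zero_iff)
  qed
qed

end

section \<open>Deterministic limits of nearly additive sequences\<close>

lemma affine_quotient_tendsto:
  fixes a b c e :: real
  assumes "c > 0"
  shows "(\<lambda>n. (a * real n + b) / (c * real n + e)) \<longlonglongrightarrow> a / c"
proof -
  have "(\<lambda>n. (a + b / real n) / (c + e / real n)) \<longlonglongrightarrow> (a + 0) / (c + 0)"
    using assms by (intro tendsto_divide tendsto_add tendsto_const lim_const_over_n) auto
  moreover have "\<forall>\<^sub>F n in sequentially. (a + b / real n) / (c + e / real n) = (a * real n + b) / (c * real n + e)"
    using eventually_gt_at_top[of 0]
  proof eventually_elim
    case (elim n)
    have "(a * real n + b) / (c * real n + e) = (real n * (a + b / real n)) / (real n * (c + e / real n))"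
      using elim by (simp add: algebra_simps)
    also have "\<dots> = (a + b / real n) / (c + e / real n)" using elim by simp
    finally show ?case by simp
  qed
  ultimately show ?thesis by (simp add: tendsto_cong)
qed

lemma nat_div_bounds:
  "real (x div L) \<le> real x / real L" "real x / real L - 1 \<le> real (x div L)"
proof -
  have "real_of_int \<lfloor>real x / real L\<rfloor> = real (x div L)" by (simp only: floor_divide_of_nat_eq of_int_of_nat_eq)
  then show "real (x div L) \<le> real x / real L" "real x / real L - 1 \<le> real (x div L)" by linarith+
qed

text \<open>Numerator and denominator count the cubes in the blocks and in the box.\<close>
lemma block_ratio_tendsto:
  assumes "L > 0"
  shows "(\<lambda>n. real (((2 * ((n - m) div L) + 1) * (4 * m + 1)) ^ d) / real ((4 * n + 1) ^ d))
    \<longlonglongrightarrow> ((4 * real m + 1) / (2 * real L)) ^ d"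
proof -
  let ?J = "\<lambda>n. (n - m) div L"
  let ?c = "4 * real m + 1"
  have cells: "real ((2 * ?J n + 1) * (4 * m + 1)) = (2 * real (?J n) + 1) * ?c" for n by (simp add: algebra_simps)
  \<comment> \<open>Replacing the integer quotient by \<open>(n - m) / L\<close>, which differs from
    it by at most 1, encloses the numerator between the affine functions with
    \<open>b = - ?c\<close> and \<open>b = ?c\<close>.\<close>
  define g where "g b n = ((2 * ?c / real L) * real n + (- 2 * real m * ?c / real L + b)) / (4 * real n + 1)" for b n
  have "(2 * ?c / real L) / 4 = ?c / (2 * real L)"
    using assms by (simp only: divide_divide_eq_left frac_eq_eq)
  then have g: "g b \<longlonglongrightarrow> ?c / (2 * real L)" for b
    using affine_quotient_tendsto[where c=4 and e=1 and a="2 * ?c / real L" and b="- 2 * real m * ?c / real L + b",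
        OF zero_less_numeral] by (simp only: g_def[abs_def])
  have g_eq: "g b n = (2 * (real (n - m) / real L) * ?c + b) / real (4 * n + 1)" if "m \<le> n" for b n
  proof -
    have "2 * (real (n - m) / real L) * ?c + b = (2 * ?c / real L) * real n + (- 2 * real m * ?c / real L + b)"
      using that assms by (simp add: of_nat_diff field_simps)
    moreover have "real (4 * n + 1) = 4 * real n + 1" by simp
    ultimately show ?thesis by (simp only: g_def)
  qed
  have "(\<lambda>n. real ((2 * ?J n + 1) * (4 * m + 1)) / real (4 * n + 1)) \<longlonglongrightarrow> ?c / (2 * real L)"
  proof (rule tendsto_sandwich[OF _ _ g[of "- ?c"] g[of ?c]])
    have "(2 * (real (n - m) / real L - 1) + 1) * ?c \<le> (2 * real (?J n) + 1) * ?c" for n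
      using nat_div_bounds(2)[of "n - m" L] by (intro mult_right_mono) auto
    then have "2 * (real (n - m) / real L) * ?c + - ?c \<le> real ((2 * ?J n + 1) * (4 * m + 1))" for n
      by (simp only: cells) (simp add: algebra_simps)
    then show "\<forall>\<^sub>F n in sequentially. g (- ?c) n \<le> real ((2 * ?J n + 1) * (4 * m + 1)) / real (4 * n + 1)"
      using eventually_ge_at_top[of m]
      by (elim eventually_mono) (simp only: g_eq, intro divide_right_mono, simp_all only: of_nat_0_le_iff)
    have "(2 * real (?J n) + 1) * ?c \<le> (2 * (real (n - m) / real L) + 1) * ?c" for n
      using nat_div_bounds(1)[of "n - m" L] by (intro mult_right_mono) auto
    then have "real ((2 * ?J n + 1) * (4 * m + 1)) \<le> 2 * (real (n - m) / real L) * ?c + ?c" for n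
      by (simp only: cells) (simp add: algebra_simps)
    then show "\<forall>\<^sub>F n in sequentially. real ((2 * ?J n + 1) * (4 * m + 1)) / real (4 * n + 1) \<le> g ?c n"
      using eventually_ge_at_top[of m]
      by (elim eventually_mono) (simp only: g_eq, intro divide_right_mono, simp_all only: of_nat_0_le_iff)
  qed
  then have "(\<lambda>n. (real ((2 * ?J n + 1) * (4 * m + 1)) / real (4 * n + 1)) ^ d) \<longlonglongrightarrow> (?c / (2 * real L)) ^ d"
    by (rule tendsto_power)
  then show ?thesis by (simp only: power_divide of_nat_power)
qed

text \<open>The deterministic core, applied to one outcome at a time: \<open>V\<close> counts the
  cubes of the box, \<open>W\<close> those in blocks, and \<open>S\<close> is the sum over the
  blocks, whose averages are known to converge along squares only. The box grows first, then the
  blocks. Naming the limit by \<open>y\<close> alone makes it a function of the block means, hence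
  the same constant for almost every outcome.\<close>

lemma near_additive_limit:
  fixes d R :: nat and \<beta> :: "nat \<Rightarrow> real" and S :: "nat \<Rightarrow> nat \<Rightarrow> real" and y :: "nat \<Rightarrow> real"
  defines "V \<equiv> \<lambda>n. real ((4 * n + 1) ^ d)"
    and "W \<equiv> \<lambda>m n. real (((2 * ((n - m) div (2 * m + R + 1)) + 1) * (4 * m + 1)) ^ d)"
  assumes block: "\<And>m n. m \<le> n \<Longrightarrow> \<bar>\<beta> n - S m n\<bar> \<le> 2 * (V n - W m n)"
    and mono: "\<And>n n'. n \<le> n' \<Longrightarrow> \<bar>\<beta> n' - \<beta> n\<bar> \<le> 2 * (V n' - V n)"
    and bound: "\<And>m n. \<bar>S m n\<bar> \<le> W m n"
    and lim: "\<And>m. (\<lambda>k. S m (k\<^sup>2) / W m (k\<^sup>2)) \<longlonglongrightarrow> y m"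
  shows "convergent y" "(\<lambda>n. \<beta> n / V n) \<longlonglongrightarrow> Topological_Spaces.lim y"
proof -
  \<comment> \<open>The asymptotic fraction of the cubes of the box that lie in blocks; it tends to
    1 because the gaps have fixed width \<open>R + 1\<close> while \<open>m\<close> grows.\<close>
  define \<rho> where "\<rho> m = ((4 * real m + 1) / (2 * real (2 * m + R + 1))) ^ d" for m
  have sq: "filterlim (\<lambda>k::nat. k\<^sup>2) sequentially sequentially"
    by (rule filterlim_subseq) (auto simp: strict_mono_def power_strict_mono)
  have Vpos: "V n > 0" for n unfolding V_def by simp
  have Wpos: "W m n > 0" for m n unfolding W_def of_nat_0_less_iff by simp
  define x where "x k = \<beta> (k\<^sup>2) / V (k\<^sup>2)" for k :: nat
  have r: "(\<lambda>n. W m n / V n) \<longlonglongrightarrow> \<rho> m" for m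
    unfolding W_def V_def \<rho>_def using block_ratio_tendsto[of "2 * m + R + 1" m d] by simp
  have r2: "(\<lambda>k. W m (k\<^sup>2) / V (k\<^sup>2)) \<longlonglongrightarrow> \<rho> m" for m
    using filterlim_compose[OF r sq] .
  have y1: "\<bar>y m\<bar> \<le> 1" for m
  proof (rule tendsto_upperbound[OF tendsto_rabs[OF lim]])
    show "\<forall>\<^sub>F k in sequentially. \<bar>S m (k\<^sup>2) / W m (k\<^sup>2)\<bar> \<le> 1"
      using bound Wpos by (intro always_eventually allI) (simp add: abs_divide abs_of_pos divide_le_eq)
  qed simp
  have \<rho>1: "\<rho> m \<le> 1" for m
    unfolding \<rho>_def by (intro power_le_one) (auto simp: field_simps)
  have close: "\<bar>x k - y m\<bar> \<le> 2 * (1 - W m (k\<^sup>2) / V (k\<^sup>2)) + \<bar>W m (k\<^sup>2) / V (k\<^sup>2) * (S m (k\<^sup>2) / W m (k\<^sup>2)) - y m\<bar>"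
    if "m \<le> k\<^sup>2" for m k
  proof -
    have "\<bar>x k - S m (k\<^sup>2) / V (k\<^sup>2)\<bar> = \<bar>\<beta> (k\<^sup>2) - S m (k\<^sup>2)\<bar> / V (k\<^sup>2)"
      unfolding x_def using Vpos[of "k\<^sup>2"] by (simp add: diff_divide_distrib[symmetric] abs_divide)
    also have "\<dots> \<le> 2 * (V (k\<^sup>2) - W m (k\<^sup>2)) / V (k\<^sup>2)"
      using block[OF that] Vpos[of "k\<^sup>2"] by (intro divide_right_mono) auto
    also have "\<dots> = 2 * (1 - W m (k\<^sup>2) / V (k\<^sup>2))" using Vpos[of "k\<^sup>2"] by (simp add: field_simps)
    moreover have "W m (k\<^sup>2) / V (k\<^sup>2) * (S m (k\<^sup>2) / W m (k\<^sup>2)) = S m (k\<^sup>2) / V (k\<^sup>2)"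
      using Wpos[of m "k\<^sup>2"] by simp
    ultimately show ?thesis by linarith
  qed
  \<comment> \<open>Twice the uncovered fraction is the error of cutting into blocks. One more such
    fraction comes from normalising by \<open>V\<close> instead of \<open>W\<close>, as the absolute
    value of \<open>y m\<close> is at most 1.\<close>
  have ev: "\<forall>\<^sub>F k in sequentially. \<bar>x k - y m\<bar> < 3 * (1 - \<rho> m) + \<epsilon>" if "\<epsilon> > 0" for m \<epsilon>
  proof -
    have "(\<lambda>k. 2 * (1 - W m (k\<^sup>2) / V (k\<^sup>2)) + \<bar>W m (k\<^sup>2) / V (k\<^sup>2) * (S m (k\<^sup>2) / W m (k\<^sup>2)) - y m\<bar>)
        \<longlonglongrightarrow> 2 * (1 - \<rho> m) + \<bar>\<rho> m * y m - y m\<bar>"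
      by (intro tendsto_intros r2 lim)
    moreover have "\<bar>\<rho> m * y m - y m\<bar> \<le> 1 - \<rho> m"
    proof -
      have "\<bar>\<rho> m * y m - y m\<bar> = \<bar>1 - \<rho> m\<bar> * \<bar>y m\<bar>" by (simp add: abs_mult[symmetric] algebra_simps abs_minus_commute)
      also have "\<dots> \<le> \<bar>1 - \<rho> m\<bar> * 1" by (intro mult_left_mono y1) simp
      finally show ?thesis using \<rho>1[of m] by simp
    qed
    ultimately have "\<forall>\<^sub>F k in sequentially. 2 * (1 - W m (k\<^sup>2) / V (k\<^sup>2)) + \<bar>W m (k\<^sup>2) / V (k\<^sup>2) * (S m (k\<^sup>2) / W m (k\<^sup>2)) - y m\<bar> < 3 * (1 - \<rho> m) + \<epsilon>"
      using that by (intro order_tendstoD(2)) auto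
    moreover have "\<forall>\<^sub>F k in sequentially. m \<le> k\<^sup>2" using filterlim_at_top[THEN iffD1, OF sq] by blast
    ultimately show ?thesis
      by eventually_elim (use close in fastforce)
  qed
  have "(\<lambda>m. (4 * real m + 1) / (4 * real m + (2 * real R + 2))) \<longlonglongrightarrow> 4 / 4"
    by (rule affine_quotient_tendsto) simp
  then have "(\<lambda>m. ((4 * real m + 1) / (4 * real m + (2 * real R + 2))) ^ d) \<longlonglongrightarrow> (4 / 4) ^ d"
    by (rule tendsto_power)
  then have \<rho>_lim: "\<rho> \<longlonglongrightarrow> 1" by (simp add: \<rho>_def[abs_def] algebra_simps)
  have "Cauchy x"
  proof (rule metric_CauchyI)
    fix \<epsilon> :: real assume "\<epsilon> > 0"
    have "(\<lambda>m. 3 * (1 - \<rho> m)) \<longlonglongrightarrow> 3 * (1 - 1)" by (intro tendsto_intros \<rho>_lim)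
    then have "\<forall>\<^sub>F m in sequentially. 3 * (1 - \<rho> m) < \<epsilon> / 4"
      using \<open>\<epsilon> > 0\<close> by (intro order_tendstoD(2)) auto
    \<comment> \<open>With this \<open>m\<close> all late \<open>x k\<close> are within half of
      \<epsilon> of the same number \<open>y m\<close>.\<close>
    then obtain m where m: "3 * (1 - \<rho> m) < \<epsilon> / 4" by (auto simp: eventually_sequentially)
    obtain k0 where k0: "\<And>k. k \<ge> k0 \<Longrightarrow> \<bar>x k - y m\<bar> < 3 * (1 - \<rho> m) + \<epsilon> / 4"
      using ev[of "\<epsilon> / 4" m] \<open>\<epsilon> > 0\<close> by (auto simp: eventually_sequentially)
    have "dist (x k) (x k') < \<epsilon>" if "k \<ge> k0" "k' \<ge> k0" for k k'
      using k0[OF that(1)] k0[OF that(2)] m unfolding dist_real_def by linarith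
    then show "\<exists>M. \<forall>k\<ge>M. \<forall>k'\<ge>M. dist (x k) (x k') < \<epsilon>" by blast
  qed
  then obtain a where a: "x \<longlonglongrightarrow> a" using Cauchy_convergent convergentD by blast
  have ya: "\<bar>y m - a\<bar> \<le> 3 * (1 - \<rho> m)" for m
  proof (rule field_le_epsilon)
    fix \<epsilon> :: real assume "\<epsilon> > 0"
    have "(\<lambda>k. \<bar>x k - y m\<bar>) \<longlonglongrightarrow> \<bar>a - y m\<bar>" by (intro tendsto_intros a)
    then have "\<bar>a - y m\<bar> \<le> 3 * (1 - \<rho> m) + \<epsilon>"
      by (rule tendsto_upperbound) (use ev[OF \<open>\<epsilon> > 0\<close>, of m] in \<open>auto elim: eventually_mono\<close>)
    then show "\<bar>y m - a\<bar> \<le> 3 * (1 - \<rho> m) + \<epsilon>" by (simp add: abs_minus_commute)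
  qed
  have "(\<lambda>m. y m - a) \<longlonglongrightarrow> 0"
  proof (rule Lim_null_comparison)
    show "\<forall>\<^sub>F m in sequentially. norm (y m - a) \<le> 3 * (1 - \<rho> m)" using ya by simp
    have "(\<lambda>m. 3 * (1 - \<rho> m)) \<longlonglongrightarrow> 3 * (1 - 1)" by (intro tendsto_intros \<rho>_lim)
    then show "(\<lambda>m. 3 * (1 - \<rho> m)) \<longlonglongrightarrow> 0" by simp
  qed
  then have y: "y \<longlonglongrightarrow> a" by (simp add: LIM_zero_iff)
  then show "convergent y" by (rule convergentI)
  \<comment> \<open>Interpolation: \<open>n\<close> lies between consecutive squares, whose ratio
    tends to 1. So the boxes of sizes \<open>n\<close> and \<open>(k n) ^ 2\<close> have
    asymptotically equally many cubes, and by \<open>mono\<close> the normalised values agree in the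
    limit.\<close>
  define k where "k n = nat \<lfloor>sqrt (real n)\<rfloor>" for n
  have k: "(k n)\<^sup>2 \<le> n" "n \<le> (k n + 1)\<^sup>2" for n
  proof -
    have kr: "real (k n) \<le> sqrt (real n)" "sqrt (real n) \<le> real (k n) + 1"
      unfolding k_def by (simp_all add: of_nat_nat)
    have "(real (k n))\<^sup>2 \<le> (sqrt (real n))\<^sup>2" using kr by (intro power_mono) auto
    then have "real ((k n)\<^sup>2) \<le> real n" by simp
    then show "(k n)\<^sup>2 \<le> n" by (simp only: of_nat_le_iff)
    have "(sqrt (real n))\<^sup>2 \<le> (real (k n) + 1)\<^sup>2" using kr by (intro power_mono) auto
    then have "real n \<le> real ((k n + 1)\<^sup>2)" by (simp add: algebra_simps)
    then show "n \<le> (k n + 1)\<^sup>2" by (simp only: of_nat_le_iff)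
  qed
  have k_lim: "filterlim k sequentially sequentially"
    unfolding filterlim_at_top
  proof
    fix N
    show "\<forall>\<^sub>F n in sequentially. N \<le> k n"
      using eventually_ge_at_top[of "(N + 1)\<^sup>2"]
    proof eventually_elim
      case (elim n)
      then have "(N + 1)\<^sup>2 \<le> (k n + 1)\<^sup>2" using k(2)[of n] by linarith
      then have "N + 1 \<le> k n + 1" by (rule power2_le_imp_le) simp
      then show ?case by simp
    qed
  qed
  have ratio: "(\<lambda>n. V ((k n)\<^sup>2) / V n) \<longlonglongrightarrow> 1"
  proof -
    have "(\<lambda>n. real (4 * (k n)\<^sup>2 + 1) / real (4 * n + 1)) \<longlonglongrightarrow> 1"
    proof (rule tendsto_sandwich)
      have "(\<lambda>j. ((1 * real j + 0) / (1 * real j + 1))\<^sup>2) \<longlonglongrightarrow> (1 / 1)\<^sup>2"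
        by (intro tendsto_power affine_quotient_tendsto) simp
      then have "(\<lambda>j. (real j / (real j + 1))\<^sup>2) \<longlonglongrightarrow> 1" by simp
      then show "(\<lambda>n. (real (k n) / (real (k n) + 1))\<^sup>2) \<longlonglongrightarrow> 1"
        using k_lim by (rule filterlim_compose)
      show "\<forall>\<^sub>F n in sequentially. (real (k n) / (real (k n) + 1))\<^sup>2 \<le> real (4 * (k n)\<^sup>2 + 1) / real (4 * n + 1)"
      proof (intro always_eventually allI)
        fix n
        let ?a = "(real (k n))\<^sup>2" and ?b = "(real (k n) + 1)\<^sup>2"
        have nb: "real n \<le> ?b" using k(2)[of n] by (metis of_nat_1 of_nat_add of_nat_le_iff of_nat_power)
        have ab: "?a \<le> ?b" by (intro power_mono) auto
        have bpos: "0 < ?b" by (intro zero_less_power) simp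
        have "?a * (4 * real n + 1) \<le> ?a * (4 * ?b + 1)" using nb by (intro mult_left_mono) auto
        also have "\<dots> \<le> (4 * ?a + 1) * ?b" using ab by (simp add: algebra_simps)
        finally have "?a / ?b \<le> (4 * ?a + 1) / (4 * real n + 1)"
          using bpos by (simp add: divide_le_eq le_divide_eq frac_le_eq)
        then show "(real (k n) / (real (k n) + 1))\<^sup>2 \<le> real (4 * (k n)\<^sup>2 + 1) / real (4 * n + 1)"
          by (simp add: power_divide add.commute)
      qed
      show "\<forall>\<^sub>F n in sequentially. real (4 * (k n)\<^sup>2 + 1) / real (4 * n + 1) \<le> 1"
        using k(1) by (intro always_eventually allI) (simp add: divide_le_eq flip: of_nat_power)
    qed auto
    then have "(\<lambda>n. (real (4 * (k n)\<^sup>2 + 1) / real (4 * n + 1)) ^ d) \<longlonglongrightarrow> 1 ^ d" by (rule tendsto_power)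
    then show ?thesis unfolding V_def by (simp only: power_divide of_nat_power power_one)
  qed
  have "(\<lambda>n. \<beta> n / V n - x (k n) * (V ((k n)\<^sup>2) / V n)) \<longlonglongrightarrow> 0"
  proof (rule Lim_null_comparison)
    have "(\<lambda>n. 2 * (1 - V ((k n)\<^sup>2) / V n)) \<longlonglongrightarrow> 2 * (1 - 1)" by (intro tendsto_intros ratio)
    then show "(\<lambda>n. 2 * (1 - V ((k n)\<^sup>2) / V n)) \<longlonglongrightarrow> 0" by simp
    show "\<forall>\<^sub>F n in sequentially. norm (\<beta> n / V n - x (k n) * (V ((k n)\<^sup>2) / V n)) \<le> 2 * (1 - V ((k n)\<^sup>2) / V n)"
    proof (intro always_eventually allI)
      fix n
      have "x (k n) * (V ((k n)\<^sup>2) / V n) = \<beta> ((k n)\<^sup>2) / V n"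
        unfolding x_def using Vpos[of "(k n)\<^sup>2"] by simp
      then have "norm (\<beta> n / V n - x (k n) * (V ((k n)\<^sup>2) / V n)) = \<bar>\<beta> n - \<beta> ((k n)\<^sup>2)\<bar> / V n"
        using Vpos[of n] by (simp add: diff_divide_distrib[symmetric] abs_divide)
      also have "\<dots> \<le> 2 * (V n - V ((k n)\<^sup>2)) / V n"
        using mono[OF k(1)[of n]] Vpos[of n] by (intro divide_right_mono) auto
      also have "\<dots> = 2 * (1 - V ((k n)\<^sup>2) / V n)" using Vpos[of n] by (simp add: field_simps)
      finally show "norm (\<beta> n / V n - x (k n) * (V ((k n)\<^sup>2) / V n)) \<le> 2 * (1 - V ((k n)\<^sup>2) / V n)" .
    qed
  qed
  moreover have "(\<lambda>n. x (k n) * (V ((k n)\<^sup>2) / V n)) \<longlonglongrightarrow> a * 1"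
    by (intro tendsto_mult ratio filterlim_compose[OF a k_lim])
  ultimately have "(\<lambda>n. (\<beta> n / V n - x (k n) * (V ((k n)\<^sup>2) / V n)) + x (k n) * (V ((k n)\<^sup>2) / V n)) \<longlonglongrightarrow> 0 + a * 1"
    by (rule tendsto_add)
  then show "(\<lambda>n. \<beta> n / V n) \<longlonglongrightarrow> Topological_Spaces.lim y" using limI[OF y] by simp
qed

section \<open>Random cubical filtrations\<close>

text \<open>Right-continuity makes the infimum in \<open>birth\<close> attained, so a cubical
  filtration is the sublevel filtration of its birth times.\<close>

lemma filtration_mem_iff:
  assumes X: "cubical_filtration d X" and t: "0 \<le> t"
  shows "Q \<in> X t \<longleftrightarrow> birth X Q \<le> ennreal t"
proof
  assume "Q \<in> X t"
  then show "birth X Q \<le> ennreal t" unfolding birth_def using t by (intro INF_lower) auto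
next
  assume b: "birth X Q \<le> ennreal t"
  have "Q \<in> X t'" if "t < t'" for t'
  proof -
    have "ennreal t < ennreal t'" using that t by (simp add: ennreal_lessI)
    then have "birth X Q < ennreal t'" using b by simp
    then obtain u where u: "0 \<le> u" "Q \<in> X u" "ennreal u < ennreal t'"
      unfolding birth_def INF_less_iff by auto
    then have "u \<le> t'" by (simp add: ennreal_less_iff)
    then show ?thesis using X u unfolding cubical_filtration_def by blast
  qed
  then have "Q \<in> (\<Inter>t'\<in>{t<..}. X t')" by simp
  then show "Q \<in> X t" using X t unfolding cubical_filtration_def by metis
qed

definition sublevel_rank :: "nat \<Rightarrow> cube set \<Rightarrow> real \<Rightarrow> real \<Rightarrow> (cube \<Rightarrow> ennreal) \<Rightarrow> nat" where
  "sublevel_rank q S s t \<eta> = hom_rank q {Q \<in> S. \<eta> Q \<le> ennreal s} {Q \<in> S. \<eta> Q \<le> ennreal t}"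

lemma sublevel_rank_cong:
  assumes "\<And>Q. Q \<in> S \<Longrightarrow> \<eta> Q = \<eta>' Q"
  shows "sublevel_rank q S s t \<eta> = sublevel_rank q S s t \<eta>'"
proof -
  have "{Q \<in> S. \<eta> Q \<le> c} = {Q \<in> S. \<eta>' Q \<le> c}" for c using assms by auto
  then show ?thesis by (simp add: sublevel_rank_def)
qed

lemma sublevel_rank_le:
  assumes "finite S"
  shows "sublevel_rank q S s t \<eta> \<le> card S"
proof -
  have "sublevel_rank q S s t \<eta> \<le> card {Q \<in> S. \<eta> Q \<le> ennreal s}"
    unfolding sublevel_rank_def using assms by (intro hom_rank_le_card) auto
  also have "\<dots> \<le> card S" using assms by (intro card_mono) auto
  finally show ?thesis .
qed

text \<open>Sublevel sets take values in the finite set \<open>Pow S\<close>, on which every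
  function is measurable; no property of \<open>hom_rank\<close> enters.\<close>

lemma measurable_sublevel_rank:
  assumes S: "finite S" and e: "\<And>Q. Q \<in> S \<Longrightarrow> (\<lambda>w. e w Q) \<in> borel_measurable N"
  shows "(\<lambda>w. real (sublevel_rank q S s t (e w))) \<in> borel_measurable N"
proof -
  have lev: "(\<lambda>w. {Q \<in> S. e w Q \<le> c}) \<in> N \<rightarrow>\<^sub>M count_space (Pow S)" for c
  proof (subst measurable_count_space_eq2)
    show "finite (Pow S)" using S by simp
    have "(\<lambda>w. {Q \<in> S. e w Q \<le> c}) -` {K} \<inter> space N \<in> sets N" if "K \<in> Pow S" for K
    proof -
      have "(\<lambda>w. {Q \<in> S. e w Q \<le> c}) -` {K} \<inter> space N = {w \<in> space N. \<forall>Q\<in>S. (e w Q \<le> c) = (Q \<in> K)}"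
        using that by auto
      also have "\<dots> \<in> sets N"
      proof (rule sets.sets_Collect_finite_All[OF _ S])
        fix Q assume Q: "Q \<in> S"
        note [measurable] = e[OF Q]
        show "{w \<in> space N. (e w Q \<le> c) = (Q \<in> K)} \<in> sets N" by measurable
      qed
      finally show ?thesis .
    qed
    then show "(\<lambda>w. {Q \<in> S. e w Q \<le> c}) \<in> space N \<rightarrow> Pow S \<and>
        (\<forall>K\<in>Pow S. (\<lambda>w. {Q \<in> S. e w Q \<le> c}) -` {K} \<inter> space N \<in> sets N)" by auto
  qed
  have "(\<lambda>w. real (hom_rank q {Q \<in> S. e w Q \<le> ennreal s} {Q \<in> S. e w Q \<le> ennreal t})) \<in> borel_measurable N"
  proof (rule measurable_compose_countable'[OF _ lev[of "ennreal s"]])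
    show "countable (Pow S)" using S by (intro countable_finite) simp
    show "(\<lambda>w. real (hom_rank q K {Q \<in> S. e w Q \<le> ennreal t})) \<in> borel_measurable N" for K
      by (rule measurable_compose[OF lev[of "ennreal t"], of "\<lambda>L. real (hom_rank q K L)"]) simp
  qed
  then show ?thesis by (simp add: sublevel_rank_def)
qed

lemma sublevel_rank_block:
  assumes "length z = d"
  shows "sublevel_rank q (block d m z) s t \<eta> = sublevel_rank q (box_cubes d m) s t (\<lambda>Q. \<eta> (shift_cube z Q))"
proof -
  have "{Q \<in> block d m z. \<eta> Q \<le> c} = shift_cube z ` {Q \<in> box_cubes d m. \<eta> (shift_cube z Q) \<le> c}" for c
    by (auto simp: block_def)
  moreover have "{Q \<in> box_cubes d m. \<eta> (shift_cube z Q) \<le> c} \<subseteq> cubes (length z)" for c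
    using assms by (auto simp: box_cubes_def)
  ultimately show ?thesis unfolding sublevel_rank_def by (simp add: hom_rank_shift_cube)
qed

lemma box_cubes_subset_cubes: "box_cubes d n \<subseteq> cubes d"
  by (auto simp: box_cubes_def)

lemma block_subset_cubes: "length z = d \<Longrightarrow> block d m z \<subseteq> cubes d"
  by (auto simp: block_iff cubes_def)

section \<open>Block averages and almost sure limits of normalised ranks\<close>

locale dependent_cubical_filtration =
  fixes P :: "'w measure" and d R q :: nat and X :: "'w \<Rightarrow> real \<Rightarrow> cube set"
  assumes filtration: "random_cubical_filtration P d X"
    and stat: "stationary P d X"
    and dep: "R_dependent P d R X"
    and q_less: "q < d"

sublocale dependent_cubical_filtration \<subseteq> prob_space P
  using filtration by (simp add: random_cubical_filtration_def)

context dependent_cubical_filtration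
begin

lemma measurable_birth: "Q \<in> cubes d \<Longrightarrow> (\<lambda>w. birth (X w) Q) \<in> borel_measurable P"
  using filtration by (auto simp: random_cubical_filtration_def)

lemma restrict_box_eq:
  assumes "w \<in> space P" "0 \<le> t"
  shows "restrict_box n (X w) t = {Q \<in> box_cubes d n. birth (X w) Q \<le> ennreal t}"
proof -
  have X: "cubical_filtration d (X w)" using filtration assms by (auto simp: random_cubical_filtration_def)
  then have "cubical_set d (X w t)" using assms(2) unfolding cubical_filtration_def by blast
  then have "X w t \<subseteq> cubes d" by (simp add: cubical_set_def)
  then show ?thesis using filtration_mem_iff[OF X assms(2)] by (auto simp: restrict_box_def box_cubes_def)
qed

lemma measurable_rank_births:
  assumes "finite S" "S \<subseteq> cubes d"
  shows "(\<lambda>w. real (sublevel_rank q S s t (birth (X w)))) \<in> borel_measurable P"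
  using assms measurable_birth by (intro measurable_sublevel_rank) auto

text \<open>The rank of a block is the rank of the centred box evaluated at shifted birth times, and
  stationarity identifies the laws of the two families.\<close>

lemma expectation_block:
  assumes z: "length z = d"
  shows "expectation (\<lambda>w. real (sublevel_rank q (block d m z) s t (birth (X w))))
       = expectation (\<lambda>w. real (sublevel_rank q (box_cubes d m) s t (birth (X w))))"
proof -
  let ?N = "PiM (cubes d) (\<lambda>_. borel :: ennreal measure)"
  let ?g = "\<lambda>\<eta>. real (sublevel_rank q (box_cubes d m) s t \<eta>)"
  have g: "?g \<in> borel_measurable ?N"
    using box_cubes_subset_cubes by (intro measurable_sublevel_rank measurable_component_singleton) auto
  have sh: "shift_cube z Q \<in> cubes d" if "Q \<in> cubes d" for Q using that z by (simp add: cubes_def)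
  have m1: "(\<lambda>w. restrict (\<lambda>Q. birth (X w) (shift_cube z Q)) (cubes d)) \<in> P \<rightarrow>\<^sub>M ?N"
    by (intro measurable_restrict measurable_birth sh)
  have m2: "(\<lambda>w. birth_family d (X w)) \<in> P \<rightarrow>\<^sub>M ?N"
    unfolding birth_family_def by (intro measurable_restrict measurable_birth)
  have r: "?g (restrict \<eta> (cubes d)) = ?g \<eta>" for \<eta>
    using box_cubes_subset_cubes[of d m] by (intro arg_cong[where f=real] sublevel_rank_cong) auto
  have "expectation (\<lambda>w. real (sublevel_rank q (block d m z) s t (birth (X w))))
      = expectation (\<lambda>w. ?g (restrict (\<lambda>Q. birth (X w) (shift_cube z Q)) (cubes d)))"
    unfolding r sublevel_rank_block[OF z] ..
  also have "\<dots> = integral\<^sup>L (distr P ?N (\<lambda>w. restrict (\<lambda>Q. birth (X w) (shift_cube z Q)) (cubes d))) ?g"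
    by (rule integral_distr[OF m1 g, symmetric])
  also have "\<dots> = integral\<^sup>L (distr P ?N (\<lambda>w. birth_family d (X w))) ?g"
    using stat z by (simp add: stationary_def)
  also have "\<dots> = expectation (\<lambda>w. ?g (birth_family d (X w)))" by (rule integral_distr[OF m2 g])
  also have "\<dots> = expectation (\<lambda>w. ?g (birth (X w)))" unfolding birth_family_def r ..
  finally show ?thesis .
qed

lemma indep_blocks:
  assumes "length v = d" "length v' = d" "v \<noteq> v'" "N = 2 * m + R + 1"
  shows "indep_var borel (\<lambda>w. real (sublevel_rank q (block d m (lattice_point N v)) s t (birth (X w))))
     borel (\<lambda>w. real (sublevel_rank q (block d m (lattice_point N v')) s t (birth (X w))))"
proof -
  let ?A = "block d m (lattice_point N v)" and ?B = "block d m (lattice_point N v')"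
  let ?g = "\<lambda>S \<eta>. real (sublevel_rank q S s t \<eta>)"
  have sub: "?A \<subseteq> cubes d" "?B \<subseteq> cubes d" using assms by (auto intro!: block_subset_cubes)
  have "\<forall>Q\<in>?A. \<forall>Q'\<in>?B. cube_dist Q Q' > real R"
    using cube_dist_blocks[OF assms(1-3) _ _ assms(4)] by blast
  then have "indep_var (PiM ?A (\<lambda>_. borel)) (\<lambda>w. restrict (birth (X w)) ?A)
          (PiM ?B (\<lambda>_. borel)) (\<lambda>w. restrict (birth (X w)) ?B)"
    using dep sub unfolding R_dependent_def by blast
  then have "indep_var borel (?g ?A \<circ> (\<lambda>w. restrict (birth (X w)) ?A)) borel (?g ?B \<circ> (\<lambda>w. restrict (birth (X w)) ?B))"
    by (rule indep_var_compose) (intro measurable_sublevel_rank measurable_component_singleton; simp)+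
  moreover have "?g S (restrict \<eta> S) = ?g S \<eta>" for S \<eta>
    by (intro arg_cong[where f=real] sublevel_rank_cong) simp
  ultimately show ?thesis by (simp add: comp_def)
qed

definition box_rank :: "real \<Rightarrow> real \<Rightarrow> nat \<Rightarrow> 'w \<Rightarrow> real" where
  "box_rank s t n w = real (sublevel_rank q (box_cubes d n) s t (birth (X w)))"

lemma measurable_box_rank [measurable]: "box_rank s t n \<in> borel_measurable P"
  unfolding box_rank_def[abs_def] using box_cubes_subset_cubes by (intro measurable_rank_births) auto

lemma box_rank_bounds: "0 \<le> box_rank s t n w" "box_rank s t n w \<le> real ((4 * n + 1) ^ d)"
  unfolding box_rank_def card_box_cubes[symmetric] using sublevel_rank_le[OF finite_box_cubes]
  by (simp_all only: of_nat_0_le_iff of_nat_le_iff)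

text \<open>The spacing \<open>2 * m + R + 1\<close> leaves gaps of width \<open>R + 1\<close>
  between blocks. For \<open>m \<le> n\<close> the grid radius is the largest one that keeps all
  blocks inside the box of size \<open>n\<close>.\<close>

definition block_sum :: "real \<Rightarrow> real \<Rightarrow> nat \<Rightarrow> nat \<Rightarrow> 'w \<Rightarrow> real" where
  "block_sum s t m n w = (\<Sum>v\<in>grid d ((n - m) div (2 * m + R + 1)).
     real (sublevel_rank q (block d m (lattice_point (2 * m + R + 1) v)) s t (birth (X w))))"

lemma grid_length: "v \<in> grid d J \<Longrightarrow> length v = d"
  by (simp add: grid_def)

lemma block_rank_bound:
  "v \<in> grid d J \<Longrightarrow> real (sublevel_rank q (block d m (lattice_point N v)) s t \<eta>) \<le> real ((4 * m + 1) ^ d)"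
  using sublevel_rank_le[OF finite_block, of q d m "lattice_point N v" s t \<eta>] card_block[of "lattice_point N v" d m]
  by (simp only: of_nat_le_iff length_lattice_point grid_length)

lemma block_sum_AE:
  "AE w in P. (\<lambda>k. block_sum s t m (k\<^sup>2) w / real (((2 * ((k\<^sup>2 - m) div (2 * m + R + 1)) + 1) * (4 * m + 1)) ^ d))
     \<longlonglongrightarrow> expectation (box_rank s t m) / real ((4 * m + 1) ^ d)"
proof -
  let ?N = "2 * m + R + 1"
  let ?J = "\<lambda>k. (k\<^sup>2 - m) div ?N"
  let ?C = "real ((4 * m + 1) ^ d)"
  let ?e = "expectation (box_rank s t m)"
  let ?Y = "\<lambda>v w. real (sublevel_rank q (block d m (lattice_point ?N v)) s t (birth (X w)))"
  define Z where "Z k w = (\<Sum>v\<in>grid d (?J k). ?Y v w) / card (grid d (?J k)) - ?e" for k :: nat and w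
  have Ym: "?Y v \<in> borel_measurable P" if "v \<in> grid d J" for v J
    using block_subset_cubes[of "lattice_point ?N v" d m] grid_length[OF that]
    by (intro measurable_rank_births) auto
  have Zm: "Z k \<in> borel_measurable P" for k
    unfolding Z_def[abs_def] using Ym by (intro borel_measurable_diff borel_measurable_divide borel_measurable_sum) auto
  have cg: "card (grid d J) > 0" for J unfolding card_grid by simp
  have e: "0 \<le> ?e" by (intro Bochner_Integration.integral_nonneg box_rank_bounds)
  have Zb: "\<bar>Z k w\<bar> \<le> ?C + ?e" for k w
  proof -
    have "(\<Sum>v\<in>grid d (?J k). ?Y v w) \<le> card (grid d (?J k)) * ?C"
      using block_rank_bound by (intro sum_bounded_above) auto
    then have "(\<Sum>v\<in>grid d (?J k). ?Y v w) / card (grid d (?J k)) \<le> ?C"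
      using cg[of "?J k"] by (simp add: divide_le_eq mult.commute)
    moreover have "0 \<le> (\<Sum>v\<in>grid d (?J k). ?Y v w) / card (grid d (?J k))" by (simp add: sum_nonneg)
    ultimately show ?thesis unfolding Z_def using e by linarith
  qed
  have Zi: "integrable P (\<lambda>w. (Z k w)\<^sup>2)" for k
  proof (rule integrable_const_bound[of _ "(?C + ?e)\<^sup>2"])
    show "AE w in P. norm ((Z k w)\<^sup>2) \<le> (?C + ?e)\<^sup>2"
      using Zb by (intro AE_I2) (simp add: abs_le_square_iff[symmetric] e)
  qed (use Zm in measurable)
  have "AE w in P. (\<lambda>k. Z k w) \<longlonglongrightarrow> 0"
  proof (rule AE_tendsto_0_if_second_moments_summable[OF Zm Zi])
    fix k
    have "expectation (\<lambda>w. (Z k w)\<^sup>2) \<le> ?C\<^sup>2 / card (grid d (?J k))"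
      unfolding Z_def
    proof (rule second_moment_average_pairwise_indep)
      show "grid d (?J k) \<noteq> {}" using cg[of "?J k"] by auto
      show "?Y v \<in> borel_measurable P" if "v \<in> grid d (?J k)" for v using Ym[OF that] .
      show "0 \<le> ?Y v w \<and> ?Y v w \<le> ?C" if "v \<in> grid d (?J k)" for v w
        using block_rank_bound[OF that] by auto
      show "expectation (?Y v) = ?e" if "v \<in> grid d (?J k)" for v
        unfolding box_rank_def[abs_def] using grid_length[OF that] by (intro expectation_block) simp
      show "indep_var borel (?Y v) borel (?Y v')" if "v \<in> grid d (?J k)" "v' \<in> grid d (?J k)" "v \<noteq> v'" for v v'
        using that grid_length by (intro indep_blocks) auto
    qed simp
    \<comment> \<open>The case \<open>k = 0\<close> is separate because \<open>1 / 0 = 0\<close>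
      would make the bound vanish.\<close>
    also have "\<dots> \<le> (if k = 0 then ?C\<^sup>2 else ?C\<^sup>2 * real (m + ?N) * (1 / real k ^ 2))"
    proof (cases "k = 0")
      case True
      have "?C\<^sup>2 / card (grid d (?J k)) \<le> ?C\<^sup>2 / 1"
        using cg[of "?J k"] by (intro divide_left_mono) auto
      then show ?thesis using True by simp
    next
      case False
      \<comment> \<open>One power of the side length of the grid is enough: with
        \<open>n = k ^ 2\<close> the number of blocks is at least of order
        \<open>k ^ 2\<close>.\<close>
      have d: "d > 0" using q_less by simp
      have "?J k + 1 \<le> 2 * ?J k + 1" by simp
      also have "\<dots> \<le> (2 * ?J k + 1) ^ d" using d by (intro self_le_power) auto
      finally have c1: "?J k + 1 \<le> card (grid d (?J k))" by (simp only: card_grid)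
      have "k\<^sup>2 \<le> m + (k\<^sup>2 - m)" by simp
      also have "\<dots> \<le> m + ?N * (?J k + 1)"
        using dividend_less_times_div[of ?N "k\<^sup>2 - m"] by simp
      also have "\<dots> \<le> (m + ?N) * (?J k + 1)" by simp
      also have "\<dots> \<le> (m + ?N) * card (grid d (?J k))" using c1 by (intro mult_left_mono) auto
      finally have "real (k\<^sup>2) \<le> real ((m + ?N) * card (grid d (?J k)))" by (simp only: of_nat_le_iff)
      then have "1 / real (card (grid d (?J k))) \<le> real (m + ?N) * (1 / real k ^ 2)"
        using cg[of "?J k"] False by (simp add: field_simps)
      then have "?C\<^sup>2 * (1 / real (card (grid d (?J k)))) \<le> ?C\<^sup>2 * (real (m + ?N) * (1 / real k ^ 2))"
        by (intro mult_left_mono) auto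
      then show ?thesis using False by simp
    qed
    finally show "expectation (\<lambda>w. (Z k w)\<^sup>2) \<le> (if k = 0 then ?C\<^sup>2 else ?C\<^sup>2 * real (m + ?N) * (1 / real k ^ 2))" .
  next
    have "summable (\<lambda>k. ?C\<^sup>2 * real (m + ?N) * (1 / real k ^ 2))"
      using inverse_power_summable[of 2, where 'a=real] by (intro summable_mult) (simp add: inverse_eq_divide)
    moreover have "\<forall>\<^sub>F k in sequentially. (if k = 0 then ?C\<^sup>2 else ?C\<^sup>2 * real (m + ?N) * (1 / real k ^ 2))
        = ?C\<^sup>2 * real (m + ?N) * (1 / real k ^ 2)"
      using eventually_gt_at_top[of 0] by eventually_elim simp
    ultimately show "summable (\<lambda>k. if k = 0 then ?C\<^sup>2 else ?C\<^sup>2 * real (m + ?N) * (1 / real k ^ 2))"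
      using summable_cong by fast
  qed
  then show ?thesis
  proof eventually_elim
    case (elim w)
    have "(\<lambda>k. (Z k w + ?e) / ?C) \<longlonglongrightarrow> (0 + ?e) / ?C" by (intro tendsto_intros elim) simp
    moreover have "(Z k w + ?e) / ?C = block_sum s t m (k\<^sup>2) w / real (((2 * ?J k + 1) * (4 * m + 1)) ^ d)" for k
      unfolding Z_def block_sum_def card_grid power_mult_distrib of_nat_mult by simp
    ultimately show ?case by simp
  qed
qed

text \<open>The error bounds hold for every outcome, so null sets arise only from the block
  averages, one for each of the countably many \<open>m\<close>.\<close>

theorem box_rank_AE:
  obtains a where "AE w in P. (\<lambda>n. box_rank s t n w / box_volume d n) \<longlonglongrightarrow> a"
proof -
  define y where "y m = expectation (box_rank s t m) / real ((4 * m + 1) ^ d)" for m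
  have "AE w in P. \<forall>m. (\<lambda>k. block_sum s t m (k\<^sup>2) w / real (((2 * ((k\<^sup>2 - m) div (2 * m + R + 1)) + 1) * (4 * m + 1)) ^ d))
     \<longlonglongrightarrow> y m"
    unfolding AE_all_countable y_def using block_sum_AE by blast
  then have "AE w in P. (\<lambda>n. box_rank s t n w / box_volume d n) \<longlonglongrightarrow> 2 ^ d * lim y"
  proof eventually_elim
    case (elim w)
    let ?K = "\<lambda>n c. {Q \<in> box_cubes d n. birth (X w) Q \<le> ennreal c}"
    have "(\<lambda>n. box_rank s t n w / real ((4 * n + 1) ^ d)) \<longlonglongrightarrow> lim y"
    proof (rule near_additive_limit(2)[where S="\<lambda>m n. block_sum s t m n w" and R=R])
      fix m n :: nat assume "m \<le> n"
      let ?N = "2 * m + R + 1"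
      let ?J = "(n - m) div ?N"
      have J: "?N * ?J + m \<le> n" using \<open>m \<le> n\<close> times_div_less_eq_dividend[of ?N "n - m"] by linarith
      have "?K n c \<inter> block d m (lattice_point ?N v) = {Q \<in> block d m (lattice_point ?N v). birth (X w) Q \<le> ennreal c}"
        if "v \<in> grid d ?J" for v c using block_subset_box[OF that J] by auto
      then have "(\<Sum>v\<in>grid d ?J. real (hom_rank q (?K n s \<inter> block d m (lattice_point ?N v)) (?K n t \<inter> block d m (lattice_point ?N v))))
          = block_sum s t m n w"
        unfolding block_sum_def sublevel_rank_def by (intro sum.cong refl) simp
      moreover have "\<bar>real (hom_rank q (?K n s) (?K n t)) - (\<Sum>v\<in>grid d ?J. real (hom_rank q (?K n s \<inter> block d m (lattice_point ?N v)) (?K n t \<inter> block d m (lattice_point ?N v))))\<bar>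
          \<le> 2 * (real ((4 * n + 1) ^ d) - real (((2 * ?J + 1) * (4 * m + 1)) ^ d))"
        by (rule hom_rank_blocks[OF _ J]) auto
      ultimately show "\<bar>box_rank s t n w - block_sum s t m n w\<bar>
          \<le> 2 * (real ((4 * n + 1) ^ d) - real (((2 * ?J + 1) * (4 * m + 1)) ^ d))"
        by (simp only: box_rank_def sublevel_rank_def)
    next
      fix n n' :: nat assume nn: "n \<le> n'"
      have "?K n' c \<inter> box_cubes d n = ?K n c" for c using box_cubes_mono[OF nn] by auto
      then show "\<bar>box_rank s t n' w - box_rank s t n w\<bar> \<le> 2 * (real ((4 * n' + 1) ^ d) - real ((4 * n + 1) ^ d))"
        using hom_rank_box_diff[OF nn, of "?K n' s" d "?K n' t" q] by (simp only: box_rank_def sublevel_rank_def) auto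
    next
      fix m n
      let ?J = "(n - m) div (2 * m + R + 1)"
      have "block_sum s t m n w \<le> card (grid d ?J) * real ((4 * m + 1) ^ d)"
        unfolding block_sum_def using block_rank_bound by (intro sum_bounded_above) auto
      moreover have "0 \<le> block_sum s t m n w" unfolding block_sum_def by (intro sum_nonneg) simp
      ultimately show "\<bar>block_sum s t m n w\<bar> \<le> real (((2 * ?J + 1) * (4 * m + 1)) ^ d)"
        unfolding card_grid power_mult_distrib of_nat_mult by simp
    next
      fix m
      show "(\<lambda>k. block_sum s t m (k\<^sup>2) w / real (((2 * ((k\<^sup>2 - m) div (2 * m + R + 1)) + 1) * (4 * m + 1)) ^ d)) \<longlonglongrightarrow> y m"
        using elim by blast
    qed
    \<comment> \<open>Change of normalisation from cube counts to volumes: asymptotically there are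
      \<open>2 ^ d\<close> cubes per unit volume, a point or an interval in every
      coordinate.\<close>
    moreover have "(\<lambda>n. ((4 * real n + 1) / (2 * real n + 0)) ^ d) \<longlonglongrightarrow> (4 / 2) ^ d"
      by (intro tendsto_power affine_quotient_tendsto) simp
    ultimately have "(\<lambda>n. ((4 * real n + 1) / (2 * real n + 0)) ^ d * (box_rank s t n w / real ((4 * n + 1) ^ d))) \<longlonglongrightarrow> (4 / 2) ^ d * lim y"
      by (intro tendsto_mult)
    moreover have "((4 * real n + 1) / (2 * real n + 0)) ^ d * (box_rank s t n w / real ((4 * n + 1) ^ d)) = box_rank s t n w / box_volume d n" for n
    proof -
      have "real ((4 * n + 1) ^ d) = (4 * real n + 1) ^ d" by (simp add: add.commute)
      moreover have "(4 * real n + 1) ^ d \<noteq> 0" by simp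
      ultimately show ?thesis by (simp add: box_volume_def power_divide)
    qed
    ultimately show ?case by simp
  qed
  then show ?thesis by (rule that)
qed

end

section \<open>Convergence of the persistence diagrams\<close>

text \<open>A Dynkin argument over the corners. Complements require the total mass to be measurable
  beforehand, which is derived from finite differences of corners.\<close>

lemma measurable_emeasure_from_corners:
  fixes \<kappa> :: "'w \<Rightarrow> (ennreal \<times> ennreal) measure"
  assumes sets: "\<And>w. w \<in> space P \<Longrightarrow> sets (\<kappa> w) = sets Delta_borel"
    and fin: "\<And>w. w \<in> space P \<Longrightarrow> finite_measure (\<kappa> w)"
    and corner: "\<And>s t. 0 \<le> s \<Longrightarrow> s \<le> t \<Longrightarrow> (\<lambda>w. emeasure (\<kappa> w) (corner s t)) \<in> borel_measurable P"
    and A: "A \<in> sets Delta_borel"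
  shows "(\<lambda>w. emeasure (\<kappa> w) A) \<in> borel_measurable P"
proof -
  have fin': "emeasure (\<kappa> w) B \<noteq> \<infinity>" if "w \<in> space P" for w B
    using finite_measure.emeasure_finite[OF fin[OF that]] by simp
  have corners_sets: "C \<in> sets Delta_borel" if "C \<in> corners" for C
    using that corner_sets by auto
  have diff: "(\<lambda>w. emeasure (\<kappa> w) (B - C)) \<in> borel_measurable P"
    if "B \<in> sets Delta_borel" "C \<in> sets Delta_borel" "C \<subseteq> B"
      "(\<lambda>w. emeasure (\<kappa> w) B) \<in> borel_measurable P" "(\<lambda>w. emeasure (\<kappa> w) C) \<in> borel_measurable P" for B C
  proof -
    note [measurable] = that(4,5)
    have "(\<lambda>w. emeasure (\<kappa> w) B - emeasure (\<kappa> w) C) \<in> borel_measurable P" by measurable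
    moreover have "emeasure (\<kappa> w) (B - C) = emeasure (\<kappa> w) B - emeasure (\<kappa> w) C" if "w \<in> space P" for w
      using fin'[OF that] sets[OF that] \<open>B \<in> sets Delta_borel\<close> \<open>C \<in> sets Delta_borel\<close> \<open>C \<subseteq> B\<close>
      by (intro emeasure_Diff) auto
    ultimately show ?thesis by (simp cong: measurable_cong)
  qed
  have finite_diff: "(\<lambda>w. emeasure (\<kappa> w) (B - \<Union>(set Cs))) \<in> borel_measurable P"
    if "set Cs \<subseteq> corners" "B \<in> corners" for Cs B
    using that
  proof (induction Cs arbitrary: B)
    case Nil
    then show ?case using corner by auto
  next
    case (Cons C Cs)
    have BC: "B \<inter> C \<in> corners" using Cons.prems Int_stable_corners by (auto simp: Int_stable_def)
    have pre: "set Cs \<subseteq> corners" "B \<in> corners" using Cons.prems by simp_all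
    then have "set Cs \<subseteq> sets Delta_borel" using corners_sets by blast
    then have U: "\<Union>(set Cs) \<in> sets Delta_borel" by (intro sets.finite_Union) simp
    \<comment> \<open>The intersection \<open>B \<inter> C\<close> is again a corner, so the
      induction only subtracts finite masses of nested sets.\<close>
    have eq: "B - \<Union>(set (C # Cs)) = (B - \<Union>(set Cs)) - (B \<inter> C - \<Union>(set Cs))" by auto
    show ?case
      unfolding eq
    proof (rule diff)
      show "(\<lambda>w. emeasure (\<kappa> w) (B - \<Union>(set Cs))) \<in> borel_measurable P"
        "(\<lambda>w. emeasure (\<kappa> w) (B \<inter> C - \<Union>(set Cs))) \<in> borel_measurable P"
        by (rule Cons.IH[OF pre], rule Cons.IH[OF pre(1) BC])
      show "B - \<Union>(set Cs) \<in> sets Delta_borel" "B \<inter> C - \<Union>(set Cs) \<in> sets Delta_borel"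
        by (rule sets.Diff[OF corners_sets[OF pre(2)] U], rule sets.Diff[OF corners_sets[OF BC] U])
    qed auto
  qed
  \<comment> \<open>\<open>Delta\<close> is not a corner itself; a countable cover by corners is
    made disjoint, each piece being a corner minus finitely many others.\<close>
  have total: "(\<lambda>w. emeasure (\<kappa> w) Delta) \<in> borel_measurable P"
  proof -
    obtain C :: "nat \<Rightarrow> _" where C: "\<And>i. C i \<in> corners" and U: "(\<Union>i. C i) = Delta"
      using countable_corner_cover by blast
    have dj: "disjointed C i = C i - \<Union>(set (map C [0..<i]))" for i by (simp add: disjointed_def)
    have dm: "(\<lambda>w. emeasure (\<kappa> w) (disjointed C i)) \<in> borel_measurable P" for i
      unfolding dj using C by (intro finite_diff) auto
    have ds: "range (disjointed C) \<subseteq> sets Delta_borel"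
      using corners_sets[OF C] by (intro sets.range_disjointed_sets) auto
    have "(\<lambda>w. \<Sum>i. emeasure (\<kappa> w) (disjointed C i)) \<in> borel_measurable P"
      using dm by (intro borel_measurable_suminf_order) 
    moreover have "emeasure (\<kappa> w) Delta = (\<Sum>i. emeasure (\<kappa> w) (disjointed C i))" if "w \<in> space P" for w
      using suminf_emeasure[of "disjointed C" "\<kappa> w"] ds sets[OF that] disjoint_family_disjointed[of C]
        UN_disjointed_eq[of C] U by simp
    ultimately show ?thesis by (simp cong: measurable_cong)
  qed
  have "A \<in> sigma_sets Delta corners" using A sets_Delta_borel by simp
  with Int_stable_corners corners_subset_Pow show ?thesis
  proof (induction rule: sigma_sets_induct_disjoint)
    case (basic A)
    then show ?case using corner by auto
  next
    case empty
    then show ?case by simp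
  next
    case (compl A)
    have D: "Delta \<in> sets Delta_borel" using sets.top[of Delta_borel] by simp
    have A: "A \<in> sets Delta_borel" using compl sets_Delta_borel by simp
    show ?case using A D compl total sets.sets_into_space[OF A] by (intro diff) auto
  next
    case (union A)
    have "(\<lambda>w. \<Sum>i. emeasure (\<kappa> w) (A i)) \<in> borel_measurable P"
      using union by (intro borel_measurable_suminf_order)
    moreover have "emeasure (\<kappa> w) (\<Union>i. A i) = (\<Sum>i. emeasure (\<kappa> w) (A i))" if "w \<in> space P" for w
      using suminf_emeasure[of A "\<kappa> w"] union sets[OF that] sets_Delta_borel by simp
    ultimately show ?case by (simp cong: measurable_cong)
  qed
qed

lemma sets_expected_measure [simp]: "sets (expected_measure P \<kappa>) = sets Delta_borel"
  using sets.sigma_sets_eq[of Delta_borel] sets.space_closed[of Delta_borel]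
  by (simp add: expected_measure_def sets_measure_of)

text \<open>\<open>measure_of\<close> adopts a set function only if it is countably additive, which
  here means exchanging sum and integral; this is where measurability of the masses in
  \<open>w\<close> enters.\<close>

lemma emeasure_expected_measure:
  assumes sets: "\<And>w. w \<in> space P \<Longrightarrow> sets (\<kappa> w) = sets Delta_borel"
    and meas: "\<And>A. A \<in> sets Delta_borel \<Longrightarrow> (\<lambda>w. emeasure (\<kappa> w) A) \<in> borel_measurable P"
    and A: "A \<in> sets Delta_borel"
  shows "emeasure (expected_measure P \<kappa>) A = (\<integral>\<^sup>+ w. emeasure (\<kappa> w) A \<partial>P)"
proof (rule emeasure_measure_of[OF expected_measure_def])
  show "sets Delta_borel \<subseteq> Pow Delta" using sets.space_closed[of Delta_borel] by simp
  show "A \<in> sets (expected_measure P \<kappa>)" using A by simp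
  show "positive (sets (expected_measure P \<kappa>)) (\<lambda>A. \<integral>\<^sup>+ w. emeasure (\<kappa> w) A \<partial>P)"
    by (simp add: positive_def)
  show "countably_additive (sets (expected_measure P \<kappa>)) (\<lambda>A. \<integral>\<^sup>+ w. emeasure (\<kappa> w) A \<partial>P)"
  proof (rule countably_additiveI)
    fix F :: "nat \<Rightarrow> _" assume F: "range F \<subseteq> sets (expected_measure P \<kappa>)" "disjoint_family F"
    have "(\<Sum>i. \<integral>\<^sup>+ w. emeasure (\<kappa> w) (F i) \<partial>P) = (\<integral>\<^sup>+ w. (\<Sum>i. emeasure (\<kappa> w) (F i)) \<partial>P)"
      using F meas by (intro nn_integral_suminf[symmetric]) auto
    also have "\<dots> = (\<integral>\<^sup>+ w. emeasure (\<kappa> w) (\<Union>i. F i) \<partial>P)"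
      using F sets by (intro nn_integral_cong suminf_emeasure) auto
    finally show "(\<Sum>i. \<integral>\<^sup>+ w. emeasure (\<kappa> w) (F i) \<partial>P) = (\<integral>\<^sup>+ w. emeasure (\<kappa> w) (\<Union>i. F i) \<partial>P)" .
  qed
qed

lemma integral_scale_measure:
  fixes f :: "'a \<Rightarrow> real"
  assumes "0 \<le> c" "f \<in> borel_measurable M"
  shows "integral\<^sup>L (scale_measure (ennreal c) M) f = c * integral\<^sup>L M f"
proof -
  have "scale_measure (ennreal c) M = density M (\<lambda>_. ennreal c)"
    by (rule measure_eqI) (auto simp: emeasure_density_const)
  then show ?thesis using assms by (simp add: integral_real_density)
qed

lemma finite_measure_scale_measure:
  assumes "finite_measure M"
  shows "finite_measure (scale_measure (ennreal c) M)"
  using finite_measure.emeasure_finite[OF assms, of "space M"]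
  by (intro finite_measureI) (simp add: space_scale_measure ennreal_mult_eq_top_iff)

lemma finite_measure_atoms: "set xs \<subseteq> Delta \<Longrightarrow> finite_measure (atoms xs)"
  using emeasure_atoms[of xs Delta] sets.top[of Delta_borel] by (intro finite_measureI) simp

lemma measure_atoms_Delta: "set xs \<subseteq> Delta \<Longrightarrow> measure (atoms xs) Delta \<le> real (length xs)"
  using emeasure_atoms[of xs Delta] sets.top[of Delta_borel] size_filter_mset_lesseq[of "\<lambda>p. p \<in> Delta" "mset xs"]
  by (simp add: measure_def)

section \<open>Diagrams of the boxes, their means and the common limit\<close>

context dependent_cubical_filtration
begin

abbreviation diagram :: "nat \<Rightarrow> 'w \<Rightarrow> (ennreal \<times> ennreal) measure" where
  "diagram n w \<equiv> pd q (restrict_box n (X w))"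

lemma diagram_eq_atoms:
  assumes w: "w \<in> space P"
  obtains xs where "diagram n w = atoms xs" "set xs \<subseteq> Delta" "length xs \<le> (4 * n + 1) ^ d"
    "\<And>s t. 0 \<le> s \<Longrightarrow> s \<le> t \<Longrightarrow> emeasure (atoms xs) (corner s t) = ennreal (box_rank s t n w)"
proof -
  let ?Y = "restrict_box n (X w)"
  obtain xs where xs: "mset xs = pd_points q ?Y" using ex_mset by blast
  have spec: "set_mset (pd_points q ?Y) \<subseteq> Delta" "size (pd_points q ?Y) \<le> card (box_cubes d n)"
    "\<And>s t. 0 \<le> s \<Longrightarrow> s \<le> t \<Longrightarrow>
      size (filter_mset (\<lambda>p. p \<in> corner s t) (pd_points q ?Y)) = hom_rank q (?Y s) (?Y t)"
    by (rule pd_points_spec[OF finite_box_cubes[of d n]], rule restrict_box_eq[OF w]; assumption)+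
  have sub: "set xs \<subseteq> Delta" using spec(1) xs by (metis set_mset_mset)
  have "length xs \<le> (4 * n + 1) ^ d" using spec(2) xs unfolding card_box_cubes by (metis size_mset)
  moreover have "emeasure (atoms xs) (corner s t) = ennreal (box_rank s t n w)" if "0 \<le> s" "s \<le> t" for s t
    using that spec(3)[OF that] restrict_box_eq[OF w, of s n] restrict_box_eq[OF w, of t n]
    by (simp add: emeasure_atoms[OF sub corner_sets] xs box_rank_def sublevel_rank_def ennreal_of_nat_eq_real_of_nat)
  ultimately show ?thesis using that[of xs] pd_eq_atoms[OF xs sub] sub by simp
qed

lemma diagram_facts:
  assumes w: "w \<in> space P"
  shows "sets (diagram n w) = sets Delta_borel" "finite_measure (diagram n w)"
    "measure (diagram n w) Delta \<le> real ((4 * n + 1) ^ d)"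
    "0 \<le> s \<Longrightarrow> s \<le> t \<Longrightarrow> emeasure (diagram n w) (corner s t) = ennreal (box_rank s t n w)"
proof -
  obtain xs where xs: "diagram n w = atoms xs" "set xs \<subseteq> Delta" "length xs \<le> (4 * n + 1) ^ d"
    "\<And>s t. 0 \<le> s \<Longrightarrow> s \<le> t \<Longrightarrow> emeasure (atoms xs) (corner s t) = ennreal (box_rank s t n w)"
    using diagram_eq_atoms[OF w] by blast
  show "sets (diagram n w) = sets Delta_borel" "finite_measure (diagram n w)"
    "0 \<le> s \<Longrightarrow> s \<le> t \<Longrightarrow> emeasure (diagram n w) (corner s t) = ennreal (box_rank s t n w)"
    using xs finite_measure_atoms by auto
  have "real (length xs) \<le> real ((4 * n + 1) ^ d)" using xs(3) by (simp only: of_nat_le_iff)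
  then show "measure (diagram n w) Delta \<le> real ((4 * n + 1) ^ d)"
    unfolding xs(1) using measure_atoms_Delta[OF xs(2)] by linarith
qed

lemma measurable_emeasure_diagram:
  assumes "A \<in> sets Delta_borel"
  shows "(\<lambda>w. emeasure (diagram n w) A) \<in> borel_measurable P"
proof (rule measurable_emeasure_from_corners[OF _ _ _ assms])
  fix s t :: real assume st: "0 \<le> s" "s \<le> t"
  have "(\<lambda>w. ennreal (box_rank s t n w)) \<in> borel_measurable P" by measurable
  then show "(\<lambda>w. emeasure (diagram n w) (corner s t)) \<in> borel_measurable P"
    using diagram_facts(4)[OF _ st] by (simp cong: measurable_cong)
qed (use diagram_facts in auto)

lemma expected_diagram_facts:
  shows "finite_measure (expected_measure P (diagram n))"
    "measure (expected_measure P (diagram n)) Delta \<le> real ((4 * n + 1) ^ d)"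
    "0 \<le> s \<Longrightarrow> s \<le> t \<Longrightarrow> measure (expected_measure P (diagram n)) (corner s t) = expectation (box_rank s t n)"
proof -
  let ?E = "expected_measure P (diagram n)"
  have D: "Delta \<in> sets Delta_borel" using sets.top[of Delta_borel] by simp
  have eE: "emeasure ?E A = (\<integral>\<^sup>+ w. emeasure (diagram n w) A \<partial>P)" if "A \<in> sets Delta_borel" for A
    using that by (intro emeasure_expected_measure diagram_facts(1) measurable_emeasure_diagram)
  have "emeasure ?E Delta \<le> (\<integral>\<^sup>+ w. ennreal (real ((4 * n + 1) ^ d)) \<partial>P)"
    unfolding eE[OF D]
  proof (intro nn_integral_mono)
    fix w assume w: "w \<in> space P"
    show "emeasure (diagram n w) Delta \<le> ennreal (real ((4 * n + 1) ^ d))"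
      using diagram_facts(3)[OF w, of n] finite_measure.emeasure_eq_measure[OF diagram_facts(2)[OF w, of n]]
      by (simp only: ennreal_leI)
  qed
  also have "\<dots> = ennreal (real ((4 * n + 1) ^ d))" by (simp add: emeasure_space_1)
  finally have le: "emeasure ?E Delta \<le> ennreal (real ((4 * n + 1) ^ d))" .
  have sp: "space ?E = Delta" using sets_eq_imp_space_eq[OF sets_expected_measure] by simp
  show fin: "finite_measure ?E"
    using le by (intro finite_measureI) (metis sp ennreal_neq_top infinity_ennreal_def top.extremum_uniqueI)
  show "measure ?E Delta \<le> real ((4 * n + 1) ^ d)"
    using le unfolding finite_measure.emeasure_eq_measure[OF fin] by (simp only: ennreal_le_iff of_nat_0_le_iff)
  show "measure ?E (corner s t) = expectation (box_rank s t n)" if st: "0 \<le> s" "s \<le> t"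
  proof -
    have "emeasure ?E (corner s t) = (\<integral>\<^sup>+ w. ennreal (box_rank s t n w) \<partial>P)"
      unfolding eE[OF corner_sets[OF st(2)]] using diagram_facts(4)[OF _ st] by (intro nn_integral_cong) auto
    also have "\<dots> = ennreal (expectation (box_rank s t n))"
    proof (rule nn_integral_eq_integral)
      show "integrable P (box_rank s t n)"
        using box_rank_bounds by (intro integrable_const_bound[of _ "real ((4 * n + 1) ^ d)"]) auto
    qed (use box_rank_bounds in auto)
    finally show ?thesis
      using box_rank_bounds by (simp add: measure_def Bochner_Integration.integral_nonneg)
  qed
qed

text \<open>For \<open>n \<ge> 1\<close> the base is \<open>2 + 1 / (2 * n)\<close>, at most 5/2,
  rounded up to 3. For \<open>n = 0\<close> the volume is 0 because \<open>d > 0\<close>, and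
  division by zero gives 0.\<close>

lemma volume_ratio: "1 / box_volume d n * real ((4 * n + 1) ^ d) \<le> 3 ^ d"
proof (cases "n = 0")
  case True
  then show ?thesis using q_less by (simp add: box_volume_def zero_power)
next
  case False
  have "1 / box_volume d n * real ((4 * n + 1) ^ d) = (real (4 * n + 1) / (2 * real n)) ^ d"
    by (simp add: box_volume_def power_divide)
  also have "\<dots> \<le> 3 ^ d" using False by (intro power_mono) (auto simp: divide_le_eq)
  finally show ?thesis .
qed

lemma inverse_volume_nonneg: "0 \<le> 1 / box_volume d n"
  by (simp add: box_volume_def)

lemma scaled_mass_le:
  assumes "measure N Delta \<le> real ((4 * n + 1) ^ d)"
  shows "measure (scale_measure (ennreal (1 / box_volume d n)) N) Delta \<le> 3 ^ d"
proof -
  have "measure (scale_measure (ennreal (1 / box_volume d n)) N) Delta = 1 / box_volume d n * measure N Delta"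
    using inverse_volume_nonneg by (rule measure_scale_measure)
  also have "\<dots> \<le> 1 / box_volume d n * real ((4 * n + 1) ^ d)"
    using assms inverse_volume_nonneg by (rule mult_left_mono)
  also have "\<dots> \<le> 3 ^ d" by (rule volume_ratio)
  finally show ?thesis .
qed

lemma scaled_diagram_corner:
  assumes "w \<in> space P" "0 \<le> s" "s \<le> t"
  shows "measure (scale_measure (ennreal (1 / box_volume d n)) (diagram n w)) (corner s t) = box_rank s t n w / box_volume d n"
  using inverse_volume_nonneg[of n] diagram_facts(4)[OF assms, of n] box_rank_bounds
  by (simp add: measure_def enn2real_mult)

text \<open>The conditions under which \<open>vague_comparison\<close> applies, packaged so that
  single outcomes and the expected diagrams can be treated alike.\<close>

definition corner_limits :: "(nat \<Rightarrow> (ennreal \<times> ennreal) measure) \<Rightarrow> (real \<Rightarrow> real \<Rightarrow> real) \<Rightarrow> bool" where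
  "corner_limits K a \<longleftrightarrow>
     (\<forall>n. finite_measure (K n) \<and> sets (K n) = sets Delta_borel \<and> measure (K n) Delta \<le> 3 ^ d) \<and>
     (\<forall>s\<in>\<rat>. \<forall>t\<in>\<rat>. 0 \<le> s \<longrightarrow> s \<le> t \<longrightarrow> (\<lambda>n. measure (K n) (corner s t)) \<longlonglongrightarrow> a s t)"

lemma vague_limit_exists:
  assumes w: "w \<in> space P"
    and lim: "\<And>s t. s \<in> \<rat> \<Longrightarrow> t \<in> \<rat> \<Longrightarrow> 0 \<le> s \<Longrightarrow> s \<le> t \<Longrightarrow> (\<lambda>n. box_rank s t n w / box_volume d n) \<longlonglongrightarrow> a s t"
  obtains \<mu> where "radon_Delta \<mu>" "\<And>K. corner_limits K a \<Longrightarrow> vague_lim K \<mu>"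
proof -
  let ?c = "\<lambda>n. 1 / box_volume d n"
  note c0 = inverse_volume_nonneg
  have "\<exists>xs. diagram n w = atoms xs \<and> set xs \<subseteq> Delta \<and> length xs \<le> (4 * n + 1) ^ d" for n
    by (rule diagram_eq_atoms[OF w, of n]) blast
  then obtain xs where xs: "\<And>n. diagram n w = atoms (xs n)" "\<And>n. set (xs n) \<subseteq> Delta" "\<And>n. length (xs n) \<le> (4 * n + 1) ^ d"
    by metis
  \<comment> \<open>Starting at box size 1 keeps the normalisation positive and gives
    \<open>4 * n + 1 \<le> 6 * n\<close>.\<close>
  have len: "length (xs (Suc n)) \<le> (6 * Suc n) ^ d" for n
    by (rule order_trans[OF xs(3)]) (intro power_mono, auto)
  obtain r M where r: "strict_mono r" and M: "finite_measure M" "sets M = sets Delta_borel"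
    and conv: "\<And>f. Cc_Delta f \<Longrightarrow> (\<lambda>n. (\<Sum>p\<leftarrow>xs (Suc (r n)). f p) / ((6 * Suc (r n)) ^ d)) \<longlonglongrightarrow> integral\<^sup>L M f"
    by (rule atomic_measures_vague_compact[of "\<lambda>n. xs (Suc n)" "\<lambda>n. (6 * Suc n) ^ d"])
      (rule len, simp, rule xs(2), rule that)
  \<comment> \<open>Compactness was applied with \<open>(6 * n) ^ d\<close>, which is
    \<open>3 ^ d\<close> times the volume; the factor restores the normalisation by volume.\<close>
  define \<mu> where "\<mu> = scale_measure (ennreal (3 ^ d)) M"
  have "radon_Delta \<mu>"
    unfolding radon_Delta_def \<mu>_def using M
    by (auto simp: less_top[symmetric] ennreal_mult_eq_top_iff finite_measure.emeasure_finite)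
  define \<nu> where "\<nu> n = scale_measure (ennreal (?c (Suc (r n)))) (diagram (Suc (r n)) w)" for n
  have \<nu>1: "finite_measure (\<nu> n)" "sets (\<nu> n) = sets Delta_borel" for n
    unfolding \<nu>_def using diagram_facts(1,2)[OF w] by (auto intro: finite_measure_scale_measure)
  have \<nu>2: "measure (\<nu> n) Delta \<le> 3 ^ d" for n
    unfolding \<nu>_def by (rule scaled_mass_le[OF diagram_facts(3)[OF w]])
  have sub: "filterlim (\<lambda>n. Suc (r n)) sequentially sequentially"
    using filterlim_compose[OF filterlim_Suc filterlim_subseq[OF r]] .
  have \<nu>3: "(\<lambda>n. measure (\<nu> n) (corner s t)) \<longlonglongrightarrow> a s t" if "s \<in> \<rat>" "t \<in> \<rat>" "0 \<le> s" "s \<le> t" for s t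
  proof -
    have "measure (\<nu> n) (corner s t) = box_rank s t (Suc (r n)) w / box_volume d (Suc (r n))" for n
      unfolding \<nu>_def by (rule scaled_diagram_corner[OF w that(3,4)])
    then show ?thesis using filterlim_compose[OF lim[OF that] sub] by simp
  qed
  have \<nu>4: "(\<lambda>n. integral\<^sup>L (\<nu> n) f) \<longlonglongrightarrow> integral\<^sup>L \<mu> f" if f: "Cc_Delta f" for f
  proof -
    have fm: "f \<in> borel_measurable Delta_borel" by (rule Cc_Delta_measurable[OF f refl])
    have "integral\<^sup>L (\<nu> n) f = 3 ^ d * ((\<Sum>p\<leftarrow>xs (Suc (r n)). f p) / real ((6 * Suc (r n)) ^ d))" for n
    proof -
      have "integral\<^sup>L (\<nu> n) f = ?c (Suc (r n)) * (\<Sum>p\<leftarrow>xs (Suc (r n)). f p)"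
        unfolding \<nu>_def xs(1) using c0 xs(2) fm
        by (subst integral_scale_measure) (auto simp: integral_atoms measurable_cong_sets[OF sets_atoms refl])
      moreover have "real ((6 * Suc (r n)) ^ d) = 3 ^ d * box_volume d (Suc (r n))"
        by (simp add: box_volume_def flip: power_mult_distrib)
      ultimately show ?thesis by (simp del: of_nat_power)
    qed
    moreover have "(\<lambda>n. 3 ^ d * ((\<Sum>p\<leftarrow>xs (Suc (r n)). f p) / real ((6 * Suc (r n)) ^ d))) \<longlonglongrightarrow> 3 ^ d * integral\<^sup>L M f"
      by (intro tendsto_mult tendsto_const conv[OF f])
    moreover have "integral\<^sup>L \<mu> f = 3 ^ d * integral\<^sup>L M f"
      unfolding \<mu>_def by (intro integral_scale_measure Cc_Delta_measurable[OF f M(2)]) simp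
    ultimately show ?thesis by simp
  qed
  have "vague_lim K \<mu>" if "corner_limits K a" for K
    unfolding vague_lim_def
  proof (intro allI impI)
    fix f assume f: "Cc_Delta f"
    have K: "finite_measure (K n)" "sets (K n) = sets Delta_borel" "measure (K n) Delta \<le> 3 ^ d" for n
      using that by (auto simp: corner_limits_def)
    \<comment> \<open>\<open>K\<close> runs through all indices while \<nu> follows the extracted
      subsequence. Their corner masses have the same limits, so the whole sequence inherits the
      limit of the subsequence.\<close>
    have "(\<lambda>n. integral\<^sup>L (K n) f - integral\<^sup>L (\<nu> n) f) \<longlonglongrightarrow> 0"
    proof (rule vague_comparison[OF K(1-3) \<nu>1 \<nu>2 _ f])
      fix s t :: real assume st: "s \<in> \<rat>" "t \<in> \<rat>" "0 \<le> s" "s \<le> t"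
      show "(\<lambda>n. measure (K n) (corner s t) - measure (\<nu> n) (corner s t)) \<longlonglongrightarrow> 0"
        using tendsto_diff[OF _ \<nu>3[OF st], of "\<lambda>n. measure (K n) (corner s t)" "a s t"] \<open>corner_limits K a\<close> st
        by (simp add: corner_limits_def)
    qed
    from tendsto_add[OF this \<nu>4[OF f]] show "(\<lambda>n. integral\<^sup>L (K n) f) \<longlonglongrightarrow> integral\<^sup>L \<mu> f" by simp
  qed
  with \<open>radon_Delta \<mu>\<close> show ?thesis by (rule that)
qed

lemma law_of_large_numbers:
  "\<exists>\<mu>. radon_Delta \<mu> \<and>
     vague_lim (\<lambda>n. scale_measure (ennreal (1 / box_volume d n)) (expected_measure P (diagram n))) \<mu> \<and>
     (AE w in P. vague_lim (\<lambda>n. scale_measure (ennreal (1 / box_volume d n)) (diagram n w)) \<mu>)"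
proof -
  let ?c = "\<lambda>n. 1 / box_volume d n"
  note c0 = inverse_volume_nonneg
  have "\<exists>a. AE w in P. (\<lambda>n. box_rank s t n w / box_volume d n) \<longlonglongrightarrow> a" for s t
    using box_rank_AE[of s t] by blast
  then obtain a where a: "\<And>s t. AE w in P. (\<lambda>n. box_rank s t n w / box_volume d n) \<longlonglongrightarrow> a s t"
    by metis
  \<comment> \<open>Rational parameters are countably many, so one null set serves all of them, and
    every remaining outcome has the same corner limits.\<close>
  define good where "good w \<longleftrightarrow> (\<forall>s\<in>\<rat>. \<forall>t\<in>\<rat>. (\<lambda>n. box_rank s t n w / box_volume d n) \<longlonglongrightarrow> a s t)" for w
  have AE_good: "AE w in P. good w"
    unfolding good_def using a by (simp add: AE_ball_countable countable_rat)
  have "\<exists>w\<in>space P. good w"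
  proof (rule ccontr)
    assume "\<not> ?thesis"
    then have "AE w in P. False" by (intro eventually_elim2[OF AE_good AE_space]) blast
    then show False by simp
  qed
  then obtain w0 where w0: "w0 \<in> space P" "good w0" by blast
  obtain \<mu> where \<mu>: "radon_Delta \<mu>"
    and vague: "\<And>K. corner_limits K a \<Longrightarrow> vague_lim K \<mu>"
    by (rule vague_limit_exists[of w0 a]) (use w0 in \<open>auto simp: good_def\<close>)
  have "vague_lim (\<lambda>n. scale_measure (ennreal (?c n)) (diagram n w)) \<mu>" if w: "w \<in> space P" "good w" for w
  proof (rule vague)
    show "corner_limits (\<lambda>n. scale_measure (ennreal (?c n)) (diagram n w)) a"
      unfolding corner_limits_def using w diagram_facts(1-3)[OF w(1)]
      by (intro conjI allI ballI impI finite_measure_scale_measure scaled_mass_le)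
        (simp_all add: good_def scaled_diagram_corner del: of_nat_power)
  qed
  then have "AE w in P. vague_lim (\<lambda>n. scale_measure (ennreal (?c n)) (diagram n w)) \<mu>"
    by (intro eventually_elim2[OF AE_good AE_space]) blast
  moreover have "vague_lim (\<lambda>n. scale_measure (ennreal (?c n)) (expected_measure P (diagram n))) \<mu>"
  proof (rule vague)
    have "(\<lambda>n. measure (scale_measure (ennreal (?c n)) (expected_measure P (diagram n))) (corner s t)) \<longlonglongrightarrow> a s t"
      if st: "s \<in> \<rat>" "t \<in> \<rat>" "0 \<le> s" "s \<le> t" for s t
    proof -
      have eq: "measure (scale_measure (ennreal (?c n)) (expected_measure P (diagram n))) (corner s t)
          = expectation (\<lambda>w. box_rank s t n w / box_volume d n)" for n
        using measure_scale_measure[OF c0[of n], of "expected_measure P (diagram n)" "corner s t"]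
          expected_diagram_facts(3)[OF st(3,4), of n] by simp
      \<comment> \<open>The almost sure limits are constants and the normalised ranks are at most
        \<open>3 ^ d\<close>, so the expected diagrams share the corner limits of the good
        outcomes.\<close>
      have "(\<lambda>n. expectation (\<lambda>w. box_rank s t n w / box_volume d n)) \<longlonglongrightarrow> expectation (\<lambda>w. a s t)"
      proof (rule integral_dominated_convergence[where w="\<lambda>_. 3 ^ d"])
        show "AE w in P. norm (box_rank s t n w / box_volume d n) \<le> 3 ^ d" for n
        proof (rule AE_I2)
          fix w
          have "?c n * box_rank s t n w \<le> ?c n * real ((4 * n + 1) ^ d)"
            using box_rank_bounds(2) c0 by (intro mult_left_mono) auto
          also have "\<dots> \<le> 3 ^ d" by (rule volume_ratio)
          finally have "?c n * box_rank s t n w \<le> 3 ^ d" .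
          moreover have "0 \<le> ?c n * box_rank s t n w" using c0 box_rank_bounds(1) by (rule mult_nonneg_nonneg)
          ultimately show "norm (box_rank s t n w / box_volume d n) \<le> 3 ^ d" by simp
        qed
      qed (use a in auto)
      then show ?thesis unfolding eq by (simp add: prob_space)
    qed
    then show "corner_limits (\<lambda>n. scale_measure (ennreal (?c n)) (expected_measure P (diagram n))) a"
      unfolding corner_limits_def using expected_diagram_facts(1,2)
      by (intro conjI allI ballI impI finite_measure_scale_measure scaled_mass_le)
        (simp_all del: of_nat_power)
  qed
  ultimately show ?thesis using \<mu> by blast
qed

end

theorem mainTheorem2:
  fixes P :: "'w measure" and d R q :: nat and X :: "'w \<Rightarrow> real \<Rightarrow> cube set"
  assumes "random_cubical_filtration P d X"
    and "stationary P d X"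
    and "R_dependent P d R X"
    and "q < d"
  shows "\<exists>\<mu>. radon_Delta \<mu> \<and>
     vague_lim (\<lambda>n. scale_measure (ennreal (1 / box_volume d n))
                     (expected_measure P (\<lambda>w. pd q (restrict_box n (X w))))) \<mu> \<and>
     (AE w in P. vague_lim (\<lambda>n. scale_measure (ennreal (1 / box_volume d n))
                     (pd q (restrict_box n (X w)))) \<mu>)"
proof -
  interpret dependent_cubical_filtration P d R q X using assms by unfold_locales
  show ?thesis by (rule law_of_large_numbers)
qed

end
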